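(* Let $A$ and $B$ be separable infinite-dimensional unital abelian $C^*$-algebras such that the fundamental groups $\pi_1(\mathcal{U}_0(A))$ and $\pi_1(\mathcal{U}_0(B))$ are finitely generated. Then $\mathcal{U}_0(A)$ and $\mathcal{U}_0(B)$ are topologically isomorphic (isomorphic as topological groups) if and only if $\pi_1(\mathcal{U}_0(A))$ is isomorphic to $\pi_1(\mathcal{U}_0(B))$.
   Context: For a unital $C^*$-algebra $A$, $\mathcal{U}(A)$ is the unitary group with the norm topology and $\mathcal{U}_0(A)$ is its connected component of the identity. *)

theory Defs
  imports "HOL-Analysis.Analysis" "HOL-Algebra.Generated_Groups"
begin

text \<open>
  The real scalar multiplication is part of the library class of unital real normed
  algebras; \<open>scaleR_scaleC\<close> says that it is the restriction of the complex one.  The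
  inherited axiom \<open>norm 1 = 1\<close> only excludes the zero algebra: in every nonzero unital
  C*-algebra it follows from the C*-identity.
\<close>

class unital_cstar_algebra = real_normed_algebra_1 + banach +
  fixes scaleC :: "complex \<Rightarrow> 'a \<Rightarrow> 'a"  (infixr \<open>*\<^sub>C\<close> 75)
    and star :: "'a \<Rightarrow> 'a"
  assumes scaleC_add_right: "c *\<^sub>C (x + y) = c *\<^sub>C x + c *\<^sub>C y"
    and scaleC_add_left: "(c + d) *\<^sub>C x = c *\<^sub>C x + d *\<^sub>C x"
    and scaleC_scaleC: "c *\<^sub>C d *\<^sub>C x = (c * d) *\<^sub>C x"
    and scaleC_one: "1 *\<^sub>C x = x"
    and scaleR_scaleC: "r *\<^sub>R x = complex_of_real r *\<^sub>C x"
    and mult_scaleC_left: "(c *\<^sub>C x) * y = c *\<^sub>C (x * y)"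
    and mult_scaleC_right: "x * (c *\<^sub>C y) = c *\<^sub>C (x * y)"
    and norm_scaleC: "norm (c *\<^sub>C x) = cmod c * norm x"
    and star_add: "star (x + y) = star x + star y"
    and star_scaleC: "star (c *\<^sub>C x) = cnj c *\<^sub>C star x"
    and star_mult: "star (x * y) = star y * star x"
    and star_star: "star (star x) = x"
    and cstar_identity: "norm (star x * x) = (norm x)\<^sup>2"

class abelian_unital_cstar_algebra = unital_cstar_algebra + comm_ring_1

lemma vector_space_scaleC:
  "vector_space (scaleC :: complex \<Rightarrow> 'a::unital_cstar_algebra \<Rightarrow> 'a)"
  by unfold_locales (simp_all add: scaleC_add_right scaleC_add_left scaleC_scaleC scaleC_one)

definition infinite_dimensional :: "'a::unital_cstar_algebra itself \<Rightarrow> bool" where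
  "infinite_dimensional _ \<longleftrightarrow>
    \<not> (\<exists>S::'a set. finite S \<and> module.span scaleC S = UNIV)"

definition unitary_elements :: "'a::unital_cstar_algebra set" where
  "unitary_elements = {u. star u * u = 1 \<and> u * star u = 1}"

definition U0 :: "'a::unital_cstar_algebra set" where
  "U0 = connected_component_set unitary_elements 1"

definition U0_group :: "'a::unital_cstar_algebra monoid" where
  "U0_group = \<lparr>carrier = U0, monoid.mult = (*), one = 1\<rparr>"

text \<open>The topology on a carrier is the subspace topology of the ambient type.\<close>

definition topologically_isomorphic ::
    "('a::topological_space) monoid \<Rightarrow> ('b::topological_space) monoid \<Rightarrow> bool" where
  "topologically_isomorphic G H \<longleftrightarrow>
    (\<exists>f \<in> iso G H. homeomorphic_map (top_of_set (carrier G)) (top_of_set (carrier H)) f)"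

text \<open>
  Library paths are functions on all of \<open>real\<close> of which only the values on \<open>{0..1}\<close> matter:
  two functions that agree on \<open>{0..1}\<close> are \<open>homotopic_paths\<close>.
\<close>

definition loops_at :: "'a::topological_space set \<Rightarrow> 'a \<Rightarrow> (real \<Rightarrow> 'a) set" where
  "loops_at S x = {p. path p \<and> path_image p \<subseteq> S \<and> pathstart p = x \<and> pathfinish p = x}"

definition fundamental_group ::
    "'a::topological_space set \<Rightarrow> 'a \<Rightarrow> (real \<Rightarrow> 'a) set monoid" where
  "fundamental_group S x =
    \<lparr>carrier = (\<lambda>p. Collect (homotopic_paths S p)) ` loops_at S x,
     monoid.mult = (\<lambda>P Q. {r. \<exists>p\<in>P. \<exists>q\<in>Q. homotopic_paths S (p +++ q) r}),
     one = Collect (homotopic_paths S (\<lambda>_. x))\<rparr>"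

abbreviation pi1_U0 :: "'a::unital_cstar_algebra itself \<Rightarrow> (real \<Rightarrow> 'a) set monoid" where
  "pi1_U0 _ \<equiv> fundamental_group (U0 :: 'a set) 1"

definition finitely_generated :: "('a, 'b) monoid_scheme \<Rightarrow> bool" where
  "finitely_generated G \<longleftrightarrow>
    (\<exists>S. finite S \<and> S \<subseteq> carrier G \<and> generate G S = carrier G)"

end

theory Submission
  imports Defs
begin

text \<open>
  By Gelfand duality \<open>A = C(X)\<close> for a compact metrizable space \<open>X\<close>, and exponentiation
  identifies \<open>U0(A)\<close> with \<open>C(X, \<real>) / C(X, \<int>)\<close>.  This quotient map is a covering of a simply
  connected space, so \<open>\<pi>\<^sub>1(U0(A)) = C(X, \<int>)\<close>; if it is finitely generated, then \<open>X\<close> has finitely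
  many components, and their number \<open>n\<close> is determined by the group.  As \<open>X\<close> is infinite, some component
  is a nondegenerate continuum and contains a Cantor set.  Hence Milutin's theorem, in the form of
  Pelczynski's decomposition method, shows that the functions in \<open>C(X, \<real>)\<close> vanishing at one chosen
  point in each component form a Banach space isomorphic to \<open>C(Cantor space, \<real>)\<close>.  So
  \<open>C(X, \<real>) / C(X, \<int>)\<close> is the product of an \<open>n\<close>-torus and a Banach space that does not depend on \<open>A\<close>.
\<close>


section \<open>Self-adjoint elements\<close>

text \<open>Gelfand duality is obtained from order rather than from spectra: in the real algebra of
  self-adjoint elements the sums of squares serve as positive cone, and characters are the cuts of
  total preorders that extend it. The C*-identity, in the form |a + ib|^2 = |a^2 + b^2|, ties the
  norm to this cone.

  The obstacle in the classification is that a linear isomorphism of function spaces descends to the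
  unitary groups only if it matches the lattices C(X, Z), which Banach space isomorphisms ignore.
  With finitely many components the lattice spans just the locally constant functions; evaluation at
  base points splits these off, and on the complement only the Banach space structure is left to
  respect.

  The decomposition method needs two kinds of operators, and both integrate against Bernoulli
  measures whose parameters are functions on X: for a separating sequence of parameters this
  averages functions on the Cantor space back to X, and for parameters that are 0 or 1 on a Cantor
  subset it extends functions from there to X.\<close>

definition sa :: "'a::abelian_unital_cstar_algebra set" where
  "sa = {a. star a = a}"

definition re :: "'a::abelian_unital_cstar_algebra \<Rightarrow> 'a" where
  "re x = (1/2) *\<^sub>R (x + star x)"

definition im :: "'a::abelian_unital_cstar_algebra \<Rightarrow> 'a" where
  "im x = re ((-\<i>) *\<^sub>C x)"

lemma star_scaleR: "star (r *\<^sub>R x) = r *\<^sub>R star x"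
  by (simp add: scaleR_scaleC star_scaleC)

lemma star_0 [simp]: "star 0 = 0"
  using star_scaleR[of 0 0] by simp

lemma star_minus: "star (- x) = - star x"
  using star_scaleR[of "-1" x] by simp

lemma star_diff: "star (x - y) = star x - star y"
  using star_add[of x "-y"] by (simp add: star_minus)

lemma star_1 [simp]: "star 1 = 1"
  using star_mult[of 1 "star 1"] by (simp add: star_star)

lemma star_of_real [simp]: "star (of_real r) = of_real r"
  unfolding of_real_def by (simp add: star_scaleR)

lemma norm_star [simp]: "norm (star x) = norm x"
proof -
  have *: "norm x \<le> norm (star x)" for x :: 'a
  proof (cases "x = 0")
    case False
    have "norm x * norm x = norm (star x * x)"
      by (simp add: cstar_identity power2_eq_square)
    also have "\<dots> \<le> norm (star x) * norm x"
      by (rule norm_mult_ineq)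
    finally show ?thesis using False by simp
  qed simp
  from *[of x] *[of "star x"] show ?thesis by (simp add: star_star)
qed

lemma bounded_linear_star: "bounded_linear star"
  by (rule bounded_linear_intro[where K=1]) (simp_all add: star_add star_scaleR)

lemma bounded_linear_scaleC: "bounded_linear (\<lambda>x. c *\<^sub>C x)"
  by (rule bounded_linear_intro[where K="cmod c"])
     (simp_all add: scaleC_add_right scaleR_scaleC scaleC_scaleC norm_scaleC mult.commute)

lemma scaleC_of_real: "complex_of_real r *\<^sub>C x = r *\<^sub>R x"
  by (simp add: scaleR_scaleC)

lemma scaleC_minus_left: "(- c) *\<^sub>C x = - (c *\<^sub>C x)"
  using scaleC_scaleC[of "-1" c x] scaleC_of_real[of "-1" "c *\<^sub>C x"] by simp

lemma bounded_linear_re: "bounded_linear re"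
  unfolding re_def
  by (intro bounded_linear_intros bounded_linear_star)

lemma bounded_linear_im: "bounded_linear im"
  unfolding im_def
  by (rule bounded_linear_compose[OF bounded_linear_re bounded_linear_scaleC])

lemma re_in_sa [simp]: "re x \<in> sa"
  by (simp add: sa_def re_def star_scaleR star_add star_star add.commute)

lemma im_in_sa [simp]: "im x \<in> sa"
  by (simp add: im_def)

lemma re_sa: "a \<in> sa \<Longrightarrow> re a = a"
  by (simp add: sa_def re_def flip: scaleR_2)

lemma re_re [simp]: "re (re x) = re x"
  by (rule re_sa) simp

lemma norm_re_le: "norm (re x) \<le> norm x"
  unfolding re_def using norm_triangle_ineq[of x "star x"] by simp

lemma sa_add: "a \<in> sa \<Longrightarrow> b \<in> sa \<Longrightarrow> a + b \<in> sa"
  and sa_diff: "a \<in> sa \<Longrightarrow> b \<in> sa \<Longrightarrow> a - b \<in> sa"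
  and sa_minus: "a \<in> sa \<Longrightarrow> - a \<in> sa"
  and sa_mult: "a \<in> sa \<Longrightarrow> b \<in> sa \<Longrightarrow> a * b \<in> sa"
  and sa_scaleR: "a \<in> sa \<Longrightarrow> r *\<^sub>R a \<in> sa"
  by (auto simp: sa_def star_add star_diff star_minus star_mult star_scaleR mult.commute)

lemma sa_0: "0 \<in> sa" and sa_1: "1 \<in> sa"
  and sa_of_real: "of_real r \<in> sa"
  by (auto simp: sa_def)

lemmas sa_intros = sa_add sa_diff sa_minus sa_mult sa_scaleR sa_0 sa_1 sa_of_real re_in_sa im_in_sa

lemma sa_sum: "(\<And>i. i \<in> I \<Longrightarrow> f i \<in> sa) \<Longrightarrow> sum f I \<in> sa"
  by (induction I rule: infinite_finite_induct) (auto intro: sa_intros)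

lemma sa_prod: "(\<And>i. i \<in> I \<Longrightarrow> f i \<in> sa) \<Longrightarrow> prod f I \<in> sa"
  by (induction I rule: infinite_finite_induct) (auto intro: sa_intros)

lemma closed_sa: "closed sa"
  unfolding sa_def
  by (intro closed_Collect_eq continuous_intros
      bounded_linear.continuous_on[OF bounded_linear_star])

lemma re_im_decomp: "re x + \<i> *\<^sub>C im x = x"
proof -
  have "\<i> *\<^sub>C im x = \<i> *\<^sub>C ((1/2) *\<^sub>R ((-\<i>) *\<^sub>C x + \<i> *\<^sub>C star x))"
    by (simp add: im_def re_def star_scaleC)
  also have "\<dots> = (1/2) *\<^sub>R (\<i> *\<^sub>C ((-\<i>) *\<^sub>C x + \<i> *\<^sub>C star x))"
    by (simp add: scaleR_scaleC scaleC_scaleC)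
  also have "\<dots> = (1/2) *\<^sub>R (x - star x)"
    using scaleC_scaleC[of "\<i>" "\<i>" "star x"] scaleC_scaleC[of "\<i>" "\<i>" x]
      scaleC_add_right[of \<i> "(-\<i>) *\<^sub>C x" "\<i> *\<^sub>C star x"] scaleC_scaleC[of "\<i>" "-\<i>" x]
    by (simp add: scaleC_one scaleC_minus_left)
  finally show ?thesis
    by (simp add: re_def scaleR_add_right scaleR_diff_right flip: scaleR_2 scaleR_add_left)
qed

lemma re_complex: assumes "a \<in> sa" "b \<in> sa" shows "re (a + \<i> *\<^sub>C b) = a"
  using assms by (simp add: re_def sa_def star_add star_scaleC scaleC_minus_left flip: scaleR_2)

lemma im_complex: assumes "a \<in> sa" "b \<in> sa" shows "im (a + \<i> *\<^sub>C b) = b"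
proof -
  have "(-\<i>) *\<^sub>C (a + \<i> *\<^sub>C b) = b + \<i> *\<^sub>C (- a)"
    using scaleC_scaleC[of "-\<i>" "\<i>" b] bounded_linear_scaleC[of \<i>, THEN bounded_linear.linear, THEN linear_neg, of a]
    by (simp add: scaleC_add_right scaleC_one scaleC_minus_left)
  then show ?thesis
    using re_complex[OF assms(2) sa_minus[OF assms(1)]] by (simp add: im_def)
qed

lemma star_complex: assumes "a \<in> sa" "b \<in> sa" shows "star (a + \<i> *\<^sub>C b) = a - \<i> *\<^sub>C b"
  using assms by (simp add: sa_def star_add star_scaleC scaleC_minus_left)

lemma ii_mult_ii: "(\<i> *\<^sub>C a) * (\<i> *\<^sub>C b) = - (a * b)"
  using scaleC_scaleC[of \<i> \<i> "a*b"]
  by (simp add: mult_scaleC_left mult_scaleC_right scaleC_minus_left scaleC_one)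

lemma star_mult_complex:
  assumes "a \<in> sa" "b \<in> sa"
  shows "star (a + \<i> *\<^sub>C b) * (a + \<i> *\<^sub>C b) = a * a + b * b"
  by (simp add: star_complex[OF assms] algebra_simps ii_mult_ii)

text \<open>The C*-identity for an element with given real and imaginary part; the estimates for
  sums of squares rest on this formula.\<close>

lemma norm_complex_sq:
  assumes "a \<in> sa" "b \<in> sa"
  shows "(norm (a + \<i> *\<^sub>C b))\<^sup>2 = norm (a * a + b * b)"
  using cstar_identity[of "a + \<i> *\<^sub>C b"] star_mult_complex[OF assms] by simp

lemma norm_sq_sa: "a \<in> sa \<Longrightarrow> norm (a * a) = (norm a)\<^sup>2"
  using cstar_identity[of a] by (simp add: sa_def)

section \<open>Sums of squares\<close>

text \<open>The root is sought as \<open>1 - w\<close>; the equation then reads w = (a + w * w) / 2,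
  and on the ball of radius \<open>norm a\<close> the right-hand side is a contraction with constant
  \<open>norm a\<close>. The fixed point is self-adjoint because the ball is taken inside
  \<open>sa\<close>.\<close>

lemma sqrt_one_minus:
  assumes a: "a \<in> sa" and n: "norm a < 1"
  shows "\<exists>s\<in>sa. s * s = 1 - a"
proof -
  define B where "B = {w::'a. w \<in> sa \<and> norm w \<le> norm a}"
  define f where "f = (\<lambda>w::'a. (1/2) *\<^sub>R (a + w * w))"
  have "B = sa \<inter> {w. norm w \<le> norm a}" by (auto simp: B_def)
  then have "closed B"
    by (simp add: closed_Int closed_sa closed_Collect_le continuous_intros)
  then have "complete B" by (simp add: complete_eq_closed)
  moreover have "B \<noteq> {}" by (auto simp: B_def sa_0 intro!: exI[of _ 0])
  moreover have "f ` B \<subseteq> B"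
  proof (clarsimp simp: B_def f_def)
    fix w :: 'a assume w: "w \<in> sa" "norm w \<le> norm a"
    have "norm (w * w) \<le> norm w * norm w" by (rule norm_mult_ineq)
    also have "\<dots> \<le> norm a * 1" using w n by (intro mult_mono) auto
    finally have "norm (w * w) \<le> norm a" by simp
    then have "norm (a + w * w) \<le> norm a * 2"
      using norm_triangle_ineq[of a "w*w"] by simp
    then show "(1/2) *\<^sub>R (a + w * w) \<in> sa \<and> norm (a + w * w) \<le> norm a * 2"
      using a w by (auto intro!: sa_intros)
  qed
  moreover have "\<forall>x\<in>B. \<forall>y\<in>B. dist (f x) (f y) \<le> norm a * dist x y"
  proof (intro ballI)
    fix x y assume xy: "x \<in> B" "y \<in> B"
    have "f x - f y = (1/2) *\<^sub>R ((x + y) * (x - y))"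
      by (simp add: f_def algebra_simps)
    then have "norm (f x - f y) \<le> (1/2) * (norm (x + y) * norm (x - y))"
      using norm_mult_ineq[of "x+y" "x-y"] by simp
    also have "norm (x + y) \<le> 2 * norm a"
      using xy norm_triangle_ineq[of x y] by (simp add: B_def)
    finally show "dist (f x) (f y) \<le> norm a * dist x y"
      by (simp add: dist_norm mult_right_mono)
  qed
  ultimately obtain w where w: "w \<in> B" "f w = w"
    using Banach_fix[of B "norm a" f] n by auto
  have "a + w * w = 2 *\<^sub>R w"
    using w(2) by (metis f_def scaleR_half_double scaleR_2 scaleR_right_distrib)
  then have "(1 - w) * (1 - w) = 1 - a"
    by (simp add: algebra_simps scaleR_2)
  moreover have "1 - w \<in> sa" using w by (auto simp: B_def intro: sa_intros)
  ultimately show ?thesis by blast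
qed

lemma sqrt_of_real_minus:
  assumes a: "a \<in> sa" and n: "norm a < t"
  shows "\<exists>s\<in>sa. s * s = of_real t - a"
proof -
  have t: "t > 0" using n norm_ge_zero[of a] by linarith
  then have "norm ((1/t) *\<^sub>R a) < 1" using n by simp
  then obtain s where s: "s \<in> sa" "s * s = 1 - (1/t) *\<^sub>R a"
    using sqrt_one_minus[of "(1/t) *\<^sub>R a"] a sa_scaleR by blast
  have "(sqrt t *\<^sub>R s) * (sqrt t *\<^sub>R s) = t *\<^sub>R (s * s)"
    using t by simp
  also have "\<dots> = of_real t - a"
    using t by (simp add: s scaleR_diff_right of_real_def)
  finally show ?thesis using s sa_scaleR by blast
qed

inductive_set sos :: "'a::abelian_unital_cstar_algebra set" where
  sq: "a \<in> sa \<Longrightarrow> a * a \<in> sos"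
| add: "a \<in> sos \<Longrightarrow> b \<in> sos \<Longrightarrow> a + b \<in> sos"

lemma sos_mult: "a \<in> sos \<Longrightarrow> b \<in> sos \<Longrightarrow> a * b \<in> sos"
proof (induction arbitrary: b rule: sos.induct)
  case (sq a)
  from \<open>b \<in> sos\<close> show ?case
  proof (induction rule: sos.induct)
    case (sq b)
    then show ?case using sos.sq[OF sa_mult[OF \<open>a \<in> sa\<close> sq]] by (simp add: ac_simps)
  qed (simp add: distrib_left sos.add)
qed (simp add: distrib_right sos.add)

lemma sos_sa: "a \<in> sos \<Longrightarrow> a \<in> sa"
  by (induction rule: sos.induct) (auto intro: sa_intros)

lemma sos_of_real: "r \<ge> 0 \<Longrightarrow> of_real r \<in> sos"
  using sos.sq[OF sa_of_real[of "sqrt r"]] by (simp flip: of_real_mult)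

lemma of_real_minus_sos: "a \<in> sa \<Longrightarrow> norm a < t \<Longrightarrow> of_real t - a \<in> sos"
  using sqrt_of_real_minus sos.sq by metis

lemma of_real_plus_sos: "a \<in> sa \<Longrightarrow> norm a < t \<Longrightarrow> of_real t + a \<in> sos"
  using of_real_minus_sos[of "-a" t] sa_minus[of a] by simp

text \<open>If s is a root of t^2 - b^2, then s + ib has norm exactly t by the C*-identity, and s is
  its real part, so s has norm at most t.\<close>

lemma sq_norm_bound:
  assumes b: "b \<in> sa" and t: "norm b < t"
  shows "norm (of_real (t\<^sup>2) - b * b) \<le> t\<^sup>2"
proof -
  have "norm (b * b) < t\<^sup>2"
    using norm_mult_ineq[of b b] t norm_ge_zero[of b]
    by (smt (verit) mult_strict_mono' power2_eq_square)
  then obtain s where s: "s \<in> sa" "s * s = of_real (t\<^sup>2) - b * b"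
    using sqrt_of_real_minus[of "b * b" "t\<^sup>2"] sa_mult[OF b b] by blast
  have "(norm (s + \<i> *\<^sub>C b))\<^sup>2 = norm (of_real (t\<^sup>2) :: 'a)"
    using norm_complex_sq[OF s(1) b] s by (simp del: of_real_power)
  then have "(norm (s + \<i> *\<^sub>C b))\<^sup>2 = t\<^sup>2" by (simp del: of_real_power)
  moreover have "norm s \<le> norm (s + \<i> *\<^sub>C b)"
    using norm_re_le[of "s + \<i> *\<^sub>C b"] re_complex[OF s(1) b] by simp
  ultimately show ?thesis
    by (metis norm_sq_sa[OF s(1)] s(2) norm_ge_zero power_mono)
qed

text \<open>The inequality is the norm characterisation of positive elements. It adds up over sums,
  whereas being a square is not evidently preserved by them.\<close>

lemma sos_norm_bound: "a \<in> sos \<Longrightarrow> \<exists>t\<ge>0. norm (of_real t - a) \<le> t"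
proof (induction rule: sos.induct)
  case (sq a)
  show ?case
    using sq_norm_bound[OF sq, of "norm a + 1"] by (intro exI[of _ "(norm a + 1)\<^sup>2"]) simp
next
  case (add a b)
  then obtain t u where "t\<ge>0" "norm (of_real t - a) \<le> t" "u\<ge>0" "norm (of_real u - b) \<le> u" by blast
  then show ?case
    using norm_triangle_ineq[of "of_real t - a" "of_real u - b"]
    by (intro exI[of _ "t+u"]) (simp add: algebra_simps)
qed

text \<open>Write a + e = (t + e) - (t - a), where t - a has norm at most t < t + e. So a sum of
  squares is a single square up to an arbitrarily small constant.\<close>

lemma sos_plus_eps_square:
  assumes a: "a \<in> sos" and e: "e > 0"
  shows "\<exists>s\<in>sa. s * s = a + of_real e"
proof -
  obtain t where t: "t \<ge> 0" "norm (of_real t - a) \<le> t" using sos_norm_bound[OF a] by blast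
  obtain s where "s \<in> sa" "s * s = of_real (t + e) - (of_real t - a)"
    using sqrt_of_real_minus[of "of_real t - a" "t+e"] t e sos_sa[OF a]
    by (auto intro: sa_intros)
  then show ?thesis by (auto simp: algebra_simps)
qed

text \<open>With roots r of m + a + e and s of m - a + e, the element r + is has squared norm 2(m +
  e), while the real part of its square is r^2 - s^2 = 2a. Taking real parts does not increase the
  norm.\<close>

lemma norm_le_if_sos:
  assumes p: "of_real m - a \<in> sos" and q: "of_real m + a \<in> sos" and m: "m \<ge> 0"
  shows "norm a \<le> m"
proof (rule field_le_epsilon)
  fix e :: real assume e: "e > 0"
  obtain s where s: "s \<in> sa" "s * s = of_real m - a + of_real e"
    using sos_plus_eps_square[OF p e] by blast
  obtain r where r: "r \<in> sa" "r * r = of_real m + a + of_real e"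
    using sos_plus_eps_square[OF q e] by blast
  have "s * s + r * r = of_real (2 * (m + e))" by (simp add: s r)
  then have n: "(norm (r + \<i> *\<^sub>C s))\<^sup>2 = 2 * (m + e)"
    using norm_complex_sq[OF r(1) s(1)] m e
    by (metis abs_of_nonneg add.commute norm_of_real add_nonneg_nonneg less_imp_le mult_nonneg_nonneg zero_le_numeral)
  have "(r + \<i> *\<^sub>C s) * (r + \<i> *\<^sub>C s) = (r * r - s * s) + \<i> *\<^sub>C (2 *\<^sub>R (r * s))"
    using ii_mult_ii[of s s]
    by (simp add: ring_distribs mult_scaleC_left mult_scaleC_right scaleC_add_right scaleR_2 mult.commute)
  then have "re ((r + \<i> *\<^sub>C s) * (r + \<i> *\<^sub>C s)) = r * r - s * s"
    using re_complex[of "r * r - s * s" "2 *\<^sub>R (r * s)"] s(1) r(1) by (simp add: sa_intros)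
  then have "norm (r * r - s * s) \<le> 2 * (m + e)"
    using norm_re_le[of "(r + \<i> *\<^sub>C s) * (r + \<i> *\<^sub>C s)"]
      norm_mult_ineq[of "r + \<i> *\<^sub>C s" "r + \<i> *\<^sub>C s"] n
    by (simp add: power2_eq_square)
  moreover have "r * r - s * s = 2 *\<^sub>R a" by (simp add: r s scaleR_2)
  ultimately show "norm a \<le> m + e" by simp
qed

section \<open>Preorders and characters\<close>

text \<open>These are the preorderings of real algebra, on the self-adjoint part; excluding -1 makes
  them proper.\<close>

definition preorder :: "'a::abelian_unital_cstar_algebra set \<Rightarrow> bool" where
  "preorder Q \<longleftrightarrow> sos \<subseteq> Q \<and> Q \<subseteq> sa \<and> (\<forall>a\<in>Q. \<forall>b\<in>Q. a + b \<in> Q) \<and>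
     (\<forall>a\<in>Q. \<forall>b\<in>Q. a * b \<in> Q) \<and> - 1 \<notin> Q"

lemma preorderD:
  assumes "preorder Q"
  shows "a \<in> sos \<Longrightarrow> a \<in> Q" "a \<in> Q \<Longrightarrow> a \<in> sa" "a \<in> Q \<Longrightarrow> b \<in> Q \<Longrightarrow> a + b \<in> Q"
    "a \<in> Q \<Longrightarrow> b \<in> Q \<Longrightarrow> a * b \<in> Q" "- 1 \<notin> Q" "0 \<le> r \<Longrightarrow> of_real r \<in> Q"
  using assms sos_of_real unfolding preorder_def by blast+

lemma preorder_scaleR:
  assumes "preorder Q" "a \<in> Q" "0 \<le> r"
  shows "r *\<^sub>R a \<in> Q"
  using preorderD(4)[OF assms(1) preorderD(6)[OF assms(1,3)] assms(2)]
  by (simp add: scaleR_conv_of_real)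

text \<open>The extension is closed under products because \<open>a * a\<close> already lies in
  \<open>Q\<close>. Properness is asked of the extension, in the form of \<open>n\<close>, so that
  the lemma applies both to a maximal preorder and to \<open>sos\<close>.\<close>

lemma preorder_adjoin:
  assumes Q: "sos \<subseteq> Q" "Q \<subseteq> sa" "\<And>a b. a \<in> Q \<Longrightarrow> b \<in> Q \<Longrightarrow> a + b \<in> Q"
      "\<And>a b. a \<in> Q \<Longrightarrow> b \<in> Q \<Longrightarrow> a * b \<in> Q"
    and a: "a \<in> sa" and n: "\<And>p q. p \<in> Q \<Longrightarrow> q \<in> Q \<Longrightarrow> - 1 \<noteq> p + a * q"
  shows "preorder {p + a * q | p q. p \<in> Q \<and> q \<in> Q}" (is "preorder ?R")
    and "Q \<subseteq> {p + a * q | p q. p \<in> Q \<and> q \<in> Q}" and "a \<in> {p + a * q | p q. p \<in> Q \<and> q \<in> Q}"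
proof -
  have 0: "0 \<in> Q" "1 \<in> Q" using Q(1) sos_of_real[of 0] sos_of_real[of 1] by auto
  show QR: "Q \<subseteq> ?R"
    using 0 by force
  show "a \<in> ?R"
    using 0 by force
  show "preorder ?R"
    unfolding preorder_def
  proof (intro conjI ballI)
    show "sos \<subseteq> ?R" using QR Q(1) by blast
    show "?R \<subseteq> sa" using Q(2) a by (auto intro!: sa_intros)
    show "- 1 \<notin> ?R" using n by blast
  next
    fix x y assume "x \<in> ?R" "y \<in> ?R"
    then obtain p q p' q' where *: "x = p + a * q" "y = p' + a * q'" "p \<in> Q" "q \<in> Q" "p' \<in> Q" "q' \<in> Q"
      by blast
    have "x + y = (p + p') + a * (q + q')" by (simp add: * algebra_simps)
    then show "x + y \<in> ?R" using * Q(3) by blast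
    have "x * y = (p * p' + (a * a) * (q * q')) + a * (p * q' + q * p')"
      unfolding *(1,2) by (simp only: ring_distribs ac_simps)
    moreover have "a * a \<in> Q" using Q(1) sos.sq[OF a] by blast
    then have "p * p' + (a * a) * (q * q') \<in> Q" "p * q' + q * p' \<in> Q" using * Q(3,4) by simp_all
    ultimately show "x * y \<in> ?R" by blast
  qed
qed

text \<open>Take a maximal proper preorder. If it contained neither a nor -a, adjoining either of
  them would produce -1, and multiplying the two representations of -1 would put -1 into the
  preorder itself.\<close>

lemma preorder_extend_total:
  assumes "preorder (P :: 'a::abelian_unital_cstar_algebra set)"
  shows "\<exists>Q. P \<subseteq> Q \<and> preorder Q \<and> (\<forall>a\<in>sa. a \<in> Q \<or> - a \<in> Q)"
proof -
  define F where "F = {Q::'a set. P \<subseteq> Q \<and> preorder Q}"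
  have "\<exists>M\<in>F. \<forall>X\<in>F. M \<subseteq> X \<longrightarrow> X = M"
  proof (rule subset_Zorn_nonempty)
    show "F \<noteq> {}" using assms by (auto simp: F_def)
    fix C assume C: "C \<noteq> {}" "subset.chain F C"
    then have CF: "\<And>X. X \<in> C \<Longrightarrow> P \<subseteq> X \<and> preorder X"
      by (auto simp: subset.chain_def F_def)
    have ch: "\<And>X Y. X \<in> C \<Longrightarrow> Y \<in> C \<Longrightarrow> X \<subseteq> Y \<or> Y \<subseteq> X"
      using C(2) by (auto simp: subset.chain_def)
    have two: "\<exists>Z\<in>C. a \<in> Z \<and> b \<in> Z" if "a \<in> \<Union>C" "b \<in> \<Union>C" for a b
      using that ch by blast
    obtain X0 where X0: "X0 \<in> C" using C(1) by blast
    have "preorder (\<Union>C)"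
      unfolding preorder_def
    proof (intro conjI ballI)
      show "sos \<subseteq> \<Union>C" using CF[OF X0] X0 unfolding preorder_def by blast
      show "\<Union>C \<subseteq> sa" using CF unfolding preorder_def by blast
      show "- 1 \<notin> \<Union>C" using CF unfolding preorder_def by blast
    next
      fix a b assume "a \<in> \<Union>C" "b \<in> \<Union>C"
      from two[OF this] obtain Z where Z: "Z \<in> C" "a \<in> Z" "b \<in> Z" by blast
      show "a + b \<in> \<Union>C" "a * b \<in> \<Union>C"
        using preorderD(3,4)[OF conjunct2[OF CF[OF Z(1)]] Z(2,3)] Z(1) by blast+
    qed
    then show "\<Union>C \<in> F" using CF[OF X0] X0 by (auto simp: F_def)
  qed
  then obtain Q where Q: "Q \<in> F" "\<And>X. X \<in> F \<Longrightarrow> Q \<subseteq> X \<Longrightarrow> X = Q" by blast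
  then have pQ: "preorder Q" "P \<subseteq> Q" by (auto simp: F_def)
  note D = preorderD[OF pQ(1)]
  have ext: "a \<in> Q" if a: "a \<in> sa" and n: "\<And>p q. p \<in> Q \<Longrightarrow> q \<in> Q \<Longrightarrow> - 1 \<noteq> p + a * q" for a
  proof -
    have Q': "sos \<subseteq> Q" "Q \<subseteq> sa" "\<And>a b. a \<in> Q \<Longrightarrow> b \<in> Q \<Longrightarrow> a + b \<in> Q"
      "\<And>a b. a \<in> Q \<Longrightarrow> b \<in> Q \<Longrightarrow> a * b \<in> Q" using D by auto
    note adj = preorder_adjoin[OF Q' a n]
    have "{p + a * q | p q. p \<in> Q \<and> q \<in> Q} = Q"
      by (rule Q(2)) (use adj pQ(2) in \<open>auto simp: F_def\<close>)
    then show ?thesis using adj(3) by simp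
  qed
  have "a \<in> Q \<or> - a \<in> Q" if a: "a \<in> sa" for a
  proof (rule ccontr)
    assume "\<not> (a \<in> Q \<or> - a \<in> Q)"
    with ext[OF a] ext[OF sa_minus[OF a]] obtain p q p' q' where
      *: "p \<in> Q" "q \<in> Q" "- 1 = p + a * q" "p' \<in> Q" "q' \<in> Q" "- 1 = p' + - a * q'" by metis
    have e: "1 + p = - (a * q)" "1 + p' = a * q'"
    proof -
      have "1 + p = (p + a * q) + (1 - a * q)" "1 + p' = (p' + - a * q') + (1 + a * q')"
        by simp_all
      then show "1 + p = - (a * q)" "1 + p' = a * q'"
        by (simp_all only: *(3,6)[symmetric]) simp_all
    qed
    \<comment> \<open>The left-hand side lies in \<open>Q\<close> term by term; that it equals -1 is
      the product (1 + p)(1 + p') = -(aq)(aq').\<close>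
    have "p + p' + p * p' + (a * a) * (q * q') = (1 + p) * (1 + p') - 1 + (a * q) * (a * q')"
      by (simp add: algebra_simps)
    also have "\<dots> = - 1" by (simp add: e)
    finally have "- 1 = p + p' + p * p' + (a * a) * (q * q')" by simp
    moreover have "\<dots> \<in> Q" using * D(1)[OF sos.sq[OF a]] by (simp add: D(3,4))
    ultimately show False using D(5) by simp
  qed
  then show ?thesis using pQ by blast
qed

section \<open>Real values from Dedekind cuts of a total preorder\<close>

definition cut_at :: "'a::abelian_unital_cstar_algebra set \<Rightarrow> 'a \<Rightarrow> real \<Rightarrow> bool" where
  "cut_at Q a x \<longleftrightarrow> (\<forall>e>0. a - of_real (x - e) \<in> Q \<and> of_real (x + e) - a \<in> Q)"

lemma cut_le:
  assumes Q: "preorder Q" and "of_real x - a \<in> Q" "a - of_real y \<in> Q"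
  shows "y \<le> x"
proof (rule ccontr)
  assume "\<not> y \<le> x"
  then have yx: "y - x > 0" by simp
  have "(of_real x - a) + (a - of_real y) \<in> Q" using assms preorderD(3) by blast
  then have "(1 / (y - x)) *\<^sub>R of_real (x - y) \<in> Q"
    using preorder_scaleR[OF Q, of "of_real (x - y)" "1 / (y - x)"] yx by simp
  moreover have "(1 / (y - x)) *\<^sub>R of_real (x - y) = (- 1 :: 'a)"
  proof -
    have "(1 / (y - x)) * (x - y) = - 1" using yx by (simp add: field_simps)
    then show ?thesis by (metis of_real_def scaleR_scaleR of_real_1 of_real_minus)
  qed
  ultimately show False using preorderD(5)[OF Q] by simp
qed

lemma cut_unique:
  assumes Q: "preorder Q" and x: "cut_at Q a x" and y: "cut_at Q a y"
  shows "x = y"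
proof -
  have "x \<le> y" if "cut_at Q a x" "cut_at Q a y" for x y
  proof (rule field_le_epsilon)
    fix e :: real assume e: "e > 0"
    have "x - e/2 \<le> y + e/2"
      using that e by (intro cut_le[OF Q, of _ a]) (auto simp: cut_at_def)
    then show "x \<le> y + e" by simp
  qed
  then show ?thesis using x y by (simp add: order_antisym)
qed

text \<open>The value is the supremum of the constants below \<open>a\<close>. The norm confines
  \<open>a\<close> between two constants, so the supremum is finite, and totality turns "not above a
  constant" into "below it".\<close>

lemma cut_exists:
  assumes Q: "preorder Q" "\<forall>a\<in>sa. a \<in> Q \<or> - a \<in> Q" and a: "a \<in> sa"
  shows "\<exists>x. cut_at Q a x"
proof -
  define S where "S = {r. a - of_real r \<in> Q}"
  define N where "N = norm a + 1"
  have "of_real N + a \<in> Q" and "of_real N - a \<in> Q"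
    using of_real_minus_sos[OF a, of N] of_real_plus_sos[OF a, of N] preorderD(1)[OF Q(1)]
    by (auto simp: N_def)
  from this have N1: "a - of_real (- N) \<in> Q" "of_real N - a \<in> Q"
    by (simp_all add: add.commute)
  have ne: "S \<noteq> {}" using N1(1) unfolding S_def by blast
  have bd: "bdd_above S"
    by (rule bdd_aboveI[of _ N]) (use cut_le[OF Q(1) N1(2)] in \<open>auto simp: S_def\<close>)
  have "cut_at Q a (Sup S)"
    unfolding cut_at_def
  proof (intro allI impI conjI)
    fix e :: real assume e: "e > 0"
    then obtain r where r: "r \<in> S" "Sup S - e < r"
      using less_cSupD[OF ne, of "Sup S - e"] by auto
    have "(a - of_real r) + of_real (r - (Sup S - e)) \<in> Q"
      using r preorderD(3,6)[OF Q(1)] by (auto simp: S_def simp del: of_real_diff)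
    moreover have "(a - of_real r) + of_real (r - (Sup S - e)) = a - of_real (Sup S - e)" by simp
    ultimately show "a - of_real (Sup S - e) \<in> Q" by (simp only:)
    have "Sup S + e \<notin> S" using cSup_upper[OF _ bd, of "Sup S + e"] e by auto
    then have "a - of_real (Sup S + e) \<notin> Q" by (simp add: S_def)
    then have "- (a - of_real (Sup S + e)) \<in> Q" using Q(2) a by (metis sa_diff sa_of_real)
    then show "of_real (Sup S + e) - a \<in> Q" by simp
  qed
  then show ?thesis ..
qed

lemma cut_add:
  assumes Q: "preorder Q" and x: "cut_at Q a x" and y: "cut_at Q b y"
  shows "cut_at Q (a + b) (x + y)"
  unfolding cut_at_def
proof (intro allI impI)
  fix e :: real assume e: "e > 0"
  have "(a - of_real (x - e/2)) + (b - of_real (y - e/2)) \<in> Q"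
    "(of_real (x + e/2) - a) + (of_real (y + e/2) - b) \<in> Q"
    using x y e unfolding cut_at_def by (auto intro!: preorderD(3)[OF Q] simp del: of_real_diff of_real_add)
  moreover have "(a - of_real (x - e/2)) + (b - of_real (y - e/2)) = a + b - of_real ((x - e/2) + (y - e/2))"
    "(of_real (x + e/2) - a) + (of_real (y + e/2) - b) = of_real ((x + e/2) + (y + e/2)) - (a + b)"
    by (simp_all only: of_real_add) (simp_all add: algebra_simps)
  moreover have "(x - e/2) + (y - e/2) = x + y - e" "(x + e/2) + (y + e/2) = x + y + e" by auto
  ultimately show "a + b - of_real (x + y - e) \<in> Q \<and> of_real (x + y + e) - (a + b) \<in> Q"
    by (simp only:)
qed

lemma cut_of_real:
  assumes Q: "preorder Q"
  shows "cut_at Q (of_real r) r"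
  unfolding cut_at_def using preorderD(6)[OF Q] by (simp flip: of_real_diff)

lemma cut_shift: "cut_at Q a x \<longleftrightarrow> cut_at Q (a - of_real x) 0"
  unfolding cut_at_def by (simp add: algebra_simps)

text \<open>The elements of value 0 absorb products. With d - a, d + a, N - b, N + b in
  \<open>Q\<close>, adding two products of such factors leaves twice dN + ab or twice dN - ab, and d
  is chosen with dN = e.\<close>

lemma cut_0_mult:
  assumes Q: "preorder Q" and a: "cut_at Q a 0" and b: "b \<in> sa"
  shows "cut_at Q (a * b) 0"
  unfolding cut_at_def
proof (intro allI impI)
  fix e :: real assume e: "e > 0"
  define N where "N = norm b + 1"
  have N0: "N > 0" by (simp add: N_def add_nonneg_pos)
  have N: "of_real N - b \<in> Q" "of_real N + b \<in> Q"
    using of_real_minus_sos[OF b, of N] of_real_plus_sos[OF b, of N] preorderD(1)[OF Q]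
    by (auto simp: N_def)
  define d where "d = e / N"
  have d: "d > 0" "d * N = e" using e N0 by (auto simp: d_def)
  have A: "of_real d + a \<in> Q" "of_real d - a \<in> Q"
    using a d(1) unfolding cut_at_def by (force simp: add.commute)+
  have e': "of_real d * of_real N = (of_real e :: 'a)" by (simp add: d(2) flip: of_real_mult)
  have "(1/2) *\<^sub>R ((of_real d + a) * (of_real N + b) + (of_real d - a) * (of_real N - b)) \<in> Q"
    "(1/2) *\<^sub>R ((of_real d + a) * (of_real N - b) + (of_real d - a) * (of_real N + b)) \<in> Q"
    using A N by (auto intro!: preorder_scaleR[OF Q] preorderD(3,4)[OF Q])
  moreover have "(of_real d + a) * (of_real N + b) + (of_real d - a) * (of_real N - b)
      = (of_real e + a * b) + (of_real e + a * b)"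
    "(of_real d + a) * (of_real N - b) + (of_real d - a) * (of_real N + b)
      = (of_real e - a * b) + (of_real e - a * b)"
    by (simp_all add: ring_distribs e')
  ultimately show "a * b - of_real (0 - e) \<in> Q \<and> of_real (0 + e) - a * b \<in> Q"
    by (simp only: scaleR_half_double) (simp add: add.commute)
qed

lemma cut_scaleR:
  assumes Q: "preorder Q" and x: "cut_at Q a x"
  shows "cut_at Q (r *\<^sub>R a) (r * x)"
proof -
  have "cut_at Q ((a - of_real x) * of_real r) 0"
    using x by (intro cut_0_mult[OF Q]) (auto simp: sa_of_real simp flip: cut_shift)
  moreover have "(a - of_real x) * of_real r = r *\<^sub>R a - of_real (r * x)"
    by (simp add: algebra_simps scaleR_conv_of_real)
  ultimately show ?thesis using cut_shift by metis
qed

text \<open>The identity ab - xy = (a - x) b + x (b - y) reduces multiplicativity to the absorption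
  property of value 0.\<close>

lemma cut_mult:
  assumes Q: "preorder Q" and a: "cut_at Q a x" and b: "cut_at Q b y" "b \<in> sa"
  shows "cut_at Q (a * b) (x * y)"
proof -
  have "cut_at Q ((a - of_real x) * b) 0"
    using a b(2) by (intro cut_0_mult[OF Q]) (simp_all flip: cut_shift)
  from cut_add[OF Q this cut_scaleR[OF Q b(1), of x]] show ?thesis
    by (simp add: left_diff_distrib scaleR_conv_of_real)
qed

text \<open>
  Characters are extended from the self-adjoint part to the whole algebra by \<open>\<phi> a = \<phi> (re a)\<close>;
  in other words, these are the real parts of the complex characters.
\<close>

definition characters :: "('a::abelian_unital_cstar_algebra \<Rightarrow> real) set" where
  "characters = {\<phi>. (\<forall>a b. \<phi> (a + b) = \<phi> a + \<phi> b) \<and> (\<forall>r a. \<phi> (r *\<^sub>R a) = r * \<phi> a) \<and>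
     (\<forall>a. \<phi> a = \<phi> (re a)) \<and> (\<forall>a. \<bar>\<phi> a\<bar> \<le> norm a) \<and> \<phi> 1 = 1 \<and>
     (\<forall>a b. \<phi> (re a * re b) = \<phi> (re a) * \<phi> (re b))}"

lemma total_preorder_character:
  assumes Q: "preorder (Q :: 'a::abelian_unital_cstar_algebra set)" "\<forall>a\<in>sa. a \<in> Q \<or> - a \<in> Q"
  shows "\<exists>\<phi>\<in>characters. \<forall>a\<in>sa. cut_at Q a (\<phi> a)"
proof -
  define \<phi> where "\<phi> a = (THE x. cut_at Q (re a) x)" for a
  have cut: "cut_at Q (re a) (\<phi> a)" for a
    unfolding \<phi>_def
    by (rule theI') (use cut_exists[OF Q re_in_sa] cut_unique[OF Q(1)] in blast)
  have eq: "\<phi> a = x" if "cut_at Q (re a) x" for a x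
    using cut_unique[OF Q(1) cut that] .
  interpret re: bounded_linear "re :: 'a \<Rightarrow> 'a" by (rule bounded_linear_re)
  have bd: "\<phi> a \<le> norm a" for a
  proof (rule field_le_epsilon)
    fix e :: real assume e: "e > 0"
    have 1: "of_real (norm a + e/2) - re a \<in> Q"
      using norm_re_le[of a] e by (intro preorderD(1)[OF Q(1)] of_real_minus_sos) auto
    have "re a - of_real (\<phi> a - e/2) \<in> Q" using cut[of a] e by (simp add: cut_at_def del: of_real_diff)
    from cut_le[OF Q(1) 1 this] show "\<phi> a \<le> norm a + e" by simp
  qed
  have sc: "\<phi> (r *\<^sub>R a) = r * \<phi> a" for r a
    by (rule eq) (simp add: re.scaleR cut_scaleR[OF Q(1) cut])
  have "\<phi> \<in> characters"
    unfolding characters_def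
  proof (clarsimp, intro conjI allI)
    show "\<phi> (a + b) = \<phi> a + \<phi> b" for a b
      by (rule eq) (simp add: re.add cut_add[OF Q(1) cut cut])
    show "\<phi> (r *\<^sub>R a) = r * \<phi> a" for r a by (rule sc)
    show "\<phi> a = \<phi> (re a)" for a by (simp add: \<phi>_def)
    show "\<phi> 1 = 1" using cut_of_real[OF Q(1), of 1] by (intro eq) (simp add: re_sa sa_1)
    show "\<bar>\<phi> a\<bar> \<le> norm a" for a
      using bd[of a] bd[of "(-1) *\<^sub>R a"] sc[of "-1" a] by simp
    show "\<phi> (re a * re b) = \<phi> (re a) * \<phi> (re b)" for a b
    proof (rule eq)
      show "cut_at Q (re (re a * re b)) (\<phi> (re a) * \<phi> (re b))"
        using cut_mult[OF Q(1) cut[of "re a"] cut[of "re b"]] by (simp add: re_sa[OF sa_mult])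
    qed
  qed
  then show ?thesis using cut re_sa by metis
qed

text \<open>
  The identity \<open>N\<^sup>2(c + r) = (N - q)\<^sup>2(c + r) + (2N - q)(1 + p) + r q (2N - q)\<close> lowers the bound
  \<open>c + r \<ge> 0\<close> to \<open>c + r - 1/N \<ge> 0\<close>; iterating it removes \<open>r\<close>.
\<close>

lemma sos_of_mult_eq_one_plus:
  assumes c: "c \<in> sa" and p: "p \<in> sos" and q: "q \<in> sos" and eq: "c * q = 1 + p"
  shows "c \<in> sos"
proof -
  define N where "N = norm q + 1"
  have N: "N > 0" "of_real N - q \<in> sos"
    using of_real_minus_sos[OF sos_sa[OF q], of N] by (auto simp: N_def add_nonneg_pos)
  have step: "c + of_real r - of_real (1/N) \<in> sos" if r: "r \<ge> 0" "c + of_real r \<in> sos" for r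
  proof -
    let ?n = "of_real N :: 'a" and ?r = "of_real r :: 'a"
    have n: "?n \<in> sos" using N(1) by (simp add: sos_of_real)
    have "?n * ?n * (c + ?r) = (?n - q) * (?n - q) * (c + ?r) + (?n + (?n - q)) * (c * q)
        + ?r * q * (?n + (?n - q))"
      by (simp add: algebra_simps)
    \<comment> \<open>From 2N - q, the coefficient of 1 + p, a summand N is moved to the left, and N
      - q is still a sum of squares. Dividing by N^2 turns this N into the gain 1/N.\<close>
    then have "?n * ?n * (c + ?r) - ?n = (?n - q) * (?n - q) * (c + ?r) + (?n - q) + (?n + (?n - q)) * p
        + ?r * q * (?n + (?n - q))"
      by (simp add: eq algebra_simps)
    also have "\<dots> \<in> sos"
      by (rule sos.add[OF sos.add[OF sos.add[OF sos_mult[OF sos_mult[OF N(2) N(2)] r(2)] N(2)]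
            sos_mult[OF sos.add[OF n N(2)] p]]
            sos_mult[OF sos_mult[OF sos_of_real[OF r(1)] q] sos.add[OF n N(2)]]])
    finally have "of_real (1/(N*N)) * (?n * ?n * (c + ?r) - ?n) \<in> sos"
      using N(1) by (intro sos_mult[OF sos_of_real]) auto
    moreover have "of_real (1/(N*N)) * (?n * ?n * (c + ?r) - ?n)
        = of_real (1/(N*N) * (N * N)) * (c + ?r) - of_real (1/(N*N) * N)"
      by (simp only: of_real_mult right_diff_distrib mult.assoc)
    ultimately show ?thesis using N(1) by (simp add: add_diff_eq)
  qed
  have "c + of_real (norm c + 1) \<in> sos"
    using of_real_plus_sos[OF c, of "norm c + 1"] by (simp add: add.commute)
  moreover have "\<exists>k::nat. norm c + 1 \<le> real k * (1/N)"
    using N(1) by (metis divide_pos_pos reals_Archimedean3 less_imp_le zero_less_one)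
  then obtain k :: nat where "norm c + 1 \<le> real k * (1/N)" ..
  moreover have "c \<in> sos" if "c + of_real r \<in> sos" "r \<le> real k * (1/N)" for k :: nat and r
    using that
  proof (induction k arbitrary: r)
    case 0
    then have "c + of_real r + of_real (- r) \<in> sos" using sos.add[OF 0(1) sos_of_real[of "- r"]] by simp
    then show ?case by simp
  next
    case (Suc k)
    show ?case
    proof (cases "r \<ge> 0")
      case True
      have "c + of_real (r - 1/N) \<in> sos" using step[OF True Suc.prems(1)] by (simp add: algebra_simps)
      moreover have "r - 1/N \<le> real k * (1/N)" using Suc.prems(2) by (simp add: add_divide_distrib)
      ultimately show ?thesis by (rule Suc.IH)
    next
      case False
      then have "c + of_real r + of_real (- r) \<in> sos" using sos.add[OF Suc.prems(1) sos_of_real[of "- r"]] by simp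
      then show ?thesis by simp
    qed
  qed
  ultimately show ?thesis by blast
qed

text \<open>A Positivstellensatz. If m - a were not a sum of squares, then by
  \<open>sos_of_mult_eq_one_plus\<close> the element a - m could be adjoined to the sums of squares
  without producing -1, and a total extension would yield a character whose value at a is at least
  m.\<close>

lemma of_real_minus_sos_if_characters:
  assumes a: "a \<in> sa" and le: "\<And>\<phi>. \<phi> \<in> characters \<Longrightarrow> \<phi> a < m"
  shows "of_real m - a \<in> sos"
proof (rule ccontr)
  assume n: "of_real m - a \<notin> sos"
  have "- 1 \<noteq> p + (a - of_real m) * q" if "p \<in> sos" "q \<in> sos" for p q
  proof
    assume "- 1 = p + (a - of_real m) * q"
    then have "(of_real m - a) * q = 1 + p"
      by (simp add: algebra_simps eq_neg_iff_add_eq_0)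
    then show False
      using sos_of_mult_eq_one_plus[OF _ that] n a by (blast intro: sa_intros)
  qed
  moreover have s: "sos \<subseteq> sa" "a - of_real m \<in> sa" using sos_sa a by (auto intro: sa_intros)
  ultimately have adj: "preorder {p + (a - of_real m) * q | p q. p \<in> sos \<and> q \<in> sos}"
    "a - of_real m \<in> {p + (a - of_real m) * q | p q. p \<in> sos \<and> q \<in> sos}"
    using preorder_adjoin(1,3)[OF order_refl s(1) sos.add sos_mult s(2)] by blast+
  obtain Q where Q: "preorder Q" "\<forall>a\<in>sa. a \<in> Q \<or> - a \<in> Q" "a - of_real m \<in> Q"
    using preorder_extend_total[OF adj(1)] adj(2) by blast
  obtain \<phi> where \<phi>: "\<phi> \<in> characters" "\<forall>a\<in>sa. cut_at Q a (\<phi> a)"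
    using total_preorder_character[OF Q(1,2)] by blast
  have "m \<le> \<phi> a"
  proof (rule field_le_epsilon)
    fix e :: real assume "e > 0"
    then have "of_real (\<phi> a + e) - a \<in> Q" using \<phi>(2) a by (simp add: cut_at_def del: of_real_add)
    from cut_le[OF Q(1) this Q(3)] show "m \<le> \<phi> a + e" .
  qed
  with le[OF \<phi>(1)] show False by simp
qed

lemma characterD:
  assumes "\<phi> \<in> characters"
  shows "\<phi> (a + b) = \<phi> a + \<phi> b" "\<phi> (r *\<^sub>R a) = r * \<phi> a" "\<phi> (re a) = \<phi> a" "\<bar>\<phi> a\<bar> \<le> norm a"
    "\<phi> 1 = 1" "a \<in> sa \<Longrightarrow> b \<in> sa \<Longrightarrow> \<phi> (a * b) = \<phi> a * \<phi> b"
    "\<phi> (- a) = - \<phi> a" "\<phi> (a - b) = \<phi> a - \<phi> b" "\<phi> (of_real r) = r" "\<phi> 0 = 0"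
proof -
  show add: "\<phi> (a + b) = \<phi> a + \<phi> b" and sc: "\<phi> (r *\<^sub>R a) = r * \<phi> a" and "\<phi> (re a) = \<phi> a"
    "\<bar>\<phi> a\<bar> \<le> norm a" and one: "\<phi> 1 = 1" for a b r
    using assms by (simp_all add: characters_def)
  have m: "\<phi> (re a * re b) = \<phi> (re a) * \<phi> (re b)" using assms by (simp add: characters_def)
  show "a \<in> sa \<Longrightarrow> b \<in> sa \<Longrightarrow> \<phi> (a * b) = \<phi> a * \<phi> b"
    using m by (simp add: re_sa)
  show min: "\<phi> (- a) = - \<phi> a" for a using sc[of "-1" a] by simp
  show "\<phi> (a - b) = \<phi> a - \<phi> b" using add[of a "-b"] min by simp
  show "\<phi> (of_real r) = r" using sc[of r 1] one by (simp add: of_real_def)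
  show "\<phi> 0 = 0" using sc[of 0 0] by simp
qed

text \<open>Isometry of the Gelfand representation, from the order estimate
  \<open>norm_le_if_sos\<close>; the slack \<open>e\<close> supplies the strict inequality that the
  Positivstellensatz asks for.\<close>

lemma norm_le_characters:
  assumes a: "a \<in> sa" and le: "\<And>\<phi>. \<phi> \<in> characters \<Longrightarrow> \<bar>\<phi> a\<bar> \<le> m" and m: "m \<ge> 0"
  shows "norm a \<le> m"
proof (rule field_le_epsilon)
  fix e :: real assume e: "e > 0"
  have lt: "\<phi> a < m + e" "\<phi> (- a) < m + e" if "\<phi> \<in> characters" for \<phi>
    using le[OF that] characterD(7)[OF that, of a] e by auto
  have "of_real (m + e) - a \<in> sos" "of_real (m + e) - (- a) \<in> sos"
    using of_real_minus_sos_if_characters[OF a, of "m + e"] lt(1)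
      of_real_minus_sos_if_characters[OF sa_minus[OF a], of "m + e"] lt(2) by blast+
  then show "norm a \<le> m + e"
    using norm_le_if_sos[of "m + e" a] m e by simp
qed

section \<open>The Gelfand representation\<close>

lemma open_coordinate_vimage: "open U \<Longrightarrow> open ((\<lambda>h. h x) -` U)"
  by (rule open_vimage) simp_all

text \<open>The separation axioms pass to functions coordinatewise. The Hausdorff property is the
  one that makes compact sets of characters closed and the character space normal.\<close>

instance "fun" :: (type, t0_space) t0_space
proof
  fix f g :: "'a \<Rightarrow> 'b"
  assume "f \<noteq> g"
  then obtain x where x: "f x \<noteq> g x" by blast
  obtain U where "open U" "\<not> (f x \<in> U \<longleftrightarrow> g x \<in> U)"
    using separation_t0[THEN iffD1, OF x] by blast
  then show "\<exists>U. open U \<and> \<not> (f \<in> U \<longleftrightarrow> g \<in> U)"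
    by (intro exI[of _ "(\<lambda>h. h x) -` U"] conjI open_coordinate_vimage) auto
qed

instance "fun" :: (type, t1_space) t1_space
proof
  fix f g :: "'a \<Rightarrow> 'b"
  assume "f \<noteq> g"
  then obtain x where x: "f x \<noteq> g x" by blast
  obtain U where "open U" "f x \<in> U" "g x \<notin> U"
    using t1_space[OF x] by blast
  then show "\<exists>U. open U \<and> f \<in> U \<and> g \<notin> U"
    by (intro exI[of _ "(\<lambda>h. h x) -` U"] conjI open_coordinate_vimage) auto
qed

instance "fun" :: (type, t2_space) t2_space
proof
  fix f g :: "'a \<Rightarrow> 'b"
  assume "f \<noteq> g"
  then obtain x where x: "f x \<noteq> g x" by blast
  obtain U V where UV: "open U" "open V" "f x \<in> U" "g x \<in> V" "U \<inter> V = {}"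
    using hausdorff[OF x] by blast
  then have "(\<lambda>h. h x) -` U \<inter> (\<lambda>h. h x) -` V = {}" by blast
  with UV show "\<exists>U V. open U \<and> open V \<and> f \<in> U \<and> g \<in> V \<and> U \<inter> V = {}"
    by (intro exI[of _ "(\<lambda>h. h x) -` U"] exI[of _ "(\<lambda>h. h x) -` V"] conjI
        open_coordinate_vimage) auto
qed

text \<open>A closed subset of the compact product of the intervals from \<open>- norm a\<close> to
  \<open>norm a\<close>: each single condition on a character involves finitely many
  coordinates.\<close>

lemma compact_characters: "compact (characters :: ('a::abelian_unital_cstar_algebra \<Rightarrow> real) set)"
proof -
  define K :: "('a \<Rightarrow> real) set" where "K = PiE UNIV (\<lambda>a. {- norm a..norm a})"
  have "compactin (product_topology (\<lambda>_. euclideanreal) UNIV) K"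
    unfolding K_def compactin_PiE by simp
  then have "compact K"
    by (simp add: euclidean_product_topology)
  moreover have "closed (characters :: ('a \<Rightarrow> real) set)"
    unfolding characters_def
    by (intro closed_Collect_conj closed_Collect_all closed_Collect_eq closed_Collect_le
        continuous_intros continuous_on_product_coordinates)
  moreover have "(characters :: ('a \<Rightarrow> real) set) \<subseteq> K"
    using characterD(4) by (fastforce simp: K_def abs_le_iff minus_le_iff)
  ultimately show ?thesis
    by (metis compact_Int_closed inf.absorb2)
qed

lemma continuous_on_evaluation: "continuous_on S (\<lambda>\<phi>. \<phi> a)"
  by (rule continuous_on_subset[OF continuous_on_product_coordinates]) simp

lemma characters_separated:
  assumes "\<phi> \<in> characters" "\<psi> \<in> characters" "\<phi> \<noteq> \<psi>"
  shows "\<exists>a\<in>sa. \<phi> a \<noteq> \<psi> a"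
proof -
  obtain x where "\<phi> x \<noteq> \<psi> x" using assms by blast
  then have "\<phi> (re x) \<noteq> \<psi> (re x)" using assms by (simp add: characterD)
  then show ?thesis using re_in_sa by blast
qed

lemma sa_eqI:
  assumes "a \<in> sa" "b \<in> sa" "\<And>\<phi>. \<phi> \<in> characters \<Longrightarrow> \<phi> a = \<phi> b"
  shows "a = b"
  using norm_le_characters[of "a - b" 0] assms by (simp add: characterD sa_diff)

lemma gelfand_dense:
  assumes f: "continuous_on characters (f :: ('a::abelian_unital_cstar_algebra \<Rightarrow> real) \<Rightarrow> real)"
    and e: "e > 0"
  shows "\<exists>a\<in>sa. \<forall>\<phi>\<in>characters. \<bar>f \<phi> - \<phi> a\<bar> < e"
proof -
  let ?X = "characters :: ('a \<Rightarrow> real) set"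
  define R where "R = {g. \<exists>a\<in>sa. \<forall>\<phi>\<in>?X. g \<phi> = \<phi> a}"
  interpret function_ring_on R ?X
  proof
    show "compact ?X" by (rule compact_characters)
  next
    fix g assume "g \<in> R"
    then obtain a where "\<forall>\<phi>\<in>?X. g \<phi> = \<phi> a" by (auto simp: R_def)
    then show "continuous_on ?X g"
      by (simp cong: continuous_on_cong add: continuous_on_evaluation)
  next
    fix g h assume "g \<in> R" "h \<in> R"
    then obtain a b where ab: "a \<in> sa" "b \<in> sa" "\<forall>\<phi>\<in>?X. g \<phi> = \<phi> a" "\<forall>\<phi>\<in>?X. h \<phi> = \<phi> b"
      by (auto simp: R_def)
    show "(\<lambda>x. g x + h x) \<in> R"
      using ab by (auto simp: R_def characterD(1) intro!: bexI[of _ "a + b"] sa_add)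
    show "(\<lambda>x. g x * h x) \<in> R"
      using ab by (auto simp: R_def characterD(6) intro!: bexI[of _ "a * b"] sa_mult)
  next
    fix c :: real
    show "(\<lambda>_. c) \<in> R"
      by (auto simp: R_def characterD(9) sa_of_real intro!: bexI[of _ "of_real c"])
  next
    fix x y assume "x \<in> ?X" "y \<in> ?X" "x \<noteq> y"
    then obtain a where "a \<in> sa" "x a \<noteq> y a" using characters_separated by blast
    then show "\<exists>f\<in>R. f x \<noteq> f y"
      by (intro bexI[of _ "\<lambda>\<phi>. \<phi> a"]) (auto simp: R_def)
  qed
  obtain g where "g \<in> R" "\<forall>\<phi>\<in>?X. \<bar>f \<phi> - g \<phi>\<bar> < e"
    using Stone_Weierstrass_basic[OF f e] by blast
  then show ?thesis unfolding R_def by force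
qed

lemma character_LIMSEQ:
  assumes p: "\<phi> \<in> characters" and a: "a \<longlonglongrightarrow> l"
  shows "(\<lambda>n. \<phi> (a n)) \<longlonglongrightarrow> \<phi> l"
proof -
  have "(\<lambda>n. norm (a n - l)) \<longlonglongrightarrow> 0" using a by (simp add: LIM_zero tendsto_norm_zero)
  then have "(\<lambda>n. \<phi> (a n) - \<phi> l) \<longlonglongrightarrow> 0"
    by (rule Lim_null_comparison[rotated]) (simp add: characterD(4)[OF p] flip: characterD(8)[OF p])
  then show ?thesis by (simp add: LIM_zero_iff)
qed

text \<open>The approximants from the Stone-Weierstrass theorem are Cauchy in norm because
  characters determine the norm, so completeness of the algebra supplies the limit.\<close>

lemma gelfand_surj:
  assumes f: "continuous_on characters (f :: ('a::abelian_unital_cstar_algebra \<Rightarrow> real) \<Rightarrow> real)"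
  shows "\<exists>a\<in>sa. \<forall>\<phi>\<in>characters. \<phi> a = f \<phi>"
proof -
  have "\<exists>a\<in>sa. \<forall>\<phi>\<in>characters. \<bar>f \<phi> - \<phi> a\<bar> < 1 / Suc n" for n
    by (rule gelfand_dense[OF f]) simp
  then obtain a where a: "\<And>n. a n \<in> sa"
    "\<And>n \<phi>. \<phi> \<in> characters \<Longrightarrow> \<bar>f \<phi> - \<phi> (a n)\<bar> < 1 / Suc n"
    by metis
  have d: "norm (a m - a n) \<le> 1 / Suc m + 1 / Suc n" for m n
  proof (rule norm_le_characters)
    fix \<phi> :: "'a \<Rightarrow> real" assume p: "\<phi> \<in> characters"
    from a(2)[OF p, of m] a(2)[OF p, of n]
    show "\<bar>\<phi> (a m - a n)\<bar> \<le> 1 / Suc m + 1 / Suc n"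
      unfolding characterD(8)[OF p] by linarith
  qed (auto intro: sa_diff a)
  have "Cauchy a"
  proof (rule metric_CauchyI)
    fix e :: real assume e: "e > 0"
    then obtain N where N: "N > 0" "1 / real N < e / 2"
      using ex_inverse_of_nat_less[of "e/2"] by (auto simp: inverse_eq_divide)
    have "dist (a m) (a n) < e" if "m \<ge> N" "n \<ge> N" for m n
    proof -
      have "1 / real (Suc m) \<le> 1 / N" "1 / real (Suc n) \<le> 1 / N"
        using that N by (auto intro!: divide_left_mono)
      then show ?thesis using d[of m n] N by (simp add: dist_norm)
    qed
    then show "\<exists>M. \<forall>m\<ge>M. \<forall>n\<ge>M. dist (a m) (a n) < e" by blast
  qed
  then obtain l where l: "a \<longlonglongrightarrow> l" using Cauchy_convergent convergent_def by blast
  have "l \<in> sa" using closed_sequentially[OF closed_sa] a(1) l by blast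
  moreover have "\<phi> l = f \<phi>" if p: "\<phi> \<in> characters" for \<phi>
  proof (rule LIMSEQ_unique)
    show "(\<lambda>n. \<phi> (a n)) \<longlonglongrightarrow> \<phi> l" by (rule character_LIMSEQ[OF p l])
    have "(\<lambda>n. \<phi> (a n) - f \<phi>) \<longlonglongrightarrow> 0"
      by (rule Lim_null_comparison[OF _ LIMSEQ_Suc[OF lim_1_over_n]])
        (use a(2)[OF p] in \<open>auto simp: abs_minus_commute intro!: always_eventually less_imp_le\<close>)
    then show "(\<lambda>n. \<phi> (a n)) \<longlonglongrightarrow> f \<phi>" by (simp add: LIM_zero_iff)
  qed
  ultimately show ?thesis by blast
qed

definition gel :: "(('a::abelian_unital_cstar_algebra \<Rightarrow> real) \<Rightarrow> real) \<Rightarrow> 'a" where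
  "gel f = (SOME a. a \<in> sa \<and> (\<forall>\<phi>\<in>characters. \<phi> a = f \<phi>))"

lemma
  assumes "continuous_on characters f"
  shows gel_in_sa: "gel f \<in> sa" and gel_eval: "\<phi> \<in> characters \<Longrightarrow> \<phi> (gel f) = f \<phi>"
proof -
  have "gel f \<in> sa \<and> (\<forall>\<phi>\<in>characters. \<phi> (gel f) = f \<phi>)"
    unfolding gel_def by (rule someI_ex) (use gelfand_surj[OF assms] in blast)
  then show "gel f \<in> sa" "\<phi> \<in> characters \<Longrightarrow> \<phi> (gel f) = f \<phi>" by auto
qed

section \<open>Complex values of elements at characters\<close>

definition ceval :: "('a::abelian_unital_cstar_algebra \<Rightarrow> real) \<Rightarrow> 'a \<Rightarrow> complex" where
  "ceval \<phi> x = Complex (\<phi> x) (\<phi> (im x))"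

definition cgel :: "(('a::abelian_unital_cstar_algebra \<Rightarrow> real) \<Rightarrow> complex) \<Rightarrow> 'a" where
  "cgel f = gel (\<lambda>\<phi>. Re (f \<phi>)) + \<i> *\<^sub>C gel (\<lambda>\<phi>. Im (f \<phi>))"

lemma ceval_complex:
  assumes "\<phi> \<in> characters" "a \<in> sa" "b \<in> sa"
  shows "ceval \<phi> (a + \<i> *\<^sub>C b) = Complex (\<phi> a) (\<phi> b)"
  using assms characterD(3)[OF assms(1), of "a + \<i> *\<^sub>C b"]
  by (simp add: ceval_def im_complex re_complex)

lemma im_sa:
  assumes "a \<in> sa" shows "im a = 0"
proof -
  have "\<i> *\<^sub>C (0::'a::abelian_unital_cstar_algebra) = 0"
    by (rule linear_0[OF bounded_linear.linear[OF bounded_linear_scaleC]])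
  then show ?thesis using im_complex[OF assms sa_0] by simp
qed

lemma ceval_sa: "\<phi> \<in> characters \<Longrightarrow> a \<in> sa \<Longrightarrow> ceval \<phi> a = of_real (\<phi> a)"
  by (simp add: ceval_def im_sa characterD(10) complex_of_real_def)

lemma ceval_cgel:
  assumes "continuous_on characters f" "\<phi> \<in> characters"
  shows "ceval \<phi> (cgel f) = f \<phi>"
proof -
  have "continuous_on characters (\<lambda>\<phi>. Re (f \<phi>))" "continuous_on characters (\<lambda>\<phi>. Im (f \<phi>))"
    using assms(1) by (auto intro: continuous_intros)
  then show ?thesis
    using assms(2) by (simp add: cgel_def ceval_complex gel_in_sa gel_eval)
qed

lemma ceval_1: "\<phi> \<in> characters \<Longrightarrow> ceval \<phi> 1 = 1"
  by (simp add: ceval_sa sa_1 characterD)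

lemma ceval_diff:
  assumes "\<phi> \<in> characters" shows "ceval \<phi> (x - y) = ceval \<phi> x - ceval \<phi> y"
  using assms linear_diff[OF bounded_linear.linear[OF bounded_linear_im], of x y]
  by (simp add: ceval_def characterD complex_eq_iff)

lemma ceval_star:
  assumes "\<phi> \<in> characters" shows "ceval \<phi> (star x) = cnj (ceval \<phi> x)"
proof -
  have "star x = re x + \<i> *\<^sub>C (- im x)"
    using star_complex[of "re x" "im x"] linear_neg[OF bounded_linear.linear[OF bounded_linear_scaleC[of \<i>]], of "im x"]
    by (simp add: re_im_decomp)
  then show ?thesis
    using assms ceval_complex[of \<phi> "re x" "- im x"] ceval_complex[of \<phi> "re x" "im x"]
    by (simp add: sa_minus re_im_decomp characterD complex_eq_iff)
qed

lemma scaleC_ii: "\<i> *\<^sub>C \<i> *\<^sub>C x = - x"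
  by (simp add: scaleC_scaleC scaleC_minus_left scaleC_one)

lemma ceval_mult:
  assumes p: "\<phi> \<in> characters" shows "ceval \<phi> (x * y) = ceval \<phi> x * ceval \<phi> y"
proof -
  have "x * y = (re x + \<i> *\<^sub>C im x) * (re y + \<i> *\<^sub>C im y)" by (simp add: re_im_decomp)
  also have "\<dots> = (re x * re y - im x * im y) + \<i> *\<^sub>C (re x * im y + im x * re y)"
    by (simp add: ring_distribs ii_mult_ii mult_scaleC_left mult_scaleC_right scaleC_add_right scaleC_ii)
  finally have "ceval \<phi> (x * y) = ceval \<phi> ((re x * re y - im x * im y) + \<i> *\<^sub>C (re x * im y + im x * re y))"
    by simp
  also have "\<dots> = ceval \<phi> (re x + \<i> *\<^sub>C im x) * ceval \<phi> (re y + \<i> *\<^sub>C im y)"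
    using p by (simp add: ceval_complex sa_intros characterD complex_eq_iff)
  finally show ?thesis by (simp add: re_im_decomp)
qed

lemma ceval_norm_sq:
  assumes p: "\<phi> \<in> characters"
  shows "(cmod (ceval \<phi> x))\<^sup>2 = \<phi> (re x * re x + im x * im x)"
  using p by (simp add: cmod_def ceval_def characterD power2_eq_square)

lemma norm_sq_re_im: "(norm x)\<^sup>2 = norm (re x * re x + im x * im x)"
  using norm_complex_sq[of "re x" "im x"] by (simp add: re_im_decomp)

lemma cmod_ceval_le:
  assumes p: "\<phi> \<in> characters" shows "cmod (ceval \<phi> x) \<le> norm x"
proof -
  have "(cmod (ceval \<phi> x))\<^sup>2 \<le> (norm x)\<^sup>2"
    unfolding ceval_norm_sq[OF p] norm_sq_re_im using characterD(4)[OF p] abs_le_D1 by blast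
  then show ?thesis by (rule power2_le_imp_le) simp
qed

lemma norm_le_ceval:
  assumes m: "m \<ge> 0" and le: "\<And>\<phi>. \<phi> \<in> characters \<Longrightarrow> cmod (ceval \<phi> x) \<le> m"
  shows "norm x \<le> m"
proof -
  have "norm (re x * re x + im x * im x) \<le> m\<^sup>2"
  proof (rule norm_le_characters)
    fix \<phi> :: "'a \<Rightarrow> real" assume p: "\<phi> \<in> characters"
    show "\<bar>\<phi> (re x * re x + im x * im x)\<bar> \<le> m\<^sup>2"
      using power_mono[OF le[OF p], of 2] by (simp flip: ceval_norm_sq[OF p])
  qed (auto intro!: sa_add sa_mult)
  then have "(norm x)\<^sup>2 \<le> m\<^sup>2" by (simp add: norm_sq_re_im)
  then show ?thesis using m by (rule power2_le_imp_le)
qed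

lemma ceval_eqI:
  assumes "\<And>\<phi>. \<phi> \<in> characters \<Longrightarrow> ceval \<phi> x = ceval \<phi> y"
  shows "x = y"
  using norm_le_ceval[of 0 "x - y"] assms by (simp add: ceval_diff)

lemma unitary_iff_ceval:
  "u \<in> unitary_elements \<longleftrightarrow> (\<forall>\<phi>\<in>characters. cmod (ceval \<phi> u) = 1)"
proof -
  have "u \<in> unitary_elements \<longleftrightarrow> star u * u = 1"
    by (simp add: unitary_elements_def mult.commute)
  also have "\<dots> \<longleftrightarrow> (\<forall>\<phi>\<in>characters. ceval \<phi> (star u * u) = 1)"
    by (metis ceval_1 ceval_eqI)
  also have "\<dots> \<longleftrightarrow> (\<forall>\<phi>\<in>characters. cmod (ceval \<phi> u) = 1)"
  proof (rule ball_cong[OF refl])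
    fix \<phi> :: "'a \<Rightarrow> real" assume p: "\<phi> \<in> characters"
    have "ceval \<phi> (star u * u) = of_real ((cmod (ceval \<phi> u))\<^sup>2)"
      by (simp add: ceval_mult[OF p] ceval_star[OF p] complex_norm_square mult.commute
          del: of_real_power)
    then show "(ceval \<phi> (star u * u) = 1) = (cmod (ceval \<phi> u) = 1)"
      by (metis norm_ge_zero of_real_1 of_real_eq_iff one_power2 power2_eq_imp_eq zero_le_one)
  qed
  finally show ?thesis .
qed

section \<open>The identity component of the unitary group\<close>

text \<open>This is exp(2 pi i a), defined through its Gelfand transform. The factor 2 pi makes the
  kernel on self-adjoint elements consist of the integer-valued functions.\<close>

definition uexp :: "'a::abelian_unital_cstar_algebra \<Rightarrow> 'a" where
  "uexp a = cgel (\<lambda>\<phi>. cis (2 * pi * \<phi> a))"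

lemma ceval_uexp: "\<phi> \<in> characters \<Longrightarrow> ceval \<phi> (uexp a) = cis (2 * pi * \<phi> a)"
  unfolding uexp_def
  by (rule ceval_cgel) (auto simp: cis_conv_exp intro!: continuous_intros continuous_on_evaluation)

lemma uexp_add: "uexp (a + b) = uexp a * uexp b"
  by (rule ceval_eqI) (simp add: ceval_uexp ceval_mult characterD(1) cis_mult ring_distribs)

lemma uexp_0 [simp]: "uexp 0 = 1"
  by (rule ceval_eqI) (simp add: ceval_uexp ceval_1 characterD(10))

lemma uexp_minus: "uexp (- a) * uexp a = 1"
  using uexp_add[of "- a" a] by simp

lemma uexp_unitary: "uexp a \<in> unitary_elements"
  by (simp add: unitary_iff_ceval ceval_uexp)

lemma cmod_cis_diff_one: "cmod (cis t - 1) = 2 * \<bar>sin (t / 2)\<bar>"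
  using dist_exp_i_1[of t] by (simp add: cis_conv_exp)

lemma cmod_cis_diff: "cmod (cis s - cis t) = cmod (cis (s - t) - 1)"
proof -
  have "cis s - cis t = cis t * (cis (s - t) - 1)"
    by (simp add: algebra_simps cis_mult)
  then show ?thesis by (simp add: norm_mult)
qed

lemma norm_uexp_diff_le: "norm (uexp a - uexp b) \<le> 2 * pi * norm (a - b)"
proof (rule norm_le_ceval)
  fix \<phi> :: "'a \<Rightarrow> real" assume p: "\<phi> \<in> characters"
  have "cmod (ceval \<phi> (uexp a - uexp b)) = 2 * \<bar>sin (pi * (\<phi> a - \<phi> b))\<bar>"
    by (simp add: ceval_diff[OF p] ceval_uexp[OF p] cmod_cis_diff cmod_cis_diff_one
        flip: right_diff_distrib)
  also have "\<dots> \<le> 2 * \<bar>pi * (\<phi> a - \<phi> b)\<bar>"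
    by (simp add: abs_sin_x_le_abs_x del: abs_mult)
  also have "\<dots> = 2 * pi * \<bar>\<phi> (a - b)\<bar>" by (simp add: abs_mult characterD(8)[OF p])
  also have "\<dots> \<le> 2 * pi * norm (a - b)" using characterD(4)[OF p] by simp
  finally show "cmod (ceval \<phi> (uexp a - uexp b)) \<le> 2 * pi * norm (a - b)" .
qed simp

lemma continuous_on_uexp: "continuous_on S uexp"
proof (rule continuous_onI)
  fix x e :: _ assume e: "(e::real) > 0"
  show "\<exists>d>0. \<forall>x'\<in>S. dist x' x < d \<longrightarrow> dist (uexp x') (uexp x) \<le> e"
  proof (intro exI[of _ "e / (2*pi)"] conjI ballI impI)
    fix x' assume "dist x' x < e / (2*pi)"
    then have "2 * pi * norm (x' - x) \<le> e" by (simp add: dist_norm field_simps)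
    then show "dist (uexp x') (uexp x) \<le> e"
      using norm_uexp_diff_le[of x' x] by (simp add: dist_norm)
  qed (use e in simp)
qed

text \<open>Up to pi/3 the cosine is at least 1/2, so sin x - x/4 increases; beyond that sin x is at
  least 1/2, and x/4 is below 1/2. The crude slope suffices: it yields 2 sin(pi t) >= (pi/2) t >=
  t.\<close>

lemma sin_ge_quarter:
  fixes x :: real
  assumes "0 \<le> x" "x \<le> pi / 2"
  shows "x / 4 \<le> sin x"
proof (cases "x \<le> pi / 3")
  case True
  have "sin 0 - 0 / 4 \<le> sin x - x / 4"
  proof (rule DERIV_nonneg_imp_nondecreasing[OF assms(1)])
    fix y assume y: "0 \<le> y" "y \<le> x"
    have "cos y \<ge> cos (pi / 3)" using y True by (intro cos_monotone_0_pi_le) auto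
    then show "\<exists>d. ((\<lambda>y. sin y - y / 4) has_real_derivative d) (at y) \<and> 0 \<le> d"
      by (intro exI[of _ "cos y - 1 / 4"] conjI) (auto simp: cos_60 intro!: derivative_eq_intros)
  qed
  then show ?thesis by simp
next
  case False
  have "sin (pi / 6) \<le> sin x"
    using False assms by (intro sin_monotone_2pi_le) auto
  moreover have "x / 4 \<le> 1 / 2" using assms pi_less_4 by simp
  ultimately show ?thesis by (simp add: sin_30)
qed

lemma cmod_cis_diff_one_ge:
  assumes "\<bar>t\<bar> \<le> 1 / 2"
  shows "\<bar>t\<bar> \<le> cmod (cis (2 * pi * t) - 1)"
proof -
  have "(pi * \<bar>t\<bar>) / 4 \<le> sin (pi * \<bar>t\<bar>)"
    using assms by (intro sin_ge_quarter) (auto simp: field_simps)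
  also have "\<dots> \<le> \<bar>sin (pi * t)\<bar>" by (cases "t \<ge> 0") auto
  finally have "(pi / 2) * \<bar>t\<bar> \<le> cmod (cis (2 * pi * t) - 1)"
    by (simp add: cmod_cis_diff_one)
  moreover have "1 * \<bar>t\<bar> \<le> (pi / 2) * \<bar>t\<bar>"
    using pi_ge_two by (intro mult_right_mono) auto
  ultimately show ?thesis by simp
qed

text \<open>A lower Lipschitz bound within half a period. It makes the local inverses of
  \<open>uexp\<close> Lipschitz, and with them the sections of the covering and the induced maps of
  unitary groups.\<close>

lemma norm_le_uexp:
  assumes a: "a \<in> sa" and n: "norm a \<le> 1 / 2"
  shows "norm a \<le> norm (uexp a - 1)"
proof (rule norm_le_characters[OF a])
  fix \<phi> :: "'a \<Rightarrow> real" assume p: "\<phi> \<in> characters"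
  have "\<bar>\<phi> a\<bar> \<le> 1 / 2" using characterD(4)[OF p, of a] n by simp
  then have "\<bar>\<phi> a\<bar> \<le> cmod (ceval \<phi> (uexp a - 1))"
    using cmod_cis_diff_one_ge by (simp add: ceval_diff[OF p] ceval_uexp[OF p] ceval_1[OF p])
  also have "\<dots> \<le> norm (uexp a - 1)" by (rule cmod_ceval_le[OF p])
  finally show "\<bar>\<phi> a\<bar> \<le> norm (uexp a - 1)" .
qed simp

text \<open>The principal logarithm: at distance less than 1 from 1 a unitary has positive real
  part, so its angle is recovered from the imaginary part alone.\<close>

definition ulog :: "'a::abelian_unital_cstar_algebra \<Rightarrow> 'a" where
  "ulog u = gel (\<lambda>\<phi>. arcsin (\<phi> (im u)) / (2 * pi))"

lemma
  assumes u: "u \<in> unitary_elements" and n: "norm (u - 1) < 1"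
  shows ulog_sa: "ulog u \<in> sa" and norm_ulog_le: "norm (ulog u) \<le> 1 / 4"
    and uexp_ulog: "uexp (ulog u) = u"
proof -
  have b: "\<phi> (im u) \<in> {-1..1}" "\<phi> u > 0" "(\<phi> u)\<^sup>2 + (\<phi> (im u))\<^sup>2 = 1" if p: "\<phi> \<in> characters" for \<phi>
  proof -
    have c: "cmod (ceval \<phi> u) = 1" using u p by (simp add: unitary_iff_ceval)
    show "\<phi> (im u) \<in> {-1..1}"
      using abs_Im_le_cmod[of "ceval \<phi> u"] c by (simp add: ceval_def abs_le_iff)
    show "(\<phi> u)\<^sup>2 + (\<phi> (im u))\<^sup>2 = 1"
      using c by (simp add: ceval_def cmod_def)
    have "\<bar>\<phi> u - 1\<bar> < 1"
      using characterD(4)[OF p, of "u - 1"] n by (simp add: characterD(5,8)[OF p])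
    then show "\<phi> u > 0" by linarith
  qed
  have cont: "continuous_on characters (\<lambda>\<phi>. arcsin (\<phi> (im u)) / (2 * pi))"
    using b(1) by (intro continuous_intros continuous_on_evaluation) auto
  show sa: "ulog u \<in> sa" unfolding ulog_def by (rule gel_in_sa[OF cont])
  have ev: "\<phi> (ulog u) = arcsin (\<phi> (im u)) / (2 * pi)" if "\<phi> \<in> characters" for \<phi>
    unfolding ulog_def by (rule gel_eval[OF cont that])
  show "norm (ulog u) \<le> 1 / 4"
  proof (rule norm_le_characters[OF sa])
    fix \<phi> :: "'a \<Rightarrow> real" assume p: "\<phi> \<in> characters"
    have "\<bar>arcsin (\<phi> (im u))\<bar> \<le> pi / 2"
      using arcsin_bounded[of "\<phi> (im u)"] b(1)[OF p] by auto
    then show "\<bar>\<phi> (ulog u)\<bar> \<le> 1 / 4" by (simp add: ev[OF p] field_simps)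
  qed simp
  show "uexp (ulog u) = u"
  proof (rule ceval_eqI)
    fix \<phi> :: "'a \<Rightarrow> real" assume p: "\<phi> \<in> characters"
    have "sqrt (1 - (\<phi> (im u))\<^sup>2) = \<phi> u"
      using b(2,3)[OF p] by (intro real_sqrt_unique) auto
    then have "cis (arcsin (\<phi> (im u))) = ceval \<phi> u"
      using b(1)[OF p] by (simp add: ceval_def complex_eq_iff cos_arcsin)
    then show "ceval \<phi> (uexp (ulog u)) = ceval \<phi> u"
      by (simp add: ceval_uexp[OF p] ev[OF p])
  qed
qed

lemma unitary_1: "1 \<in> unitary_elements"
  by (simp add: unitary_elements_def)

lemma unitary_mult:
  fixes u :: "'a::abelian_unital_cstar_algebra"
  shows "u \<in> unitary_elements \<Longrightarrow> v \<in> unitary_elements \<Longrightarrow> u * v \<in> unitary_elements"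
  by (simp add: unitary_iff_ceval ceval_mult norm_mult)

lemma norm_unitary_mult:
  fixes u :: "'a::abelian_unital_cstar_algebra"
  assumes "u \<in> unitary_elements"
  shows "norm (u * x) = norm x"
proof -
  have "cmod (ceval \<phi> (u * x)) = cmod (ceval \<phi> x)" if "\<phi> \<in> characters" for \<phi>
    using assms that by (simp add: unitary_iff_ceval ceval_mult norm_mult)
  then show ?thesis
    by (intro order_antisym norm_le_ceval) (auto, metis cmod_ceval_le, metis cmod_ceval_le)
qed

lemma uexp_near:
  assumes u: "u \<in> unitary_elements" and n: "norm (u - uexp a) < 1"
  shows "ulog (uexp (- a) * u) \<in> sa" "uexp (a + ulog (uexp (- a) * u)) = u"
    "norm (ulog (uexp (- a) * u)) \<le> 1 / 4"
proof -
  have w: "uexp (- a) * u \<in> unitary_elements" by (rule unitary_mult[OF uexp_unitary u])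
  have "uexp (- a) * u - 1 = uexp (- a) * (u - uexp a)"
    by (simp add: right_diff_distrib uexp_minus)
  then have "norm (uexp (- a) * u - 1) < 1"
    using n norm_unitary_mult[OF uexp_unitary, of "- a" "u - uexp a"] by (simp only:)
  note L = ulog_sa[OF w this] uexp_ulog[OF w this] norm_ulog_le[OF w this]
  show "ulog (uexp (- a) * u) \<in> sa" "norm (ulog (uexp (- a) * u)) \<le> 1 / 4" by (rule L)+
  show "uexp (a + ulog (uexp (- a) * u)) = u"
    by (simp only: uexp_add L mult.assoc[symmetric] mult.commute[of "uexp a"] uexp_minus mult_1)
qed

lemma convex_sa: "convex (sa :: 'a::abelian_unital_cstar_algebra set)"
  by (auto simp: convex_def intro!: sa_intros)

text \<open>The exponentials of \<open>sa\<close> form a connected set containing 1. Conversely, of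
  two unitaries at distance less than 1 either both or none are such exponentials, by the local
  logarithm, so the exponentials in the component form a clopen set.\<close>

lemma U0_eq: "(U0 :: 'a::abelian_unital_cstar_algebra set) = uexp ` sa"
proof
  let ?U = "unitary_elements :: 'a set"
  show "uexp ` sa \<subseteq> (U0 :: 'a set)"
    unfolding U0_def
  proof (rule connected_component_maximal)
    show "1 \<in> uexp ` (sa :: 'a set)" by (rule image_eqI[of _ _ 0]) (auto simp: sa_0)
    show "connected (uexp ` (sa :: 'a set))"
      by (rule connected_continuous_image[OF continuous_on_uexp convex_connected[OF convex_sa]])
  qed (use uexp_unitary in blast)
  have near: "u \<in> uexp ` sa \<longleftrightarrow> v \<in> uexp ` sa" if "u \<in> ?U" "v \<in> ?U" "norm (u - v) < 1" for u v :: 'a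
  proof -
    have "u \<in> uexp ` sa" if uv: "u \<in> ?U" "norm (u - v) < 1" "v \<in> uexp ` sa" for u v :: 'a
    proof -
      from uv(3) obtain a where a: "a \<in> sa" "v = uexp a" by blast
      have "norm (u - uexp a) < 1" using uv a by simp
      from uexp_near(1,2)[OF uv(1) this] a show ?thesis
        by (metis image_eqI sa_add)
    qed
    then show ?thesis using that by (metis norm_minus_commute)
  qed
  let ?C = "U0 :: 'a set"
  have CU: "?C \<subseteq> ?U" unfolding U0_def by (rule connected_component_subset)
  have conn: "connected ?C" by (simp add: U0_def)
  have 1: "1 \<in> ?C" by (simp add: U0_def unitary_1 connected_component_refl)
  have op: "openin (top_of_set ?C) (?C \<inter> uexp ` sa)" "openin (top_of_set ?C) (?C - uexp ` sa)"
    unfolding openin_euclidean_subtopology_iff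
    by (auto intro!: exI[of _ 1] simp: dist_norm; meson near CU subsetD imageI image_eqI)+
  then have "closedin (top_of_set ?C) (?C \<inter> uexp ` sa)"
    by (metis Diff_Diff_Int closedin_diff closedin_topspace openin_closedin_eq topspace_euclidean_subtopology)
  with op(1) conn have "?C \<inter> uexp ` sa = {} \<or> ?C \<inter> uexp ` sa = ?C"
    using connected_clopen by blast
  moreover have "1 \<in> uexp ` (sa :: 'a set)" by (rule image_eqI[of _ _ 0]) (auto simp: sa_0)
  ultimately show "?C \<subseteq> uexp ` sa" using 1 by blast
qed

definition integral_elements :: "'a::abelian_unital_cstar_algebra set" where
  "integral_elements = {a \<in> sa. \<forall>\<phi>\<in>characters. \<phi> a \<in> \<int>}"

lemma uexp_eq_1_iff: "uexp a = 1 \<longleftrightarrow> (\<forall>\<phi>\<in>characters. \<phi> a \<in> \<int>)"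
proof -
  have "uexp a = 1 \<longleftrightarrow> (\<forall>\<phi>\<in>characters. cis (2 * pi * \<phi> a) = 1)"
    by (metis ceval_1 ceval_eqI ceval_uexp)
  moreover have "cis (2 * pi * t) = 1 \<longleftrightarrow> t \<in> \<int>" for t :: real
  proof -
    have "cis (2 * pi * t) = 1 \<longleftrightarrow> (\<exists>n::int. 2 * pi * t = 2 * pi * of_int n)"
      using exp_eq_1[of "\<i> * complex_of_real (2 * pi * t)"]
      by (simp add: cis_conv_exp mult.commute mult.left_commute)
    also have "\<dots> \<longleftrightarrow> t \<in> \<int>" by (auto simp: Ints_def)
    finally show ?thesis .
  qed
  ultimately show ?thesis by simp
qed

lemma uexp_eq_iff:
  assumes "a \<in> sa" "b \<in> sa"
  shows "uexp a = uexp b \<longleftrightarrow> a - b \<in> integral_elements"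
proof -
  have "uexp a = uexp b \<longleftrightarrow> uexp (a - b) = 1"
    using uexp_add[of "a - b" b] uexp_add[of a "- b"] uexp_minus[of b] by (auto simp: mult.commute)
  then show ?thesis using assms by (simp add: uexp_eq_1_iff integral_elements_def sa_diff)
qed

lemma integral_element_small:
  assumes "l \<in> integral_elements" "norm l < 1"
  shows "l = 0"
proof (rule sa_eqI)
  fix \<phi> :: "'a \<Rightarrow> real" assume p: "\<phi> \<in> characters"
  have "\<phi> l \<in> \<int>" "\<bar>\<phi> l\<bar> < 1" using assms p characterD(4)[OF p, of l] by (auto simp: integral_elements_def)
  then show "\<phi> l = \<phi> 0" using Ints_nonzero_abs_less1[of "\<phi> l"] by (simp add: characterD(10)[OF p])
qed (use assms in \<open>auto simp: integral_elements_def sa_0\<close>)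

text \<open>Over the unit ball around u = uexp a0 the sheets are indexed by the lattice: the sheet
  of l consists of the lifts within 1/2 of a0 + l, and its section is a0 + l plus the local
  logarithm.\<close>

lemma covering_space_uexp: "covering_space (sa :: 'a::abelian_unital_cstar_algebra set) uexp U0"
proof
  show "continuous_on sa uexp" by (rule continuous_on_uexp)
  show "uexp ` sa = U0" by (simp add: U0_eq)
next
  fix u :: 'a assume u: "u \<in> U0"
  then obtain a0 where a0: "a0 \<in> sa" "u = uexp a0" by (auto simp: U0_eq)
  define T where "T = {v \<in> U0. norm (v - u) < 1}"
  \<comment> \<open>The radius 1/2 leaves room for logarithms, of norm at most 1/4, and keeps the
    sheets of distinct lattice elements disjoint, as these are at distance at least 1.\<close>
  define S where "S l = {a \<in> sa. norm (uexp a - u) < 1 \<and> norm (a - (a0 + l)) < 1 / 2}" for l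
  define q where "q l v = (a0 + l) + ulog (uexp (- a0) * v)" for l v
  have uni: "v \<in> unitary_elements" if "v \<in> T" for v
    using that by (auto simp: T_def U0_eq uexp_unitary)
  have near: "ulog (uexp (- a0) * v) \<in> sa" "uexp (a0 + ulog (uexp (- a0) * v)) = v"
    "norm (ulog (uexp (- a0) * v)) \<le> 1 / 4" if "v \<in> T" for v
    using uexp_near[OF uni[OF that], of a0] that by (auto simp: T_def a0)
  have L: "l \<in> sa" "uexp (a + l) = uexp a" if "l \<in> integral_elements" for l a
    using that by (auto simp: integral_elements_def uexp_add uexp_eq_1_iff[THEN iffD2])
  have pq: "uexp (q l v) = v" "q l v \<in> sa" if "v \<in> T" "l \<in> integral_elements" for l v
  proof -
    have "q l v = (a0 + ulog (uexp (- a0) * v)) + l" by (simp add: q_def)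
    then show "uexp (q l v) = v" using near[OF that(1)] L[OF that(2)] by simp
    show "q l v \<in> sa" using near[OF that(1)] L[OF that(2)] a0 by (simp add: q_def sa_add)
  qed
  have op: "open {a. norm (uexp a - u) < 1 \<and> norm (a - (a0 + l)) < 1 / 2}" for l
    by (intro open_Collect_conj open_Collect_less continuous_intros continuous_on_uexp)
  show "\<exists>T. u \<in> T \<and> openin (top_of_set U0) T \<and>
           (\<exists>v. \<Union> v = sa \<inter> uexp -` T \<and> (\<forall>u\<in>v. openin (top_of_set sa) u) \<and>
                pairwise disjnt v \<and> (\<forall>u\<in>v. \<exists>q. homeomorphism u T uexp q))"
  proof (intro exI[of _ T] exI[of _ "S ` integral_elements"] conjI ballI)
    show "u \<in> T" using u by (simp add: T_def)
    have "T = U0 \<inter> {v. norm (v - u) < 1}" by (auto simp: T_def)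
    moreover have "open {v. norm (v - u) < 1}"
      by (intro open_Collect_less continuous_intros)
    ultimately show "openin (top_of_set U0) T" by (auto simp: openin_open)
    show "\<Union> (S ` integral_elements) = sa \<inter> uexp -` T"
    proof
      show "\<Union> (S ` integral_elements) \<subseteq> sa \<inter> uexp -` T"
        by (auto simp: S_def T_def U0_eq)
      show "sa \<inter> uexp -` T \<subseteq> \<Union> (S ` integral_elements)"
      proof
        fix b assume b: "b \<in> sa \<inter> uexp -` T"
        define l where "l = b - (a0 + ulog (uexp (- a0) * uexp b))"
        have "l \<in> integral_elements"
          unfolding l_def using b near[of "uexp b"] a0 by (subst uexp_eq_iff[symmetric]) (auto intro: sa_add)
        moreover have "norm (b - (a0 + l)) < 1 / 2"
          using near(3)[of "uexp b"] b by (simp add: l_def)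
        ultimately show "b \<in> \<Union> (S ` integral_elements)"
          using b by (auto simp: S_def T_def)
      qed
    qed
    show "pairwise disjnt (S ` integral_elements)"
    proof (rule pairwiseI, clarsimp simp: disjnt_iff)
      fix l l' x assume l: "l \<in> integral_elements" "l' \<in> integral_elements" "S l \<noteq> S l'" and x: "x \<in> S l" "x \<in> S l'"
      have "l - l' = (x - (a0 + l')) - (x - (a0 + l))" by simp
      then have "norm (l - l') < 1"
        using x norm_triangle_ineq4[of "x - (a0 + l')" "x - (a0 + l)"] by (simp add: S_def)
      moreover have "l - l' \<in> integral_elements"
        using l by (auto simp: integral_elements_def sa_diff characterD(8))
      ultimately have "l - l' = 0" by (rule integral_element_small[rotated])
      then show False using l(3) by simp
    qed
  next
    fix V assume "V \<in> S ` integral_elements"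
    then obtain l where l: "l \<in> integral_elements" "V = S l" by blast
    have "S l = sa \<inter> {a. norm (uexp a - u) < 1 \<and> norm (a - (a0 + l)) < 1 / 2}" by (auto simp: S_def)
    then show "openin (top_of_set sa) V" using op[of l] l(2) by (auto simp: openin_open)
    have "homeomorphism (S l) T uexp (q l)"
    proof (rule homeomorphismI)
      show "continuous_on (S l) uexp" by (rule continuous_on_uexp)
      show "uexp ` S l \<subseteq> T" by (auto simp: S_def T_def U0_eq)
      show "q l ` T \<subseteq> S l"
      proof (clarsimp)
        fix v assume v: "v \<in> T"
        show "q l v \<in> S l"
          using pq[OF v l(1)] near(3)[OF v] v by (simp add: S_def T_def) (simp add: q_def)
      qed
      show "uexp (q l v) = v" if "v \<in> T" for v using pq(1)[OF that l(1)] .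
      show "q l (uexp a) = a" if a: "a \<in> S l" for a
      proof -
        have v: "uexp a \<in> T" using a by (auto simp: S_def T_def U0_eq)
        have sa: "a \<in> sa" using a by (simp add: S_def)
        have "q l (uexp a) - a \<in> integral_elements"
          using pq[OF v l(1)] uexp_eq_iff[OF pq(2)[OF v l(1)] sa] by simp
        \<comment> \<open>Two lifts of one point differ by a lattice element. Here the difference is
          bounded by 1/4 plus a number below 1/2, which forces it to vanish.\<close>
        moreover have "norm (q l (uexp a) - a) < 1"
        proof -
          have "q l (uexp a) - a = ulog (uexp (- a0) * uexp a) - (a - (a0 + l))"
            by (simp add: q_def)
          also have "norm \<dots> \<le> norm (ulog (uexp (- a0) * uexp a)) + norm (a - (a0 + l))"
            by (rule norm_triangle_ineq4)
          also have "\<dots> < 1" using near(3)[OF v] a by (simp add: S_def)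
          finally show ?thesis .
        qed
        ultimately show ?thesis using integral_element_small by fastforce
      qed
      show "continuous_on T (q l)"
      proof (rule continuous_onI)
        fix v e :: _ assume v: "v \<in> T" and e: "(e::real) > 0"
        \<comment> \<open>Two logarithms differ by at most 1/4 + 1/4, just within the range of
          \<open>norm_le_uexp\<close>; hence the section is 1-Lipschitz.\<close>
        have "dist (q l v') (q l v) \<le> norm (v' - v)" if v': "v' \<in> T" for v'
        proof -
          let ?d = "q l v' - q l v"
          have "norm ?d \<le> 1 / 2"
            using near(3)[OF v] near(3)[OF v']
              norm_triangle_ineq4[of "ulog (uexp (- a0) * v')" "ulog (uexp (- a0) * v)"]
            by (simp add: q_def)
          then have "norm ?d \<le> norm (uexp ?d - 1)"
            by (intro norm_le_uexp sa_diff pq(2) v v' l(1))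
          also have "\<dots> = norm (uexp (q l v) * (uexp ?d - 1))"
            by (rule norm_unitary_mult[OF uexp_unitary, symmetric])
          also have "uexp (q l v) * (uexp ?d - 1) = v' - v"
            using pq(1)[OF v l(1)] pq(1)[OF v' l(1)] uexp_add[of "q l v" ?d]
            by (simp add: right_diff_distrib)
          finally show ?thesis by (simp add: dist_norm)
        qed
        then show "\<exists>d>0. \<forall>x'\<in>T. dist x' v < d \<longrightarrow> dist (q l x') (q l v) \<le> e"
          using e by (intro exI[of _ e]) (force simp: dist_norm)
      qed
    qed
    then show "\<exists>q. homeomorphism V T uexp q" using l by blast
  qed
qed

section \<open>The fundamental group\<close>

lemma Collect_homotopic_eq_iff:
  "path p \<Longrightarrow> path_image p \<subseteq> S \<Longrightarrow>
    Collect (homotopic_paths S p) = Collect (homotopic_paths S q) \<longleftrightarrow> homotopic_paths S p q"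
  by (metis Collect_cong homotopic_paths_refl homotopic_paths_sym_eq homotopic_paths_trans mem_Collect_eq)

lemma fundamental_group_mult:
  assumes p: "p \<in> loops_at S x" and q: "q \<in> loops_at S x"
  shows "Collect (homotopic_paths S p) \<otimes>\<^bsub>fundamental_group S x\<^esub> Collect (homotopic_paths S q)
    = Collect (homotopic_paths S (p +++ q))"
proof -
  have *: "homotopic_paths S (p +++ q) (p' +++ q')"
    if "homotopic_paths S p p'" "homotopic_paths S q q'" for p' q'
    using that p q by (intro homotopic_paths_join) (auto simp: loops_at_def)
  have "homotopic_paths S p p" "homotopic_paths S q q" using p q by (auto simp: loops_at_def)
  then have "(\<exists>p'. homotopic_paths S p p' \<and> (\<exists>q'. homotopic_paths S q q' \<and> homotopic_paths S (p' +++ q') r))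
      \<longleftrightarrow> homotopic_paths S (p +++ q) r" for r
    using * homotopic_paths_trans by metis
  then show ?thesis by (simp add: fundamental_group_def Bex_def)
qed

lemma loops_at_join: "p \<in> loops_at S x \<Longrightarrow> q \<in> loops_at S x \<Longrightarrow> p +++ q \<in> loops_at S x"
  by (auto simp: loops_at_def path_image_join)

lemma homeomorphism_loops:
  assumes "homeomorphism S T f g" "p \<in> loops_at S x"
  shows "f \<circ> p \<in> loops_at T (f x)"
  using assms
  by (auto simp: loops_at_def homeomorphism_def pathstart_compose pathfinish_compose path_image_compose
      intro!: path_continuous_image intro: continuous_on_subset)

lemma fundamental_group_homeomorphic:
  assumes h: "homeomorphism S T f g" and x: "x \<in> S"
  shows "fundamental_group S x \<cong> fundamental_group T (f x)"
proof -
  \<comment> \<open>Collecting everything homotopic to the image of some member avoids a choice of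
    representatives.\<close>
  define F where "F P = {r. \<exists>p\<in>P. homotopic_paths T (f \<circ> p) r}" for P
  have hf: "homotopic_paths T (f \<circ> p) (f \<circ> q)" if "homotopic_paths S p q" for p q
    using h by (intro homotopic_paths_continuous_image[OF that]) (auto simp: homeomorphism_def)
  have hg: "homotopic_paths S (g \<circ> p) (g \<circ> q)" if "homotopic_paths T p q" for p q
    using h by (intro homotopic_paths_continuous_image[OF that]) (auto simp: homeomorphism_def)
  have gfp: "homotopic_paths S p (g \<circ> (f \<circ> p))" if "p \<in> loops_at S x" for p
    using that h by (intro homotopic_paths_eq)
      (auto simp: loops_at_def homeomorphism_def path_image_def image_subset_iff)
  have fgp: "homotopic_paths T p (f \<circ> (g \<circ> p))" if "p \<in> loops_at T (f x)" for p
    using that h by (intro homotopic_paths_eq)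
      (auto simp: loops_at_def homeomorphism_def path_image_def image_subset_iff)
  have F: "F (Collect (homotopic_paths S p)) = Collect (homotopic_paths T (f \<circ> p))"
    if p: "p \<in> loops_at S x" for p
  proof -
    have "homotopic_paths S p p" using p by (auto simp: loops_at_def)
    then have "(\<exists>q. homotopic_paths S p q \<and> homotopic_paths T (f \<circ> q) r) \<longleftrightarrow> homotopic_paths T (f \<circ> p) r" for r
      using hf homotopic_paths_trans by metis
    then show ?thesis by (simp add: F_def Bex_def)
  qed
  have loop: "f \<circ> p \<in> loops_at T (f x)" if "p \<in> loops_at S x" for p
    by (rule homeomorphism_loops[OF h that])
  have gloop: "g \<circ> p \<in> loops_at S x" if "p \<in> loops_at T (f x)" for p
    using homeomorphism_loops[OF homeomorphism_symD[OF h] that] h x by (simp add: homeomorphism_def)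
  have carr: "carrier (fundamental_group S x) = (\<lambda>p. Collect (homotopic_paths S p)) ` loops_at S x" for S :: "'c::topological_space set" and x
    by (simp add: fundamental_group_def)
  have "F \<in> iso (fundamental_group S x) (fundamental_group T (f x))"
    unfolding iso_def bij_betw_def
  proof (intro CollectI conjI)
    show "F \<in> hom (fundamental_group S x) (fundamental_group T (f x))"
      by (rule homI)
        (auto simp: carr F loop loops_at_join fundamental_group_mult path_compose_join)
    show "inj_on F (carrier (fundamental_group S x))"
    proof (rule inj_onI, clarsimp simp: carr F)
      fix p q assume p: "p \<in> loops_at S x" and q: "q \<in> loops_at S x"
        and "Collect (homotopic_paths T (f \<circ> p)) = Collect (homotopic_paths T (f \<circ> q))"
      then have "homotopic_paths T (f \<circ> p) (f \<circ> q)"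
        using loop[OF p] by (subst (asm) Collect_homotopic_eq_iff) (auto simp: loops_at_def)
      then have "homotopic_paths S p q"
        using hg gfp[OF p] gfp[OF q] by (meson homotopic_paths_sym homotopic_paths_trans)
      then show "Collect (homotopic_paths S p) = Collect (homotopic_paths S q)"
        using p by (subst Collect_homotopic_eq_iff) (auto simp: loops_at_def)
    qed
    show "F ` carrier (fundamental_group S x) = carrier (fundamental_group T (f x))"
    proof
      show "F ` carrier (fundamental_group S x) \<subseteq> carrier (fundamental_group T (f x))"
        by (auto simp: carr F loop)
      show "carrier (fundamental_group T (f x)) \<subseteq> F ` carrier (fundamental_group S x)"
      proof (clarsimp simp: carr)
        fix r assume r: "r \<in> loops_at T (f x)"
        have "Collect (homotopic_paths T r) = Collect (homotopic_paths T (f \<circ> (g \<circ> r)))"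
          using fgp[OF r] r by (subst Collect_homotopic_eq_iff) (auto simp: loops_at_def)
        also have "\<dots> = F (Collect (homotopic_paths S (g \<circ> r)))" by (simp add: F gloop[OF r])
        finally show "Collect (homotopic_paths T r) \<in> F ` (\<lambda>p. Collect (homotopic_paths S p)) ` loops_at S x"
          using gloop[OF r] by blast
      qed
    qed
  qed
  then show ?thesis by (auto simp: is_iso_def)
qed

text \<open>Beyond homotopy invariance only the base point needs care: the image of 1 is an
  idempotent unitary, hence 1.\<close>

lemma topologically_isomorphic_imp_pi1_iso:
  assumes "topologically_isomorphic (U0_group :: 'a::abelian_unital_cstar_algebra monoid)
    (U0_group :: 'b::abelian_unital_cstar_algebra monoid)"
  shows "pi1_U0 TYPE('a) \<cong> pi1_U0 TYPE('b)"
proof -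
  obtain f where f: "f \<in> iso (U0_group :: 'a monoid) (U0_group :: 'b monoid)"
    "homeomorphic_map (top_of_set U0) (top_of_set U0) f"
    using assms by (auto simp: topologically_isomorphic_def U0_group_def)
  obtain g where "homeomorphic_maps (top_of_set U0) (top_of_set U0) f g"
    using f(2) by (auto simp: homeomorphic_map_maps)
  then have h: "homeomorphism (U0 :: 'a set) (U0 :: 'b set) f g"
    by (auto simp: homeomorphic_maps_def homeomorphism_def continuous_map_in_subtopology image_subset_iff Pi_iff)
       (metis imageI image_eqI)+
  have 1: "1 \<in> (U0 :: 'a set)" by (auto simp: U0_eq sa_0 intro!: image_eqI[of _ _ 0])
  have f1: "f 1 \<in> U0" using h 1 by (auto simp: homeomorphism_def)
  then have u: "star (f 1) * f 1 = 1" by (auto simp: U0_eq uexp_unitary[unfolded unitary_elements_def, simplified])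
  have "f (1 * 1) = f 1 * f 1"
    using f(1) 1 unfolding iso_def hom_def by (auto simp: U0_group_def)
  then have "star (f 1) * f 1 = star (f 1) * (f 1 * f 1)" by simp
  then have "f 1 = 1" using u by (simp flip: mult.assoc)
  with fundamental_group_homeomorphic[OF h 1] show ?thesis by simp
qed

section \<open>Loops given by integral elements\<close>

definition integral_group :: "'a::abelian_unital_cstar_algebra monoid" where
  "integral_group = \<lparr>carrier = integral_elements, monoid.mult = (+), one = 0\<rparr>"

lemma integral_elements_intros:
  shows integral_add: "a \<in> integral_elements \<Longrightarrow> b \<in> integral_elements \<Longrightarrow> a + b \<in> integral_elements"
    and integral_minus: "a \<in> integral_elements \<Longrightarrow> - a \<in> integral_elements"
    and integral_diff: "a \<in> integral_elements \<Longrightarrow> b \<in> integral_elements \<Longrightarrow> a - b \<in> integral_elements"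
    and integral_0: "0 \<in> integral_elements"
  by (auto simp: integral_elements_def characterD intro!: sa_intros)

lemma integral_group_simps [simp]:
  "carrier integral_group = integral_elements" "x \<otimes>\<^bsub>integral_group\<^esub> y = x + y" "\<one>\<^bsub>integral_group\<^esub> = 0"
  by (simp_all add: integral_group_def)

lemma group_integral_group: "group (integral_group :: 'a::abelian_unital_cstar_algebra monoid)"
proof (rule groupI)
  fix x :: 'a assume "x \<in> carrier integral_group"
  then show "\<exists>y\<in>carrier integral_group. y \<otimes>\<^bsub>integral_group\<^esub> x = \<one>\<^bsub>integral_group\<^esub>"
    by (intro bexI[of _ "- x"]) (auto intro: integral_minus)
qed (auto simp: integral_0 integral_add add.assoc)

lemma inv_integral_group: "x \<in> integral_elements \<Longrightarrow> inv\<^bsub>integral_group\<^esub> x = - x"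
  by (rule group.inv_equality[OF group_integral_group]) (auto intro: integral_minus)

definition uloop :: "'a::abelian_unital_cstar_algebra \<Rightarrow> real \<Rightarrow> 'a" where
  "uloop l = (\<lambda>t. uexp (t *\<^sub>R l))"

lemma uexp_integral: "l \<in> integral_elements \<Longrightarrow> uexp l = 1"
  by (simp add: uexp_eq_1_iff integral_elements_def)

lemma integral_sa: "l \<in> integral_elements \<Longrightarrow> l \<in> sa"
  by (simp add: integral_elements_def)

lemma path_scaleR: "path (\<lambda>t. t *\<^sub>R (l::'a::real_normed_vector))"
  unfolding path_def by (intro continuous_intros)

lemma uloop_loop: "l \<in> integral_elements \<Longrightarrow> uloop l \<in> loops_at U0 1"
  using path_continuous_image[OF path_scaleR[of l] continuous_on_uexp]
  by (auto simp: loops_at_def uloop_def o_def path_image_def pathstart_def pathfinish_def uexp_integral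
      U0_eq integral_sa intro!: imageI sa_scaleR)

text \<open>The self-adjoint elements are convex, so a path in them can be straightened with fixed
  endpoints before it is exponentiated.\<close>

lemma homotopic_uloop:
  assumes l: "l \<in> integral_elements" and h: "path h" "path_image h \<subseteq> sa" "pathstart h = 0" "pathfinish h = l"
  shows "homotopic_paths U0 (uexp \<circ> h) (uloop l)"
proof -
  have "homotopic_paths sa h (\<lambda>t. t *\<^sub>R l)"
  proof (rule homotopic_paths_linear)
    fix t :: real assume t: "t \<in> {0..1}"
    have "h t \<in> sa" using h t by (auto simp: path_image_def)
    then show "closed_segment (h t) (t *\<^sub>R l) \<subseteq> sa"
      by (intro closed_segment_subset convex_sa sa_scaleR integral_sa[OF l])
  qed (use h in \<open>auto simp: path_scaleR pathstart_def pathfinish_def\<close>)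
  then have "homotopic_paths U0 (uexp \<circ> h) (uexp \<circ> (\<lambda>t. t *\<^sub>R l))"
    by (rule homotopic_paths_continuous_image[OF _ continuous_on_uexp]) (simp add: U0_eq)
  then show ?thesis by (simp add: uloop_def o_def)
qed

text \<open>The inverse map sends a loop to the endpoint of its lift. That \<open>h\<close> respects
  units is recorded because the group axioms are not verified on homotopy classes directly: it lets
  \<open>finitely_generated_iso\<close> carry the group structure over from the lattice.\<close>

lemma integral_group_iso_pi1_one:
  "\<exists>h\<in>iso (integral_group :: 'a monoid) (pi1_U0 TYPE('a::abelian_unital_cstar_algebra)).
    h \<one>\<^bsub>integral_group\<^esub> = \<one>\<^bsub>pi1_U0 TYPE('a)\<^esub>"
proof -
  let ?H = "\<lambda>p::real \<Rightarrow> 'a. Collect (homotopic_paths U0 p)"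
  let ?P = "pi1_U0 TYPE('a)"
  define h where "h l = ?H (uloop l)" for l :: 'a
  have carr: "carrier ?P = ?H ` loops_at U0 1" by (simp add: fundamental_group_def)
  have "h \<in> iso integral_group ?P"
    unfolding iso_def bij_betw_def
  proof (intro CollectI conjI)
    show "h \<in> hom integral_group ?P"
    proof (rule homI)
      fix l m :: 'a assume "l \<in> carrier integral_group" "m \<in> carrier integral_group"
      then have lm: "l \<in> integral_elements" "m \<in> integral_elements" by auto
      \<comment> \<open>The lift of the product loop: the segment to l, followed by the segment to m
        translated by l.\<close>
      let ?g = "(\<lambda>t. t *\<^sub>R l) +++ (\<lambda>t. l + t *\<^sub>R m)"
      have "path (\<lambda>t. l + t *\<^sub>R m)" unfolding path_def by (intro continuous_intros)
      then have "path ?g"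
        using path_scaleR[of l] by (intro path_join_imp) (auto simp: pathstart_def pathfinish_def)
      moreover have g: "pathstart ?g = 0" "pathfinish ?g = l + m"
        by (auto simp: pathstart_def pathfinish_def joinpaths_def)
      moreover have "path_image ?g \<subseteq> sa"
        using integral_sa[OF lm(1)] integral_sa[OF lm(2)]
        by (auto simp: path_image_def joinpaths_def intro!: sa_add sa_scaleR)
      ultimately have "homotopic_paths U0 (uexp \<circ> ?g) (uloop (l + m))"
        using homotopic_uloop[OF integral_add[OF lm]] by blast
      moreover have "uexp \<circ> ?g = uloop l +++ uloop m"
        by (auto simp: fun_eq_iff joinpaths_def uloop_def uexp_add uexp_integral lm)
      ultimately have "homotopic_paths U0 (uloop (l + m)) (uloop l +++ uloop m)"
        by (simp add: homotopic_paths_sym_eq)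
      then show "h (l \<otimes>\<^bsub>integral_group\<^esub> m) = h l \<otimes>\<^bsub>?P\<^esub> h m"
        using uloop_loop[OF integral_add[OF lm]]
        by (simp add: h_def fundamental_group_mult uloop_loop lm)
           (subst Collect_homotopic_eq_iff; auto simp: loops_at_def)
    qed (auto simp: carr h_def uloop_loop)
    show "inj_on h (carrier integral_group)"
    proof (rule inj_onI)
      fix l m :: 'a assume "l \<in> carrier integral_group" "m \<in> carrier integral_group" "h l = h m"
      then have lm: "l \<in> integral_elements" "m \<in> integral_elements" and "h l = h m" by auto
      then have hom: "homotopic_paths U0 (uloop l) (uloop m)"
        using uloop_loop[OF lm(1)] unfolding h_def
        by (subst (asm) Collect_homotopic_eq_iff) (auto simp: loops_at_def)
      have "pathfinish (\<lambda>t. t *\<^sub>R l) = pathfinish (\<lambda>t. t *\<^sub>R m)"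
        by (rule covering_space_monodromy[OF covering_space_uexp _ _ _ _ hom])
           (use uloop_loop[OF lm(1)] uloop_loop[OF lm(2)] integral_sa[OF lm(1)] integral_sa[OF lm(2)] in
             \<open>auto simp: loops_at_def path_scaleR path_image_def uloop_def pathstart_def intro!: sa_scaleR\<close>)
      then show "l = m" by (simp add: pathfinish_def)
    qed
    show "h ` carrier integral_group = carrier ?P"
    proof
      show "h ` carrier integral_group \<subseteq> carrier ?P" by (auto simp: carr h_def uloop_loop)
      show "carrier ?P \<subseteq> h ` carrier integral_group"
      proof (clarsimp simp: carr)
        fix p :: "real \<Rightarrow> 'a" assume p: "p \<in> loops_at U0 1"
        then have p': "path p" "path_image p \<subseteq> U0" "pathstart p = uexp 0" "pathfinish p = 1"
          by (auto simp: loops_at_def)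
        obtain k where k: "path k" "path_image k \<subseteq> sa" "pathstart k = 0" "\<And>t. t \<in> {0..1} \<Longrightarrow> uexp (k t) = p t"
          using covering_space_lift_path_strong[OF covering_space_uexp sa_0 p'(1-3)] by blast
        have "pathfinish k \<in> sa" using k(2) by (meson pathfinish_in_path_image subsetD)
        moreover have "uexp (pathfinish k) = 1" using k(4)[of 1] p'(4) by (simp add: pathfinish_def)
        ultimately have l: "pathfinish k \<in> integral_elements"
          by (simp add: integral_elements_def uexp_eq_1_iff)
        have "homotopic_paths U0 p (uexp \<circ> k)"
          by (rule homotopic_paths_eq[OF p'(1,2)]) (simp add: k(4))
        then have "homotopic_paths U0 p (uloop (pathfinish k))"
          using homotopic_uloop[OF l k(1,2,3) refl] homotopic_paths_trans by blast
        then have "?H p = h (pathfinish k)"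
          unfolding h_def using p' by (subst Collect_homotopic_eq_iff) auto
        then show "?H p \<in> h ` integral_elements" using l by blast
      qed
    qed
  qed
  moreover have "h 0 = \<one>\<^bsub>?P\<^esub>" by (simp add: h_def fundamental_group_def uloop_def)
  ultimately show ?thesis by (intro bexI[of _ h]) simp_all
qed

section \<open>The lattice of integral elements\<close>

lemma finitely_generated_iso:
  assumes G: "group G" and iso: "h \<in> iso G H" "h \<one>\<^bsub>G\<^esub> = \<one>\<^bsub>H\<^esub>" and fg: "finitely_generated H"
  shows "\<exists>S. finite S \<and> S \<subseteq> carrier G \<and> generate G S = carrier G"
proof -
  interpret G: group G by fact
  have "group (H\<lparr>one := h \<one>\<^bsub>G\<^esub>\<rparr>)" by (rule G.iso_imp_img_group[OF iso(1)])
  then interpret H: group H by (simp add: iso(2))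
  define k where "k = inv_into (carrier G) h"
  have k: "k \<in> iso H G" unfolding k_def by (rule G.iso_set_sym[OF iso(1)])
  interpret k: group_hom H G k
    using k by unfold_locales (auto simp: iso_def)
  obtain S where S: "finite S" "S \<subseteq> carrier H" "generate H S = carrier H"
    using fg by (auto simp: finitely_generated_def)
  have im: "k ` carrier H = carrier G" using k by (simp add: iso_def bij_betw_def)
  then have "generate G (k ` S) = carrier G" using k.generate_img[OF S(2)] S(3) by simp
  moreover have "k ` S \<subseteq> carrier G" using S(2) im by blast
  ultimately show ?thesis using S(1) by blast
qed

lemma character_sum: "\<phi> \<in> characters \<Longrightarrow> \<phi> (sum f I) = (\<Sum>i\<in>I. \<phi> (f i))"
  by (induction I rule: infinite_finite_induct) (simp_all add: characterD(1,10))

text \<open>Base points: exactly one character from each class of characters that agree on C(X, Z).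
  Finiteness is included, since it is what makes the classes open.\<close>

definition rep_set :: "('a::abelian_unital_cstar_algebra \<Rightarrow> real) set \<Rightarrow> bool" where
  "rep_set F \<longleftrightarrow> finite F \<and> F \<subseteq> characters \<and>
     (\<forall>\<phi>\<in>characters. \<exists>\<psi>\<in>F. \<forall>l\<in>integral_elements. \<phi> l = \<psi> l) \<and>
     (\<forall>\<phi>\<in>F. \<forall>\<psi>\<in>F. (\<forall>l\<in>integral_elements. \<phi> l = \<psi> l) \<longrightarrow> \<phi> = \<psi>)"

lemma Ints_bounded_finite: "finite {x::real. x \<in> \<int> \<and> \<bar>x\<bar> \<le> c}"
proof -
  have "{x::real. x \<in> \<int> \<and> \<bar>x\<bar> \<le> c} \<subseteq> of_int ` {- \<lceil>c\<rceil>..\<lceil>c\<rceil>}"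
  proof
    fix x :: real assume "x \<in> {x. x \<in> \<int> \<and> \<bar>x\<bar> \<le> c}"
    then obtain n :: int where n: "x = of_int n" "\<bar>x\<bar> \<le> c" by (auto elim: Ints_cases)
    then have "n \<in> {- \<lceil>c\<rceil>..\<lceil>c\<rceil>}" by simp linarith
    then show "x \<in> of_int ` {- \<lceil>c\<rceil>..\<lceil>c\<rceil>}" using n by blast
  qed
  then show ?thesis by (rule finite_subset) simp
qed

text \<open>On the lattice a character is determined by its values at finitely many generators, and
  these are integers bounded by the norms of the generators, so only finitely many restrictions
  occur.\<close>

lemma rep_set_exists:
  assumes fg: "finitely_generated (pi1_U0 TYPE('a::abelian_unital_cstar_algebra))"
  shows "\<exists>F :: ('a \<Rightarrow> real) set. rep_set F"
proof -
  let ?X = "characters :: ('a \<Rightarrow> real) set" and ?L = "integral_elements :: 'a set"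
  obtain h where h: "h \<in> iso (integral_group :: 'a monoid) (pi1_U0 TYPE('a))"
    "h \<one>\<^bsub>integral_group\<^esub> = \<one>\<^bsub>pi1_U0 TYPE('a)\<^esub>"
    using integral_group_iso_pi1_one by blast
  obtain S where S: "finite S" "S \<subseteq> ?L" "generate integral_group S = ?L"
    using finitely_generated_iso[OF group_integral_group h fg] by auto
  have agree: "\<phi> l = \<psi> l"
    if p: "\<phi> \<in> ?X" "\<psi> \<in> ?X" and eq: "\<forall>s\<in>S. \<phi> s = \<psi> s" and l: "l \<in> ?L" for \<phi> \<psi> l
  proof -
    have "l \<in> generate integral_group S" using l S(3) by simp
    then show ?thesis
    proof (induction rule: generate.induct)
      case (inv s)
      then show ?case using eq S(2) p by (simp add: inv_integral_group subsetD characterD(7))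
    qed (use eq p in \<open>auto simp: characterD(1,10)\<close>)
  qed
  \<comment> \<open>The default value 0 off \<open>S\<close> places the restrictions in a finite set
    of functions on the whole algebra.\<close>
  define c where "c \<phi> = (\<lambda>s. if s \<in> S then \<phi> s else 0)" for \<phi> :: "'a \<Rightarrow> real"
  have "finite (c ` ?X)"
  proof (rule finite_subset)
    show "c ` ?X \<subseteq> {f. \<forall>x. (x \<in> S \<longrightarrow> f x \<in> {x. x \<in> \<int> \<and> \<bar>x\<bar> \<le> Max (norm ` S)}) \<and> (x \<notin> S \<longrightarrow> f x = 0)}"
    proof clarsimp
      fix \<phi> x assume p: "\<phi> \<in> ?X"
      have "\<bar>\<phi> x\<bar> \<le> Max (norm ` S)" if "x \<in> S"
      proof -
        have "norm x \<le> Max (norm ` S)" using that S(1) by (intro Max_ge) auto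
        then show ?thesis using characterD(4)[OF p, of x] by linarith
      qed
      then show "(x \<in> S \<longrightarrow> c \<phi> x \<in> \<int> \<and> \<bar>c \<phi> x\<bar> \<le> Max (norm ` S)) \<and> (x \<notin> S \<longrightarrow> c \<phi> x = 0)"
        using p S(2) by (auto simp: c_def integral_elements_def)
    qed
  qed (rule finite_set_of_finite_funs[OF S(1) Ints_bounded_finite])
  have rep: "\<phi> l = \<psi> l" if "\<phi> \<in> ?X" "\<psi> \<in> ?X" "c \<phi> = c \<psi>" "l \<in> ?L" for \<phi> \<psi> l
  proof (rule agree[OF that(1,2) _ that(4)])
    show "\<forall>s\<in>S. \<phi> s = \<psi> s" using fun_cong[OF that(3)] by (auto simp: c_def split: if_splits) metis
  qed
  define F where "F = inv_into ?X c ` (c ` ?X)"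
  have inF: "inv_into ?X c y \<in> ?X" "c (inv_into ?X c y) = y" if "y \<in> c ` ?X" for y
    using that by (auto simp: inv_into_into f_inv_into_f)
  have "rep_set F"
    unfolding rep_set_def
  proof (intro conjI ballI impI)
    show "finite F" using \<open>finite (c ` ?X)\<close> by (simp add: F_def)
    show "F \<subseteq> ?X" using inF(1) by (auto simp: F_def)
    show "\<exists>\<psi>\<in>F. \<forall>l\<in>?L. \<phi> l = \<psi> l" if p: "\<phi> \<in> ?X" for \<phi>
    proof (rule bexI[of _ "inv_into ?X c (c \<phi>)"])
      show "inv_into ?X c (c \<phi>) \<in> F" using p by (auto simp: F_def)
      show "\<forall>l\<in>?L. \<phi> l = inv_into ?X c (c \<phi>) l" using p inF[of "c \<phi>"] rep by force
    qed
    show "\<phi> = \<psi>" if F: "\<phi> \<in> F" "\<psi> \<in> F" and eq: "\<forall>l\<in>?L. \<phi> l = \<psi> l" for \<phi> \<psi>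
    proof -
      obtain y z where y: "y \<in> c ` ?X" "\<phi> = inv_into ?X c y" and z: "z \<in> c ` ?X" "\<psi> = inv_into ?X c z"
        using F by (auto simp: F_def)
      have "c \<phi> = c \<psi>" using eq S(2) by (auto simp: c_def fun_eq_iff)
      then show ?thesis using y z inF by metis
    qed
  qed
  then show ?thesis by blast
qed

text \<open>If a \<open>rep_set\<close> exists, these are the connected components of the character space.\<close>

definition ccomp :: "('a::abelian_unital_cstar_algebra \<Rightarrow> real) \<Rightarrow> ('a \<Rightarrow> real) set" where
  "ccomp \<phi> = {\<psi>\<in>characters. \<forall>l\<in>integral_elements. \<psi> l = \<phi> l}"

definition proj :: "('a::abelian_unital_cstar_algebra \<Rightarrow> real) \<Rightarrow> 'a" where
  "proj \<phi> = gel (indicator (ccomp \<phi>))"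

lemma closed_ccomp: "closed (ccomp \<phi>)"
proof -
  have "ccomp \<phi> = characters \<inter> (\<Inter>l\<in>integral_elements. {\<psi>. \<psi> l = \<phi> l})"
    by (auto simp: ccomp_def)
  moreover have "closed (\<Inter>l\<in>integral_elements. {\<psi>. \<psi> l = \<phi> l})"
    by (intro closed_INT ballI closed_Collect_eq continuous_on_evaluation continuous_on_const)
  ultimately show ?thesis by (simp add: closed_Int compact_imp_closed compact_characters)
qed

context
  fixes F :: "('a::abelian_unital_cstar_algebra \<Rightarrow> real) set"
  assumes F: "rep_set F"
begin

lemma rep_set_D:
  shows "finite F" "\<phi> \<in> F \<Longrightarrow> \<phi> \<in> characters"
    "\<psi> \<in> characters \<Longrightarrow> \<exists>\<phi>\<in>F. \<psi> \<in> ccomp \<phi>"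
    "\<phi> \<in> F \<Longrightarrow> \<psi> \<in> F \<Longrightarrow> \<omega> \<in> ccomp \<phi> \<Longrightarrow> \<omega> \<in> ccomp \<psi> \<Longrightarrow> \<phi> = \<psi>"
    "\<phi> \<in> F \<Longrightarrow> \<phi> \<in> ccomp \<phi>"
proof -
  note R = F[unfolded rep_set_def]
  show "finite F" using R by blast
  show "\<phi> \<in> F \<Longrightarrow> \<phi> \<in> characters" for \<phi> using R by blast
  then show "\<phi> \<in> F \<Longrightarrow> \<phi> \<in> ccomp \<phi>" by (simp add: ccomp_def)
  show "\<exists>\<phi>\<in>F. \<psi> \<in> ccomp \<phi>" if p: "\<psi> \<in> characters"
  proof -
    obtain \<phi> where "\<phi> \<in> F" "\<forall>l\<in>integral_elements. \<psi> l = \<phi> l" using R p by blast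
    then show ?thesis using p by (intro bexI[of _ \<phi>]) (simp_all add: ccomp_def)
  qed
  show "\<phi> = \<psi>" if p: "\<phi> \<in> F" "\<psi> \<in> F" and o: "\<omega> \<in> ccomp \<phi>" "\<omega> \<in> ccomp \<psi>"
  proof -
    have "\<forall>l\<in>integral_elements. \<phi> l = \<psi> l" using o by (simp add: ccomp_def)
    then show ?thesis using R p by blast
  qed
qed

lemma ccomp_complement:
  assumes "\<phi> \<in> F" shows "characters - ccomp \<phi> = \<Union> (ccomp ` (F - {\<phi>}))"
proof (intro equalityI subsetI)
  fix \<psi> assume p: "\<psi> \<in> characters - ccomp \<phi>"
  then obtain \<phi>' where "\<phi>' \<in> F" "\<psi> \<in> ccomp \<phi>'" using rep_set_D(3) by blast
  then show "\<psi> \<in> \<Union> (ccomp ` (F - {\<phi>}))" using p by blast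
next
  fix \<psi> assume "\<psi> \<in> \<Union> (ccomp ` (F - {\<phi>}))"
  then obtain \<phi>' where p: "\<phi>' \<in> F" "\<phi>' \<noteq> \<phi>" "\<psi> \<in> ccomp \<phi>'" by blast
  then have "\<psi> \<notin> ccomp \<phi>" using rep_set_D(4)[OF assms p(1) _ p(3)] by blast
  then show "\<psi> \<in> characters - ccomp \<phi>" using p(3) by (simp add: ccomp_def)
qed

text \<open>Finitely many closed classes partition the space, so each is also open.\<close>

lemma ccomp_clopen:
  assumes "\<phi> \<in> F"
  shows "closedin (top_of_set characters) (ccomp \<phi>)" "openin (top_of_set characters) (ccomp \<phi>)"
proof -
  show c: "closedin (top_of_set characters) (ccomp \<phi>)"
    by (rule closed_subset[OF _ closed_ccomp]) (auto simp: ccomp_def)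
  have "closed (\<Union> (ccomp ` (F - {\<phi>})))"
    by (rule closed_UN) (use rep_set_D(1) closed_ccomp in auto)
  then have "closed (characters - ccomp \<phi>)"
    by (simp add: ccomp_complement[OF assms])
  then have "closedin (top_of_set characters) (characters - ccomp \<phi>)"
    by (rule closed_subset[rotated]) blast
  then show "openin (top_of_set characters) (ccomp \<phi>)"
    unfolding openin_closedin_eq using closedin_subset[OF c] by simp
qed

end

lemma continuous_on_indicator_clopen:
  assumes "closedin (top_of_set X) C" "openin (top_of_set X) C"
  shows "continuous_on X (indicator C :: _ \<Rightarrow> real)"
proof -
  have "C \<subseteq> X" using assms(1) closedin_subset by fastforce
  then have X: "X = C \<union> (X - C)" by blast
  have "closedin (top_of_set X) (X - C)" using assms(2) by (simp add: openin_closedin_eq)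
  moreover have "continuous_on C (indicator C :: _ \<Rightarrow> real)"
    by (rule continuous_on_eq[OF continuous_on_const[of _ 1]]) simp
  moreover have "continuous_on (X - C) (indicator C :: _ \<Rightarrow> real)"
    by (rule continuous_on_eq[OF continuous_on_const[of _ 0]]) simp
  ultimately have "continuous_on (C \<union> (X - C)) (indicator C :: _ \<Rightarrow> real)"
    using assms(1) X by (intro continuous_on_Un_local) auto
  then show ?thesis using X by simp
qed

lemma clopen_indicator_integral:
  assumes "closedin (top_of_set characters) C" "openin (top_of_set characters) C"
  shows "gel (indicator C) \<in> integral_elements"
    and "\<phi> \<in> characters \<Longrightarrow> \<phi> (gel (indicator C)) = indicator C \<phi>"
proof -
  note c = continuous_on_indicator_clopen[OF assms]
  show "gel (indicator C) \<in> integral_elements"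
    unfolding integral_elements_def
  proof (intro CollectI conjI ballI)
    fix \<psi> :: "'a \<Rightarrow> real" assume "\<psi> \<in> characters"
    then show "\<psi> (gel (indicator C)) \<in> \<int>"
      by (cases "\<psi> \<in> C") (simp_all add: gel_eval[OF c])
  qed (rule gel_in_sa[OF c])
  show "\<phi> \<in> characters \<Longrightarrow> \<phi> (gel (indicator C)) = indicator C \<phi>"
    by (rule gel_eval[OF c])
qed

context
  fixes F :: "('a::abelian_unital_cstar_algebra \<Rightarrow> real) set"
  assumes F: "rep_set F"
begin

lemma proj_integral: "\<phi> \<in> F \<Longrightarrow> proj \<phi> \<in> integral_elements"
  unfolding proj_def by (intro clopen_indicator_integral(1) ccomp_clopen[OF F])

lemma proj_eval: "\<phi> \<in> F \<Longrightarrow> \<psi> \<in> characters \<Longrightarrow> \<psi> (proj \<phi>) = indicator (ccomp \<phi>) \<psi>"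
  unfolding proj_def by (intro clopen_indicator_integral(2) ccomp_clopen[OF F])

lemma proj_eval_rep: "\<phi> \<in> F \<Longrightarrow> \<psi> \<in> F \<Longrightarrow> \<psi> (proj \<phi>) = (if \<psi> = \<phi> then 1 else 0)"
  using proj_eval[of \<phi> \<psi>] rep_set_D(2)[OF F, of \<psi>] rep_set_D(5)[OF F, of \<psi>] rep_set_D(4)[OF F, of \<psi> \<phi> \<psi>]
  by (auto simp: indicator_def)

lemma proj_sa: "\<phi> \<in> F \<Longrightarrow> proj \<phi> \<in> sa"
  using proj_integral integral_sa by blast

lemma integral_sum:
  assumes l: "l \<in> integral_elements"
  shows "l = (\<Sum>\<phi>\<in>F. \<phi> l *\<^sub>R proj \<phi>)"
proof (rule sa_eqI)
  show "l \<in> sa" by (rule integral_sa[OF l])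
  show "(\<Sum>\<phi>\<in>F. \<phi> l *\<^sub>R proj \<phi>) \<in> sa" by (intro sa_sum sa_scaleR proj_sa)
  fix \<psi> :: "'a \<Rightarrow> real" assume p: "\<psi> \<in> characters"
  obtain \<phi>0 where r: "\<phi>0 \<in> F" "\<psi> \<in> ccomp \<phi>0" using rep_set_D(3)[OF F p] by blast
  have "\<psi> (\<Sum>\<phi>\<in>F. \<phi> l *\<^sub>R proj \<phi>) = (\<Sum>\<phi>\<in>F. \<phi> l * indicator (ccomp \<phi>) \<psi>)"
    using p by (simp add: character_sum characterD(2) proj_eval)
  also have "\<dots> = (\<Sum>\<phi>\<in>F. if \<phi> = \<phi>0 then \<phi>0 l else 0)"
    by (intro sum.cong refl) (use r rep_set_D(4)[OF F] in \<open>auto simp: indicator_def\<close>)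
  also have "\<dots> = \<phi>0 l" using r rep_set_D(1)[OF F] by simp
  also have "\<dots> = \<psi> l" using r(2) l by (simp add: ccomp_def)
  finally show "\<psi> l = \<psi> (\<Sum>\<phi>\<in>F. \<phi> l *\<^sub>R proj \<phi>)" ..
qed

text \<open>An integral element is constant on each class, with its value at the base point as
  coefficient. Together with \<open>proj_eval_rep\<close> this makes the lattice free on the
  projections.\<close>

lemma integral_iff:
  "l \<in> integral_elements \<longleftrightarrow> (\<exists>n::_ \<Rightarrow> int. l = (\<Sum>\<phi>\<in>F. of_int (n \<phi>) *\<^sub>R proj \<phi>))"
proof
  assume l: "l \<in> integral_elements"
  have "\<phi> l = of_int \<lfloor>\<phi> l\<rfloor>" if "\<phi> \<in> F" for \<phi>
    using l rep_set_D(2)[OF F that] by (auto simp: integral_elements_def elim: Ints_cases)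
  then have "l = (\<Sum>\<phi>\<in>F. of_int \<lfloor>\<phi> l\<rfloor> *\<^sub>R proj \<phi>)"
    using integral_sum[OF l] by (metis (mono_tags, lifting) sum.cong)
  then show "\<exists>n::_ \<Rightarrow> int. l = (\<Sum>\<phi>\<in>F. of_int (n \<phi>) *\<^sub>R proj \<phi>)"
    by (rule exI[of _ "\<lambda>\<phi>. \<lfloor>\<phi> l\<rfloor>"])
next
  assume "\<exists>n::_ \<Rightarrow> int. l = (\<Sum>\<phi>\<in>F. of_int (n \<phi>) *\<^sub>R proj \<phi>)"
  then obtain n :: "_ \<Rightarrow> int" where n: "l = (\<Sum>\<phi>\<in>F. of_int (n \<phi>) *\<^sub>R proj \<phi>)" ..
  have "l \<in> sa" unfolding n by (intro sa_sum sa_scaleR proj_sa)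
  moreover have "\<psi> l \<in> \<int>" if p: "\<psi> \<in> characters" for \<psi>
    unfolding n character_sum[OF p] characterD(2)[OF p]
    using p by (intro Ints_sum) (auto simp: proj_eval indicator_def)
  ultimately show "l \<in> integral_elements" by (simp add: integral_elements_def)
qed

text \<open>A clopen subset has an integral indicator, and all characters of the class take the same
  value on it; so the subset is all or nothing.\<close>

lemma ccomp_connected:
  assumes r: "\<phi> \<in> F"
  shows "connected (ccomp \<phi>)"
proof -
  have "C = {} \<or> C = ccomp \<phi>" if C: "openin (top_of_set (ccomp \<phi>)) C" "closedin (top_of_set (ccomp \<phi>)) C" for C
  proof -
    have o: "openin (top_of_set characters) C" "closedin (top_of_set characters) C"
      using C ccomp_clopen[OF F r] openin_trans closedin_trans by blast+
    note i = clopen_indicator_integral[OF o(2,1)]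
    have sub: "C \<subseteq> ccomp \<phi>" using openin_imp_subset[OF C(1)] .
    have "indicator C \<psi> = (indicator C \<phi> :: real)" if "\<psi> \<in> ccomp \<phi>" for \<psi>
    proof -
      have "\<psi> (gel (indicator C)) = \<phi> (gel (indicator C))" using that i(1) by (simp add: ccomp_def)
      then show ?thesis using that r rep_set_D(2)[OF F] by (simp add: i(2) ccomp_def)
    qed
    then have "\<psi> \<in> C \<longleftrightarrow> \<phi> \<in> C" if "\<psi> \<in> ccomp \<phi>" for \<psi> using that by (force simp: indicator_def split: if_splits)
    then show ?thesis using sub by blast
  qed
  then show ?thesis unfolding connected_clopen by blast
qed

end

text \<open>Ranks are compared modulo 2. The sums of basis elements over subsets of \<open>F\<close>
  are pairwise incongruent modulo twice the lattice, and after applying \<open>h\<close> the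
  congruence class can be read off from the parities at the points of \<open>G\<close>. So there are
  at least as many subsets of \<open>G\<close> as of \<open>F\<close>.\<close>

lemma card_rep_set_le:
  assumes F: "rep_set (F :: ('a::abelian_unital_cstar_algebra \<Rightarrow> real) set)"
    and G: "rep_set (G :: ('b::abelian_unital_cstar_algebra \<Rightarrow> real) set)"
    and h: "h \<in> iso (integral_group :: 'a monoid) (integral_group :: 'b monoid)"
  shows "card F \<le> card G"
proof -
  have hom: "\<And>x y. x \<in> integral_elements \<Longrightarrow> y \<in> integral_elements \<Longrightarrow> h (x + y) = h x + h y"
    and inj: "inj_on h integral_elements" and surj: "h ` integral_elements = integral_elements"
    using h by (auto simp: iso_def hom_def bij_betw_def)
  define e where "e D = (\<Sum>\<phi>\<in>D. proj \<phi>)" for D :: "('a \<Rightarrow> real) set"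
  have e: "e D \<in> integral_elements" if "D \<subseteq> F" for D
    unfolding integral_iff[OF F]
  proof (intro exI)
    show "e D = (\<Sum>\<phi>\<in>F. of_int (if \<phi> \<in> D then 1 else 0) *\<^sub>R proj \<phi>)"
      using that rep_set_D(1)[OF F]
      by (simp add: e_def if_distrib[of "\<lambda>x. of_int x *\<^sub>R _"] sum.If_cases Int_absorb1 cong: if_cong)
  qed
  have ev: "\<psi> (e D) = (if \<psi> \<in> D then 1 else 0)" if "D \<subseteq> F" "\<psi> \<in> F" for D \<psi>
  proof -
    have "\<psi> (e D) = (\<Sum>\<phi>\<in>D. \<psi> (proj \<phi>))"
      unfolding e_def by (rule character_sum[OF rep_set_D(2)[OF F that(2)]])
    also have "\<dots> = (\<Sum>\<phi>\<in>D. if \<psi> = \<phi> then 1 else 0)"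
      by (intro sum.cong refl proj_eval_rep[OF F]) (use that in auto)
    also have "\<dots> = (if \<psi> \<in> D then 1 else 0)"
      using finite_subset[OF that(1) rep_set_D(1)[OF F]] by simp
    finally show ?thesis .
  qed
  define P where "P D = {\<psi>\<in>G. odd \<lfloor>\<psi> (h (e D))\<rfloor>}" for D
  have hL: "h l \<in> integral_elements" if "l \<in> integral_elements" for l using surj that by blast
  have "inj_on P (Pow F)"
  proof (rule inj_onI)
    fix D E assume D: "D \<in> Pow F" and E: "E \<in> Pow F" and eq: "P D = P E"
    define d where "d = h (e D) - h (e E)"
    have dL: "d \<in> integral_elements" unfolding d_def using D E by (intro integral_diff hL e) auto
    have int: "\<exists>k::int. \<psi> (h (e D)) = of_int k" "\<exists>k::int. \<psi> (h (e E)) = of_int k" if "\<psi> \<in> G" for \<psi>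
    proof -
      have "\<psi> (h (e D)) \<in> \<int>" "\<psi> (h (e E)) \<in> \<int>"
        using hL[OF e[of D]] hL[OF e[of E]] D E rep_set_D(2)[OF G that] by (auto simp: integral_elements_def)
      then show "\<exists>k::int. \<psi> (h (e D)) = of_int k" "\<exists>k::int. \<psi> (h (e E)) = of_int k"
        by (auto simp: Ints_def)
    qed
    have "\<exists>k::int. \<psi> d = of_int (2 * k)" if p: "\<psi> \<in> G" for \<psi>
    proof -
      obtain k m :: int where km: "\<psi> (h (e D)) = of_int k" "\<psi> (h (e E)) = of_int m" using int[OF p] by blast
      have "\<psi> \<in> P D \<longleftrightarrow> \<psi> \<in> P E" using eq by simp
      then have "odd k \<longleftrightarrow> odd m" using p km by (simp add: P_def)
      then have "even (k - m)" by simp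
      then obtain j where "k - m = 2 * j" by (rule evenE)
      then have "\<psi> d = of_int (2 * j)"
        using km characterD(8)[OF rep_set_D(2)[OF G p]] by (metis d_def of_int_diff)
      then show ?thesis by blast
    qed
    then obtain k :: "_ \<Rightarrow> int" where k: "\<And>\<psi>. \<psi> \<in> G \<Longrightarrow> \<psi> d = of_int (2 * k \<psi>)" by metis
    define m where "m = (\<Sum>\<psi>\<in>G. of_int (k \<psi>) *\<^sub>R proj \<psi>)"
    have m: "m \<in> integral_elements" unfolding integral_iff[OF G] m_def by (rule exI[of _ k]) simp
    have "d = (\<Sum>\<psi>\<in>G. of_int (2 * k \<psi>) *\<^sub>R proj \<psi>)"
      using integral_sum[OF G dL] k by (metis (mono_tags, lifting) sum.cong)
    also have "\<dots> = m + m" unfolding m_def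
      by (simp add: scaleR_2[symmetric] scaleR_sum_right)
    finally have d: "d = m + m" .
    obtain n where n: "n \<in> integral_elements" "m = h n" using m surj by blast
    have "h (e D) = d + h (e E)" by (simp add: d_def)
    also have "\<dots> = h ((n + n) + e E)"
      unfolding d n(2) using n(1) E by (simp only: hom e integral_add PowD)
    finally have "h (e D) = h ((n + n) + e E)" .
    then have "e D = (n + n) + e E"
      by (rule inj_onD[OF inj]) (use D E n(1) in \<open>simp_all only: e integral_add PowD\<close>)
    then have nn: "\<psi> (e D) = 2 * \<psi> n + \<psi> (e E)" if "\<psi> \<in> F" for \<psi>
      unfolding \<open>e D = (n + n) + e E\<close> characterD(1)[OF rep_set_D(2)[OF F that]] by simp
    show "D = E"
    proof (rule ccontr)
      assume "D \<noteq> E"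
      then obtain \<psi> where p: "\<psi> \<in> F" "\<psi> \<in> D \<longleftrightarrow> \<psi> \<notin> E" using D E by blast
      have "\<psi> n \<in> \<int>" using n p rep_set_D(2)[OF F] by (auto simp: integral_elements_def)
      then obtain j :: int where j: "\<psi> n = of_int j" by (auto elim: Ints_cases)
      \<comment> \<open>At \<psi> exactly one of \<open>e D\<close> and \<open>e E\<close> has value
        1 and the other has value 0, so the even number 2 j would have to be 1 or -1.\<close>
      have "2 * (of_int j :: real) = 1 \<or> 2 * (of_int j :: real) = - 1"
        using nn[OF p(1)] ev[of D \<psi>] ev[of E \<psi>] p D E j by (auto split: if_splits)
      then have "2 * j = 1 \<or> 2 * j = - 1" by linarith
      then show False by presburger
    qed
  qed
  then have "card (Pow F) \<le> card (Pow G)"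
    by (rule card_inj_on_le) (auto simp: P_def rep_set_D(1)[OF G])
  then show ?thesis
    using rep_set_D(1)[OF F] rep_set_D(1)[OF G] by (simp add: card_Pow)
qed

section \<open>Continuous functions on the Cantor space\<close>

type_synonym cantor = "nat \<Rightarrow> bool"

text \<open>Continuity on the Cantor space, made uniform by compactness and phrased by prefixes,
  which suits both gluing and averages over finitely many coordinates.\<close>

definition ucyl :: "(cantor \<Rightarrow> real) \<Rightarrow> bool" where
  "ucyl g \<longleftrightarrow> (\<forall>e>0. \<exists>n. \<forall>\<omega> \<omega>'. (\<forall>i<n. \<omega> i = \<omega>' i) \<longrightarrow> \<bar>g \<omega> - g \<omega>'\<bar> < e)"

lemma ucylD:
  assumes "ucyl g" "e > 0"
  obtains n where "\<And>\<omega> \<omega>'. \<forall>i<n. \<omega> i = \<omega>' i \<Longrightarrow> \<bar>g \<omega> - g \<omega>'\<bar> < e"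
proof -
  from assms obtain n where "\<forall>\<omega> \<omega>'. (\<forall>i<n. \<omega> i = \<omega>' i) \<longrightarrow> \<bar>g \<omega> - g \<omega>'\<bar> < e"
    unfolding ucyl_def by blast
  then show ?thesis by (intro that[of n]) blast
qed

definition cylinder :: "nat \<Rightarrow> cantor \<Rightarrow> cantor set" where
  "cylinder n \<omega> = {\<omega>'. \<forall>i<n. \<omega>' i = \<omega> i}"

lemma open_cylinder: "open (cylinder n \<omega>)"
proof -
  have "cylinder n \<omega> = (\<Inter>i<n. (\<lambda>h. h i) -` {\<omega> i})" by (auto simp: cylinder_def)
  also have "open \<dots>" by (intro open_INT ballI open_coordinate_vimage) (auto simp: open_discrete)
  finally show ?thesis .
qed

lemma open_contains_cylinder:
  assumes "open U" "\<omega> \<in> U"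
  shows "\<exists>n. cylinder n \<omega> \<subseteq> U"
proof -
  have "openin (product_topology (\<lambda>_. euclidean) UNIV) U"
    using assms(1) by (simp add: euclidean_product_topology)
  from product_topology_open_contains_basis[OF this assms(2)]
  obtain X where X: "\<omega> \<in> PiE UNIV X" "finite {i. X i \<noteq> UNIV}" "PiE UNIV X \<subseteq> U" by auto
  obtain n where n: "\<forall>i\<in>{i. X i \<noteq> UNIV}. i < n" using X(2) finite_nat_set_iff_bounded by blast
  have "cylinder n \<omega> \<subseteq> PiE UNIV X"
  proof
    fix \<omega>' assume w: "\<omega>' \<in> cylinder n \<omega>"
    have "\<omega>' i \<in> X i" for i
    proof (cases "i < n")
      case True
      then have "\<omega>' i = \<omega> i" using w by (simp add: cylinder_def)
      then show ?thesis using PiE_mem[OF X(1), of i] by simp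
    next
      case False
      then have "X i = UNIV" using n by blast
      then show ?thesis by simp
    qed
    then show "\<omega>' \<in> PiE UNIV X" by (simp add: PiE_UNIV_domain)
  qed
  then show ?thesis using X(3) by blast
qed

lemma compact_cantor: "compact (UNIV :: cantor set)"
proof -
  have "compactin (product_topology (\<lambda>_. euclidean) UNIV) (PiE UNIV (\<lambda>_. UNIV) :: cantor set)"
    by (subst compactin_PiE) (simp add: finite_imp_compact)
  then show ?thesis by (simp add: euclidean_product_topology PiE_UNIV_domain)
qed

lemma ucyl_continuous:
  assumes c: "continuous_on UNIV (g :: cantor \<Rightarrow> real)"
  shows "ucyl g"
  unfolding ucyl_def
proof (intro allI impI)
  fix e :: real assume e: "e > 0"
  have "\<exists>n. cylinder n \<omega> \<subseteq> g -` ball (g \<omega>) (e/2)" for \<omega>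
    using e by (intro open_contains_cylinder open_vimage c) auto
  then obtain n where n: "\<And>\<omega>. cylinder (n \<omega>) \<omega> \<subseteq> g -` ball (g \<omega>) (e/2)" by metis
  have "UNIV \<subseteq> (\<Union>\<omega>\<in>UNIV. cylinder (n \<omega>) \<omega>)" by (auto simp: cylinder_def)
  then obtain W where W: "finite W" "UNIV \<subseteq> (\<Union>\<omega>\<in>W. cylinder (n \<omega>) \<omega>)"
    using compactE_image[OF compact_cantor, of UNIV "\<lambda>\<omega>. cylinder (n \<omega>) \<omega>"] open_cylinder by metis
  obtain N where N: "\<And>\<omega>. \<omega> \<in> W \<Longrightarrow> n \<omega> \<le> N"
    using finite_nat_set_iff_bounded_le[of "n ` W"] W(1) by auto
  have "\<bar>g \<omega> - g \<omega>'\<bar> < e" if eq: "\<forall>i<N. \<omega> i = \<omega>' i" for \<omega> \<omega>'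
  proof -
    obtain v where v: "v \<in> W" "\<omega> \<in> cylinder (n v) v" using W(2) by blast
    then have "\<omega>' \<in> cylinder (n v) v" using eq N[OF v(1)] by (auto simp: cylinder_def)
    then have "dist (g v) (g \<omega>) < e/2" "dist (g v) (g \<omega>') < e/2" using n[of v] v(2) by auto
    then show ?thesis unfolding dist_real_def by linarith
  qed
  then show "\<exists>n. \<forall>\<omega> \<omega>'. (\<forall>i<n. \<omega> i = \<omega>' i) \<longrightarrow> \<bar>g \<omega> - g \<omega>'\<bar> < e"
    by (intro exI[of _ N] allI impI)
qed

lemma ucyl_bcontfun:
  assumes "ucyl g" shows "g \<in> bcontfun"
  unfolding bcontfun_def
proof (intro CollectI conjI)
  show "continuous_on UNIV g"
    unfolding continuous_on_def
  proof (intro ballI tendstoI)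
    fix \<omega> and e :: real assume e: "e > 0"
    obtain n where n: "\<And>\<omega> \<omega>'. \<forall>i<n. \<omega> i = \<omega>' i \<Longrightarrow> \<bar>g \<omega> - g \<omega>'\<bar> < e"
      using ucylD[OF assms e] by blast
    show "\<forall>\<^sub>F x in at \<omega> within UNIV. dist (g x) (g \<omega>) < e"
      unfolding eventually_at_topological
      by (intro exI[of _ "cylinder n \<omega>"] conjI open_cylinder)
        (auto simp: cylinder_def dist_real_def intro!: n)
  qed
  obtain n where n: "\<And>\<omega> \<omega>'. \<forall>i<n. \<omega> i = \<omega>' i \<Longrightarrow> \<bar>g \<omega> - g \<omega>'\<bar> < 1"
    using ucylD[OF assms zero_less_one] by blast
  \<comment> \<open>The sequences that are False from n on represent all prefixes of length
    n.\<close>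
  define B where "B = Max ((\<lambda>S. \<bar>g (\<lambda>i. i \<in> S)\<bar>) ` Pow {..<n})"
  show "bounded (range g)"
    unfolding bounded_iff
  proof (intro exI[of _ "B + 1"] ballI, clarsimp)
    fix \<omega>
    have "\<bar>g (\<lambda>i. i \<in> {i. i < n \<and> \<omega> i})\<bar> \<le> B" unfolding B_def
      by (intro Max_ge finite_imageI image_eqI[of _ _ "{i. i < n \<and> \<omega> i}"]) auto
    moreover have "\<bar>g \<omega> - g (\<lambda>i. i \<in> {i. i < n \<and> \<omega> i})\<bar> < 1" by (rule n) simp
    ultimately show "\<bar>g \<omega>\<bar> \<le> B + 1" by linarith
  qed
qed

type_synonym cfun = "cantor \<Rightarrow>\<^sub>C real"

lemma abs_apply_le: "\<bar>apply_bcontfun (f :: cfun) \<omega>\<bar> \<le> norm f"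
  using norm_bounded[of f \<omega>] by simp

lemma ucyl_apply: "ucyl (apply_bcontfun (f :: cfun))"
  by (rule ucyl_continuous) simp

lemma apply_Bcontfun: "ucyl g \<Longrightarrow> apply_bcontfun (Bcontfun g) = g"
  by (rule Bcontfun_inverse[OF ucyl_bcontfun])

lemma bounded_linear_Bcontfun:
  fixes M :: "'w::real_normed_vector \<Rightarrow> cantor \<Rightarrow> real"
  assumes M: "\<And>x. ucyl (M x)" and add: "\<And>x y \<omega>. M (x + y) \<omega> = M x \<omega> + M y \<omega>"
    and scale: "\<And>r x \<omega>. M (r *\<^sub>R x) \<omega> = r * M x \<omega>" and bd: "\<And>x \<omega>. \<bar>M x \<omega>\<bar> \<le> K * norm x"
  shows "bounded_linear (\<lambda>x. Bcontfun (M x))"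
proof (rule bounded_linear_intro[where K=K])
  show "Bcontfun (M (x + y)) = Bcontfun (M x) + Bcontfun (M y)" for x y
    by (rule bcontfun_eqI) (simp add: apply_Bcontfun M add)
  show "Bcontfun (M (r *\<^sub>R x)) = r *\<^sub>R Bcontfun (M x)" for r x
    by (rule bcontfun_eqI) (simp add: apply_Bcontfun M scale)
  show "norm (Bcontfun (M x)) \<le> norm x * K" for x
    by (rule norm_bound) (use bd[of x] in \<open>simp add: apply_Bcontfun M mult.commute\<close>)
qed

lemma ucyl_compose:
  fixes p :: "cantor \<Rightarrow> cantor"
  assumes g: "ucyl g" and p: "\<And>n. \<exists>m. \<forall>\<omega> \<omega>'. (\<forall>i<m. \<omega> i = \<omega>' i) \<longrightarrow> (\<forall>i<n. p \<omega> i = p \<omega>' i)"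
  shows "ucyl (\<lambda>\<omega>. g (p \<omega>))"
  unfolding ucyl_def
proof (intro allI impI)
  fix e :: real assume "e > 0"
  then obtain n where n: "\<And>\<omega> \<omega>'. \<forall>i<n. \<omega> i = \<omega>' i \<Longrightarrow> \<bar>g \<omega> - g \<omega>'\<bar> < e"
    using ucylD[OF g] by blast
  obtain m where m: "\<forall>\<omega> \<omega>'. (\<forall>i<m. \<omega> i = \<omega>' i) \<longrightarrow> (\<forall>i<n. p \<omega> i = p \<omega>' i)"
    using p[of n] ..
  show "\<exists>n. \<forall>\<omega> \<omega>'. (\<forall>i<n. \<omega> i = \<omega>' i) \<longrightarrow> \<bar>g (p \<omega>) - g (p \<omega>')\<bar> < e"
  proof (intro exI[of _ m] allI impI)
    fix \<omega> \<omega>' :: cantor assume "\<forall>i<m. \<omega> i = \<omega>' i"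
    then show "\<bar>g (p \<omega>) - g (p \<omega>')\<bar> < e" using m by (intro n) simp
  qed
qed

lemma bounded_linear_compose_cantor:
  fixes p :: "cantor \<Rightarrow> cantor"
  assumes p: "\<And>n. \<exists>m. \<forall>\<omega> \<omega>'. (\<forall>i<m. \<omega> i = \<omega>' i) \<longrightarrow> (\<forall>i<n. p \<omega> i = p \<omega>' i)"
  shows "bounded_linear (\<lambda>f::cfun. Bcontfun (\<lambda>\<omega>. f (p \<omega>)))"
  by (rule bounded_linear_Bcontfun[where K=1])
    (simp_all add: ucyl_compose[OF ucyl_apply, OF p] abs_apply_le)

section \<open>Self-similarity of the Cantor space\<close>

definition cons :: "bool \<Rightarrow> cantor \<Rightarrow> cantor" where
  "cons b \<omega> = (\<lambda>i. case i of 0 \<Rightarrow> b | Suc j \<Rightarrow> \<omega> j)"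

text \<open>Together with \<open>unhalf\<close> these restrictions identify \<open>cfun\<close> with
  its square, since the first coordinate splits the Cantor space into two copies of itself.\<close>

definition half :: "bool \<Rightarrow> cfun \<Rightarrow> cfun" where
  "half b f = Bcontfun (\<lambda>\<omega>. f (cons b \<omega>))"

definition unhalf :: "bool \<Rightarrow> cfun \<Rightarrow> cfun" where
  "unhalf b f = Bcontfun (\<lambda>\<omega>. if \<omega> 0 = b then f (\<lambda>i. \<omega> (Suc i)) else 0)"

lemma cons_local: "\<exists>m. \<forall>\<omega> \<omega>'. (\<forall>i<m. \<omega> i = \<omega>' i) \<longrightarrow> (\<forall>i<n. cons b \<omega> i = cons b \<omega>' i)"
  by (rule exI[of _ n]) (auto simp: cons_def split: nat.split)

lemma apply_half: "apply_bcontfun (half b f) \<omega> = f (cons b \<omega>)"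
  unfolding half_def by (simp add: apply_Bcontfun ucyl_compose[OF ucyl_apply, OF cons_local])

lemma ucyl_unhalf: "ucyl (\<lambda>\<omega>. if \<omega> 0 = b then (f::cfun) (\<lambda>i. \<omega> (Suc i)) else 0)"
  unfolding ucyl_def
proof (intro allI impI)
  fix e :: real assume e: "e > 0"
  obtain n where n: "\<And>\<omega> \<omega>'. \<forall>i<n. \<omega> i = \<omega>' i \<Longrightarrow> \<bar>f \<omega> - f \<omega>'\<bar> < e"
    using ucylD[OF ucyl_apply[of f] e] by blast
  show "\<exists>n. \<forall>\<omega> \<omega>'. (\<forall>i<n. \<omega> i = \<omega>' i) \<longrightarrow> \<bar>(if \<omega> 0 = b then f (\<lambda>i. \<omega> (Suc i)) else 0) -
      (if \<omega>' 0 = b then f (\<lambda>i. \<omega>' (Suc i)) else 0)\<bar> < e"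
    by (rule exI[of _ "Suc n"]) (use e n in \<open>auto intro!: n\<close>)
qed

lemma apply_unhalf:
  "apply_bcontfun (unhalf b f) \<omega> = (if \<omega> 0 = b then f (\<lambda>i. \<omega> (Suc i)) else 0)"
  unfolding unhalf_def by (subst apply_Bcontfun[OF ucyl_unhalf]) simp

lemma bounded_linear_half: "bounded_linear (half b)"
  unfolding half_def by (rule bounded_linear_compose_cantor[OF cons_local])

lemma bounded_linear_unhalf: "bounded_linear (unhalf b)"
  unfolding unhalf_def
  by (rule bounded_linear_Bcontfun[where K=1]) (simp_all add: ucyl_unhalf abs_apply_le)

lemma half_unhalf: "half b (unhalf c f) = (if b = c then f else 0)"
  by (rule bcontfun_eqI) (auto simp: apply_half apply_unhalf cons_def)

lemma unhalf_half: "unhalf False (half False f) + unhalf True (half True f) = f"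
proof (rule bcontfun_eqI)
  fix \<omega>
  have "cons (\<omega> 0) (\<lambda>i. \<omega> (Suc i)) = \<omega>" by (auto simp: cons_def fun_eq_iff split: nat.split)
  then show "apply_bcontfun (unhalf False (half False f) + unhalf True (half True f)) \<omega> = f \<omega>"
    by (cases "\<omega> 0") (auto simp: apply_half apply_unhalf)
qed

text \<open>
  The clopen sets \<open>range (spot n)\<close> partition the Cantor space minus the zero sequence into copies of
  itself.
\<close>

definition spot :: "nat \<Rightarrow> cantor \<Rightarrow> cantor" where
  "spot n \<omega> = (\<lambda>i. if i < n then False else if i = n then True else \<omega> (i - Suc n))"

definition zseq :: cantor where "zseq = (\<lambda>_. False)"

definition sec :: "nat \<Rightarrow> cfun \<Rightarrow> cfun" where
  "sec n f = Bcontfun (\<lambda>\<omega>. f (spot n \<omega>))"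

lemma spot_local: "\<exists>m. \<forall>\<omega> \<omega>'. (\<forall>i<m. \<omega> i = \<omega>' i) \<longrightarrow> (\<forall>i<n. spot k \<omega> i = spot k \<omega>' i)"
  by (rule exI[of _ n]) (auto simp: spot_def)

lemma apply_sec: "apply_bcontfun (sec n f) \<omega> = f (spot n \<omega>)"
  unfolding sec_def by (simp add: apply_Bcontfun ucyl_compose[OF ucyl_apply, OF spot_local])

lemma bounded_linear_sec: "bounded_linear (sec n)"
  unfolding sec_def by (rule bounded_linear_compose_cantor[OF spot_local])

lemma norm_sec_le: "norm (sec n f) \<le> norm f"
  by (rule norm_bound) (use norm_bounded[of f] in \<open>simp add: apply_sec\<close>)

text \<open>The copies shrink to the zero sequence: the n-th one contains only sequences beginning
  with n values False.\<close>

lemma sec_tendsto: "(\<lambda>n. sec n f) \<longlonglongrightarrow> const_bcontfun (f zseq)"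
proof (rule LIMSEQ_I)
  fix e :: real assume e: "e > 0"
  then have "e/2 > 0" by simp
  then obtain N where N: "\<And>\<omega> \<omega>'. \<forall>i<N. \<omega> i = \<omega>' i \<Longrightarrow> \<bar>f \<omega> - f \<omega>'\<bar> < e/2"
    using ucylD[OF ucyl_apply[of f]] by blast
  have "norm (sec n f - const_bcontfun (f zseq)) < e" if n: "n \<ge> N" for n
  proof -
    have "norm (sec n f - const_bcontfun (f zseq)) \<le> e/2"
    proof (rule norm_bound)
      fix \<omega>
      have "\<bar>f (spot n \<omega>) - f zseq\<bar> < e/2" by (rule N) (use n in \<open>simp add: spot_def zseq_def\<close>)
      then show "norm (apply_bcontfun (sec n f - const_bcontfun (f zseq)) \<omega>) \<le> e/2"
        by (simp add: apply_sec)
    qed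
    then show ?thesis using e by simp
  qed
  then show "\<exists>no. \<forall>n\<ge>no. norm (sec n f - const_bcontfun (f zseq)) < e" by blast
qed

text \<open>The function with section \<open>G n\<close> on the n-th copy and value \<open>c\<close>
  at the zero sequence. It is continuous when \<open>G n\<close> tends uniformly to
  \<open>c\<close>; so \<open>cfun\<close> is described by sequences in \<open>cfun\<close> that
  converge to a constant function.\<close>

definition glue :: "(nat \<Rightarrow> cfun) \<Rightarrow> real \<Rightarrow> cantor \<Rightarrow> real" where
  "glue G c \<omega> = (if \<exists>n. \<omega> n then G (LEAST n. \<omega> n) (\<lambda>i. \<omega> (Suc ((LEAST n. \<omega> n) + i))) else c)"

lemma Least_spot: "(LEAST k. spot n \<omega> k) = n"
  by (rule Least_equality) (auto simp: spot_def split: if_splits intro: leI)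

lemma glue_spot: "glue G c (spot n \<omega>) = G n \<omega>"
proof -
  have "\<exists>k. spot n \<omega> k" by (rule exI[of _ n]) (simp add: spot_def)
  moreover have "(\<lambda>i. spot n \<omega> (Suc (n + i))) = \<omega>" by (auto simp: spot_def)
  ultimately show ?thesis by (simp add: glue_def Least_spot)
qed

lemma glue_zseq: "glue G c zseq = c"
  by (simp add: glue_def zseq_def)

lemma cantor_cases:
  obtains "\<omega> = zseq" | n \<tau> where "\<omega> = spot n \<tau>"
proof (cases "\<exists>n. \<omega> n")
  case True
  define n where "n = (LEAST n. \<omega> n)"
  have "\<omega> n" "\<And>i. i < n \<Longrightarrow> \<not> \<omega> i"
    unfolding n_def using True by (auto intro: LeastI_ex dest: not_less_Least)
  then have "\<omega> = spot n (\<lambda>i. \<omega> (Suc n + i))" by (auto simp: spot_def fun_eq_iff)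
  then show ?thesis using that by blast
next
  case False
  then have "\<omega> = zseq" by (auto simp: zseq_def)
  then show ?thesis using that by blast
qed

lemma ucyl_glue:
  assumes G: "G \<longlonglongrightarrow> const_bcontfun c"
  shows "ucyl (glue G c)"
  unfolding ucyl_def
proof (intro allI impI)
  fix e :: real assume e: "e > 0"
  then have "e/2 > 0" by simp
  then obtain N where N: "\<And>n. n \<ge> N \<Longrightarrow> norm (G n - const_bcontfun c) < e/2"
    using LIMSEQ_D[OF G] by blast
  have near: "\<bar>G n \<tau> - c\<bar> < e/2" if "n \<ge> N" for n \<tau>
    using norm_bounded[of "G n - const_bcontfun c" \<tau>] N[OF that] by simp
  have "\<exists>m. \<forall>\<omega> \<omega>'. (\<forall>i<m. \<omega> i = \<omega>' i) \<longrightarrow> \<bar>G n \<omega> - G n \<omega>'\<bar> < e" for n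
    using ucyl_apply[of "G n"] e by (simp add: ucyl_def)
  then obtain m where m: "\<And>n \<omega> \<omega>'. (\<forall>i<m n. \<omega> i = \<omega>' i) \<Longrightarrow> \<bar>G n \<omega> - G n \<omega>'\<bar> < e" by metis
  \<comment> \<open>If the first True is at n < N, the tail starts at n + 1, so agreement below
    \<open>m n + n + 1\<close> is needed; otherwise agreement below N places both values near
    \<open>c\<close>.\<close>
  define M where "M = N + 1 + (\<Sum>n<N. m n)"
  have mM: "m n + n < M" if "n < N" for n
    using that member_le_sum[of n "{..<N}" m] by (simp add: M_def)
  have "\<bar>glue G c \<omega> - glue G c \<omega>'\<bar> < e" if eq: "\<forall>i<M. \<omega> i = \<omega>' i" for \<omega> \<omega>'
  proof (cases "\<exists>n<N. \<omega> n")
    case True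
    define n where "n = (LEAST n. \<omega> n)"
    have n: "\<omega> n" "n < N" "\<And>i. i < n \<Longrightarrow> \<not> \<omega> i"
      unfolding n_def using True by (auto intro: LeastI_ex dest: not_less_Least le_less_trans[OF Least_le])
    then have n': "\<omega>' n" "\<And>i. i < n \<Longrightarrow> \<not> \<omega>' i" using eq by (auto simp: M_def)
    then have "(LEAST n. \<omega>' n) = n" by (intro Least_equality) (auto intro: leI)
    then have "glue G c \<omega> = G n (\<lambda>i. \<omega> (Suc (n + i)))" "glue G c \<omega>' = G n (\<lambda>i. \<omega>' (Suc (n + i)))"
      using n(1) n'(1) by (auto simp: glue_def n_def[symmetric])
    moreover have "\<bar>G n (\<lambda>i. \<omega> (Suc (n + i))) - G n (\<lambda>i. \<omega>' (Suc (n + i)))\<bar> < e"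
      by (rule m) (use eq mM[OF n(2)] in auto)
    ultimately show ?thesis by simp
  next
    case False
    have far: "\<bar>glue G c v - c\<bar> < e/2" if v: "\<forall>i<N. \<not> v i" for v
    proof (cases v rule: cantor_cases)
      case (2 n \<tau>)
      then have "n \<ge> N" using v by (auto simp: spot_def intro: leI)
      then show ?thesis using 2 near by (simp add: glue_spot)
    qed (use e in \<open>simp add: glue_zseq\<close>)
    have "\<forall>i<N. \<not> \<omega> i" "\<forall>i<N. \<not> \<omega>' i" using False eq by (auto simp: M_def)
    then have "\<bar>glue G c \<omega> - c\<bar> < e/2" "\<bar>glue G c \<omega>' - c\<bar> < e/2" using far by simp_all
    then show ?thesis by linarith
  qed
  then show "\<exists>n. \<forall>\<omega> \<omega>'. (\<forall>i<n. \<omega> i = \<omega>' i) \<longrightarrow> \<bar>glue G c \<omega> - glue G c \<omega>'\<bar> < e"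
    by (intro exI[of _ M] allI impI)
qed

lemma apply_glue_le:
  assumes "\<And>n. norm (G n) \<le> b" "\<bar>c\<bar> \<le> b"
  shows "\<bar>glue G c \<omega>\<bar> \<le> b"
proof (cases \<omega> rule: cantor_cases)
  case (2 n \<tau>)
  then show ?thesis using norm_bounded[of "G n" \<tau>] assms(1)[of n] by (simp add: glue_spot)
qed (use assms in \<open>simp add: glue_zseq\<close>)

lemma cfun_eqI:
  assumes "\<And>n. sec n f = sec n g" "f zseq = g zseq"
  shows "f = (g :: cfun)"
proof (rule bcontfun_eqI)
  fix \<omega> show "f \<omega> = g \<omega>"
  proof (cases \<omega> rule: cantor_cases)
    case (2 n \<tau>)
    then show ?thesis using arg_cong[OF assms(1)[of n], of "\<lambda>f. apply_bcontfun f \<tau>"] by (simp add: apply_sec)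
  qed (use assms in simp)
qed

text \<open>This takes the place of infinite direct sums: an operator into \<open>cfun\<close> is
  prescribed section by section, with convergence to a constant function instead of
  summability.\<close>

lemma glue_operator:
  fixes G :: "'w::real_normed_vector \<Rightarrow> nat \<Rightarrow> cfun" and c :: "'w \<Rightarrow> real"
  assumes G: "\<And>n. bounded_linear (\<lambda>x. G x n)" "\<And>x. G x \<longlonglongrightarrow> const_bcontfun (c x)"
    and c: "linear c" and K: "\<And>x n. norm (G x n) \<le> K * norm x" "\<And>x. \<bar>c x\<bar> \<le> K * norm x"
  shows "\<exists>T. bounded_linear T \<and> (\<forall>x n. sec n (T x) = G x n) \<and> (\<forall>x. apply_bcontfun (T x) zseq = c x)"
proof (intro exI conjI allI)
  let ?T = "\<lambda>x. Bcontfun (glue (G x) (c x))"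
  have ap: "apply_bcontfun (?T x) = glue (G x) (c x)" for x
    by (rule apply_Bcontfun[OF ucyl_glue[OF G(2)]])
  show "bounded_linear ?T"
  proof (rule bounded_linear_Bcontfun[OF ucyl_glue[OF G(2)]])
    show "glue (G (x + y)) (c (x + y)) \<omega> = glue (G x) (c x) \<omega> + glue (G y) (c y) \<omega>" for x y \<omega>
      by (cases \<omega> rule: cantor_cases)
        (simp_all add: glue_zseq glue_spot linear_add[OF c] linear_add[OF bounded_linear.linear[OF G(1)]])
    show "glue (G (r *\<^sub>R x)) (c (r *\<^sub>R x)) \<omega> = r * glue (G x) (c x) \<omega>" for r x \<omega>
      by (cases \<omega> rule: cantor_cases)
        (simp_all add: glue_zseq glue_spot linear_cmul[OF c] linear_cmul[OF bounded_linear.linear[OF G(1)]])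
    show "\<bar>glue (G x) (c x) \<omega>\<bar> \<le> K * norm x" for x \<omega> by (intro apply_glue_le K)
  qed
  show "sec n (?T x) = G x n" for x n
    by (rule bcontfun_eqI) (simp add: apply_sec ap glue_spot)
  show "apply_bcontfun (?T x) zseq = c x" for x by (simp add: ap glue_zseq)
qed

lemma linear_apply_bcontfun: "linear (\<lambda>f::cfun. apply_bcontfun f \<omega>)"
  by (rule linearI) simp_all

text \<open>
  Pelczynski's decomposition method.  Writing \<open>W\<close> for the range of the projection \<open>P\<close> and \<open>C\<close> for
  \<open>cfun\<close>, one has \<open>W \<oplus> C \<cong> C\<close> since \<open>W\<close> is complemented in \<open>C\<close>, by shifting the complement of
  \<open>W\<close> along the sections; and \<open>W \<cong> C \<oplus> W\<close> since \<open>C\<close> is complemented in \<open>W\<close> and \<open>C \<cong> C \<oplus> C\<close>.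
\<close>

lemma decomposition_method:
  fixes P :: "'w::real_normed_vector \<Rightarrow> 'w" and J :: "'w \<Rightarrow> cfun" and R :: "cfun \<Rightarrow> 'w"
    and j :: "cfun \<Rightarrow> 'w" and r :: "'w \<Rightarrow> cfun"
  assumes bl: "bounded_linear P" "bounded_linear J" "bounded_linear R" "bounded_linear j" "bounded_linear r"
    and RJ: "\<And>w. R (J w) = P w" and JP: "\<And>w. J (P w) = J w" and PR: "\<And>f. P (R f) = R f"
    and rj: "\<And>f. r (j f) = f" and Pj: "\<And>f. P (j f) = j f" and rP: "\<And>w. r (P w) = r w"
  shows "\<exists>\<Phi> \<Psi>. bounded_linear \<Phi> \<and> bounded_linear \<Psi> \<and> (\<forall>w. \<Psi> (\<Phi> w) = P w) \<and> (\<forall>f::cfun. \<Phi> (\<Psi> f) = f)"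
proof -
  interpret P: bounded_linear P by fact
  interpret J: bounded_linear J by fact
  interpret R: bounded_linear R by fact
  interpret j: bounded_linear j by fact
  interpret r: bounded_linear r by fact
  interpret sec: bounded_linear "sec n" for n by (rule bounded_linear_sec)
  interpret half: bounded_linear "half b" for b by (rule bounded_linear_half)
  \<comment> \<open>The projection of \<open>cfun\<close> onto the copy of W embedded by
    \<open>J\<close>.\<close>
  define Q where "Q f = J (R f)" for f
  have blQ: "bounded_linear Q" unfolding Q_def by (rule bounded_linear_compose[OF bl(2,3)])
  interpret Q: bounded_linear Q by (rule blQ)
  have QQ: "Q (Q f) = Q f" for f by (simp add: Q_def RJ PR)
  have QJ: "Q (J w) = J w" for w by (simp add: Q_def RJ JP)
  have RQ: "R (Q f) = R f" for f by (simp add: Q_def RJ PR)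
  obtain K where K: "K > 0" "\<And>f. norm (Q f) \<le> norm f * K" using Q.pos_bounded by blast
  have nQ: "norm (Q (sec n f)) \<le> K * norm f" for n f
    using order_trans[OF K(2)[of "sec n f"] mult_right_mono[OF norm_sec_le[of n f], of K]] K(1)
    by (simp add: mult.commute)
  have n2: "norm (sec n f - Q (sec n f)) \<le> (1 + K) * norm f" for n f
    using norm_triangle_ineq4[of "sec n f" "Q (sec n f)"] nQ[of n f] norm_sec_le[of n f]
    by (simp add: distrib_right)
  have n3: "norm (Q (sec m f) + (sec n f - Q (sec n f))) \<le> (1 + 2 * K) * norm f" for m n f
    using norm_triangle_ineq[of "Q (sec m f)" "sec n f - Q (sec n f)"] nQ[of m f] n2[of n f]
    by (simp add: distrib_right)
  have z: "\<bar>apply_bcontfun f zseq\<bar> \<le> (1 + 2 * K) * norm f" for f :: cfun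
    using norm_bounded[of f zseq] mult_right_mono[of 1 "1 + 2 * K" "norm f"] K(1) by simp
  have bls: "bounded_linear (\<lambda>f. Q (sec n f))" for n by (rule bounded_linear_compose[OF blQ bounded_linear_sec])
  have bld: "bounded_linear (\<lambda>f. sec n f - Q (sec n f))" for n
    by (rule bounded_linear_sub[OF bounded_linear_sec bls])
  have Qlim: "(\<lambda>n. Q (sec n f)) \<longlonglongrightarrow> Q (const_bcontfun (f zseq))" for f
    by (rule Q.tendsto[OF sec_tendsto])
  have lim2: "(\<lambda>n. sec n f - Q (sec n f)) \<longlonglongrightarrow> const_bcontfun (f zseq) - Q (const_bcontfun (f zseq))" for f
    by (rule tendsto_diff[OF sec_tendsto Qlim])
  \<comment> \<open>\<open>D\<close> forgets the Q-part of section 0 and moves the other Q-parts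
    down by one section, while the complementary parts stay. Neither kind of part need tend to a
    constant function, but their limits add up to \<open>const_bcontfun (f zseq)\<close>.\<close>
  have "\<exists>T. bounded_linear T \<and> (\<forall>f n. sec n (T f) = Q (sec (Suc n) f) + (sec n f - Q (sec n f))) \<and>
      (\<forall>f. apply_bcontfun (T f) zseq = f zseq)"
  proof (rule glue_operator[where K="1 + 2 * K"])
    show "(\<lambda>n. Q (sec (Suc n) f) + (sec n f - Q (sec n f))) \<longlonglongrightarrow> const_bcontfun (f zseq)" for f
      using tendsto_add[OF LIMSEQ_Suc[OF Qlim] lim2, of f f] by simp
  qed (auto intro: bounded_linear_add bls bld linear_apply_bcontfun n3 z)
  then obtain D where D: "bounded_linear D" "\<And>f n. sec n (D f) = Q (sec (Suc n) f) + (sec n f - Q (sec n f))"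
    "\<And>f. apply_bcontfun (D f) zseq = f zseq" by blast
  \<comment> \<open>\<open>U\<close> moves the Q-parts up by one section and leaves no Q-part at
    section 0. It is a right inverse of \<open>D\<close>, and \<open>U (D f)\<close> lacks only the
    Q-part of section 0 of f.\<close>
  have "\<exists>T. bounded_linear T \<and> (\<forall>f n. sec n (T f) =
        (case n of 0 \<Rightarrow> sec 0 f - Q (sec 0 f) | Suc m \<Rightarrow> Q (sec m f) + (sec (Suc m) f - Q (sec (Suc m) f)))) \<and>
      (\<forall>f. apply_bcontfun (T f) zseq = f zseq)"
  proof (rule glue_operator[where K="1 + 2 * K"])
    show "bounded_linear (\<lambda>f. case n of 0 \<Rightarrow> sec 0 f - Q (sec 0 f)
        | Suc m \<Rightarrow> Q (sec m f) + (sec (Suc m) f - Q (sec (Suc m) f)))" for n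
      by (cases n) (auto intro: bounded_linear_add bls bld)
    show "(\<lambda>n. case n of 0 \<Rightarrow> sec 0 f - Q (sec 0 f)
        | Suc m \<Rightarrow> Q (sec m f) + (sec (Suc m) f - Q (sec (Suc m) f))) \<longlonglongrightarrow> const_bcontfun (f zseq)" for f
      using tendsto_add[OF Qlim LIMSEQ_Suc[OF lim2], of f f] by (subst filterlim_sequentially_Suc[symmetric]) simp
    show "norm (case n of 0 \<Rightarrow> sec 0 f - Q (sec 0 f)
        | Suc m \<Rightarrow> Q (sec m f) + (sec (Suc m) f - Q (sec (Suc m) f))) \<le> (1 + 2 * K) * norm f" for f n
    proof (cases n)
      case 0
      have "(1 + K) * norm f \<le> (1 + 2 * K) * norm f" using K(1) by (intro mult_right_mono) auto
      then show ?thesis using n2[of 0 f] 0 by simp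
    qed (simp add: n3)
  qed (auto intro: linear_apply_bcontfun z)
  then obtain U where U1: "bounded_linear U" "\<And>f. apply_bcontfun (U f) zseq = apply_bcontfun f zseq"
    and U2: "\<And>f n. sec n (U f) = (case n of 0 \<Rightarrow> sec 0 f - Q (sec 0 f)
      | Suc m \<Rightarrow> Q (sec m f) + (sec (Suc m) f - Q (sec (Suc m) f)))" by blast
  note U = U1(1) U2[of 0, simplified] U2[of "Suc _", simplified] U1(2)
  \<comment> \<open>\<open>I\<close> places a function at section 0 and zero elsewhere, so that f
    corresponds to the pair of \<open>Q (sec 0 f)\<close> and \<open>D f\<close>.\<close>
  have "\<exists>T. bounded_linear T \<and> (\<forall>f n. sec n (T f) = (if n = 0 then f else 0)) \<and>
      (\<forall>f::cfun. apply_bcontfun (T f) zseq = 0)"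
  proof (rule glue_operator[where K=1])
    show "(\<lambda>n. if n = 0 then f else 0) \<longlonglongrightarrow> const_bcontfun 0" for f :: cfun
      by (subst filterlim_sequentially_Suc[symmetric]) simp
    show "bounded_linear (\<lambda>f::cfun. if n = 0 then f else 0)" for n :: nat
      by (cases n) (simp_all add: bounded_linear_ident bounded_linear_zero)
  qed (auto intro: linearI)
  then obtain I :: "cfun \<Rightarrow> cfun" where I: "bounded_linear I" "\<And>f n. sec n (I f) = (if n = 0 then f else 0)"
    "\<And>f. apply_bcontfun (I f) zseq = 0" by blast
  interpret D: bounded_linear D by (rule D(1))
  interpret U: bounded_linear U by (rule U(1))
  interpret I: bounded_linear I by (rule I(1))
  have DU: "D (U f) = f" for f
  proof (rule cfun_eqI)
    show "sec n (D (U f)) = sec n f" for n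
      by (cases n) (simp_all add: D U Q.add Q.diff QQ)
  qed (simp add: D U)
  have DIJ: "D (I (J w)) = 0" for w
  proof (rule cfun_eqI)
    show "sec n (D (I (J w))) = sec n 0" for n
      by (cases n) (simp_all add: D I QJ Q.zero sec.zero)
  qed (simp add: D I)
  have UD: "I (Q (sec 0 f)) + U (D f) = f" for f
  proof (rule cfun_eqI)
    show "sec n (I (Q (sec 0 f)) + U (D f)) = sec n f" for n
      by (cases n) (simp_all add: sec.add D U I Q.add Q.diff QQ)
  qed (simp add: D U I)
  \<comment> \<open>A point w of W consists of w - j (r w) and r w. The True half of r w takes the
    place of r w, which gives a point of W again, and the False half becomes a separate factor C;
    the pair is then put together by \<open>I\<close> and \<open>U\<close>.\<close>
  define \<Phi> where "\<Phi> w = I (J (w - j (r w) + j (half True (r w)))) + U (half False (r w))" for w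
  define \<Psi> where "\<Psi> f = R (sec 0 f) - j (r (R (sec 0 f)))
    + j (unhalf False (D f) + unhalf True (r (R (sec 0 f))))" for f
  have "bounded_linear \<Phi>"
    unfolding \<Phi>_def
    by (intro bounded_linear_add bounded_linear_sub bounded_linear_ident
        bounded_linear_compose[OF I(1)] bounded_linear_compose[OF U(1)] bounded_linear_compose[OF bl(2)]
        bounded_linear_compose[OF bl(4)] bounded_linear_compose[OF bounded_linear_half] bl(5))
  moreover have "bounded_linear \<Psi>"
    unfolding \<Psi>_def
    by (intro bounded_linear_add bounded_linear_sub bounded_linear_compose[OF bl(4)]
        bounded_linear_compose[OF bounded_linear_unhalf] bounded_linear_compose[OF bl(5)]
        bounded_linear_compose[OF bl(3)] bounded_linear_sec D(1))
  moreover have "\<Psi> (\<Phi> w) = P w" for w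
  proof -
    define w' where "w' = w - j (r w) + j (half True (r w))"
    have Pw': "P w' = P w - j (r w) + j (half True (r w))" by (simp add: w'_def P.add P.diff Pj)
    have rw': "r w' = half True (r w)" by (simp add: w'_def r.add r.diff rj)
    have Phi: "\<Phi> w = I (J w') + U (half False (r w))" by (simp add: \<Phi>_def w'_def)
    have "R (sec 0 (\<Phi> w)) = P w'"
      by (simp add: Phi sec.add I U R.add R.diff RJ RQ)
    moreover have "D (\<Phi> w) = half False (r w)"
      by (simp add: Phi D.add DIJ DU)
    ultimately show ?thesis
      by (simp add: \<Psi>_def rP rw' unhalf_half) (simp add: Pw')
  qed
  moreover have "\<Phi> (\<Psi> f) = f" for f
  proof -
    have r\<Psi>: "r (\<Psi> f) = unhalf False (D f) + unhalf True (r (R (sec 0 f)))"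
      by (simp add: \<Psi>_def r.add r.diff rj)
    have h: "half True (r (\<Psi> f)) = r (R (sec 0 f))" "half False (r (\<Psi> f)) = D f"
      by (simp_all add: r\<Psi> half.add half_unhalf)
    have "\<Psi> f - j (r (\<Psi> f)) + j (half True (r (\<Psi> f))) = R (sec 0 f)"
      unfolding h by (simp add: r\<Psi>) (simp add: \<Psi>_def)
    then show ?thesis using UD[of f] by (simp add: \<Phi>_def h Q_def)
  qed
  ultimately show ?thesis by blast
qed

section \<open>Averaging against Bernoulli measures\<close>

definition unit_seq :: "(nat \<Rightarrow> 'a::abelian_unital_cstar_algebra) \<Rightarrow> bool" where
  "unit_seq f \<longleftrightarrow> (\<forall>n. f n \<in> sa \<and> (\<forall>\<phi>\<in>characters. 0 \<le> \<phi> (f n) \<and> \<phi> (f n) \<le> 1))"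

text \<open>For S below n, the value at \<phi> is the probability that among n independent events of
  probabilities \<open>\<phi> (f i)\<close> exactly those with index in S occur.\<close>

definition weight :: "(nat \<Rightarrow> 'a::abelian_unital_cstar_algebra) \<Rightarrow> nat \<Rightarrow> nat set \<Rightarrow> 'a" where
  "weight f n S = prod f S * (\<Prod>i\<in>{..<n} - S. 1 - f i)"

text \<open>An expectation over the first n coordinates, with \<open>g\<close> evaluated at
  sequences that are False from n on.\<close>

definition avg :: "(nat \<Rightarrow> 'a::abelian_unital_cstar_algebra) \<Rightarrow> nat \<Rightarrow> (cantor \<Rightarrow> real) \<Rightarrow> 'a" where
  "avg f n g = (\<Sum>S\<in>Pow {..<n}. g (\<lambda>i. i \<in> S) *\<^sub>R weight f n S)"

text \<open>
  \<open>\<phi> (bern f g)\<close> is the integral of \<open>g\<close> against the product of the Bernoulli measures on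
  \<open>{False, True}\<close> with \<open>True\<close>-probabilities \<open>\<phi> (f n)\<close>.
\<close>

definition bern :: "(nat \<Rightarrow> 'a::abelian_unital_cstar_algebra) \<Rightarrow> cfun \<Rightarrow> 'a" where
  "bern f g = lim (\<lambda>n. avg f n (apply_bcontfun g))"

lemma character_prod:
  assumes "\<phi> \<in> characters" "\<And>i. i \<in> I \<Longrightarrow> f i \<in> sa"
  shows "\<phi> (prod f I) = (\<Prod>i\<in>I. \<phi> (f i))"
  using assms(2)
proof (induction I rule: infinite_finite_induct)
  case (insert x I)
  then show ?case using assms(1) by (simp add: characterD(6) sa_prod)
qed (use assms(1) in \<open>simp_all add: characterD(5)\<close>)

lemma characters_nonempty: "(characters :: ('a::abelian_unital_cstar_algebra \<Rightarrow> real) set) \<noteq> {}"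
  using norm_le_characters[of "1::'a" 0] sa_1 by auto

text \<open>Only a full gap from 0 to 1 counts as separation. Hence the characters may be sorted by
  the overlapping open conditions "value > 0" and "value < 1": two characters that satisfy the same
  choice of conditions below N are still close at \<open>a\<close>.\<close>

definition sep_seq :: "(nat \<Rightarrow> 'a::abelian_unital_cstar_algebra) \<Rightarrow> bool" where
  "sep_seq h \<longleftrightarrow> (\<forall>a. \<forall>e>0. \<exists>N. \<forall>\<phi>\<in>characters. \<forall>\<psi>\<in>characters.
     (\<forall>i<N. \<not> (\<phi> (h i) = 0 \<and> \<psi> (h i) = 1) \<and> \<not> (\<phi> (h i) = 1 \<and> \<psi> (h i) = 0)) \<longrightarrow> \<bar>\<phi> a - \<psi> a\<bar> < e)"

context
  fixes f :: "nat \<Rightarrow> 'a::abelian_unital_cstar_algebra"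
  assumes f: "unit_seq f"
begin

lemma unit_seqD:
  shows "f n \<in> sa" "\<phi> \<in> characters \<Longrightarrow> 0 \<le> \<phi> (f n)" "\<phi> \<in> characters \<Longrightarrow> \<phi> (f n) \<le> 1"
  using f by (auto simp: unit_seq_def)

lemma weight_sa: "weight f n S \<in> sa"
  unfolding weight_def by (intro sa_mult sa_prod sa_diff sa_1 unit_seqD(1))

lemma character_weight:
  assumes "\<phi> \<in> characters"
  shows "\<phi> (weight f n S) = (\<Prod>i\<in>S. \<phi> (f i)) * (\<Prod>i\<in>{..<n} - S. 1 - \<phi> (f i))"
proof -
  have "prod f S \<in> sa" "(\<Prod>i\<in>{..<n} - S. 1 - f i) \<in> sa"
    by (intro sa_prod sa_diff sa_1 unit_seqD(1))+
  then have "\<phi> (weight f n S) = \<phi> (prod f S) * \<phi> (\<Prod>i\<in>{..<n} - S. 1 - f i)"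
    unfolding weight_def by (rule characterD(6)[OF assms])
  also have "\<dots> = (\<Prod>i\<in>S. \<phi> (f i)) * (\<Prod>i\<in>{..<n} - S. \<phi> (1 - f i))"
    using assms by (simp add: character_prod unit_seqD(1) sa_diff sa_1)
  finally show ?thesis using assms by (simp add: characterD(5,8))
qed

lemma weight_nonneg: "\<phi> \<in> characters \<Longrightarrow> 0 \<le> \<phi> (weight f n S)"
  using unit_seqD by (simp add: character_weight prod_nonneg)

lemma weight_sum: "\<phi> \<in> characters \<Longrightarrow> (\<Sum>S\<in>Pow {..<n}. \<phi> (weight f n S)) = 1"
  using prod_add[of "{..<n}" "\<lambda>i. \<phi> (f i)" "\<lambda>i. 1 - \<phi> (f i)"] by (simp add: character_weight)

lemma weight_nonzero:
  assumes "\<phi> \<in> characters" "\<phi> (weight f n S) \<noteq> 0" "S \<subseteq> {..<n}" "i < n"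
  shows "i \<in> S \<Longrightarrow> \<phi> (f i) > 0" "i \<notin> S \<Longrightarrow> \<phi> (f i) < 1"
proof -
  have fin: "finite S" using assms(3) finite_subset by blast
  have n: "(\<Prod>i\<in>S. \<phi> (f i)) \<noteq> 0" "(\<Prod>i\<in>{..<n} - S. 1 - \<phi> (f i)) \<noteq> 0"
    using assms(1,2) by (simp_all add: character_weight)
  show "\<phi> (f i) > 0" if "i \<in> S"
  proof -
    have "\<phi> (f i) \<noteq> 0" using n(1) that fin by (auto simp: prod_zero_iff)
    then show ?thesis using unit_seqD(2)[OF assms(1), of i] by linarith
  qed
  show "\<phi> (f i) < 1" if "i \<notin> S"
  proof -
    have "1 - \<phi> (f i) \<noteq> 0" using n(2) that assms(4) by (auto simp: prod_zero_iff)
    then show ?thesis using unit_seqD(3)[OF assms(1), of i] by linarith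
  qed
qed

lemma avg_sa: "avg f n g \<in> sa"
  unfolding avg_def by (intro sa_sum sa_scaleR weight_sa)

text \<open>The weights form a probability distribution, so only sets of nonzero weight influence
  the value.\<close>

lemma avg_bound:
  assumes p: "\<phi> \<in> characters"
    and near: "\<And>S. S \<subseteq> {..<n} \<Longrightarrow> \<phi> (weight f n S) \<noteq> 0 \<Longrightarrow> \<bar>g (\<lambda>i. i \<in> S) - c\<bar> \<le> e"
  shows "\<bar>\<phi> (avg f n g) - c\<bar> \<le> e"
proof -
  let ?w = "\<lambda>S. \<phi> (weight f n S)" and ?P = "Pow {..<n}"
  have "\<phi> (avg f n g) - c = (\<Sum>S\<in>?P. g (\<lambda>i. i \<in> S) * ?w S) - c * (\<Sum>S\<in>?P. ?w S)"
    using p by (simp add: avg_def character_sum characterD(2) weight_sum)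
  also have "\<dots> = (\<Sum>S\<in>?P. (g (\<lambda>i. i \<in> S) - c) * ?w S)"
    by (simp add: sum_distrib_left sum_subtractf left_diff_distrib)
  also have "\<bar>\<dots>\<bar> \<le> (\<Sum>S\<in>?P. e * ?w S)"
  proof (rule order_trans[OF sum_abs], rule sum_mono)
    fix S assume S: "S \<in> ?P"
    show "\<bar>(g (\<lambda>i. i \<in> S) - c) * ?w S\<bar> \<le> e * ?w S"
    proof (cases "?w S = 0")
      case False
      then have "\<bar>g (\<lambda>i. i \<in> S) - c\<bar> * ?w S \<le> e * ?w S"
        using near S weight_nonneg[OF p] by (intro mult_right_mono) auto
      then show ?thesis using weight_nonneg[OF p, of n S] by (simp add: abs_mult)
    qed simp
  qed
  also have "\<dots> = e" using weight_sum[OF p] by (simp flip: sum_distrib_left)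
  finally show ?thesis .
qed

lemma avg_norm_le:
  assumes "\<And>\<omega>. \<bar>g \<omega>\<bar> \<le> e" shows "norm (avg f n g) \<le> e"
proof (rule norm_le_characters[OF avg_sa])
  show "\<bar>\<phi> (avg f n g)\<bar> \<le> e" if "\<phi> \<in> characters" for \<phi>
    using avg_bound[OF that, of n g 0 e] assms by simp
  show "0 \<le> e" using assms[of undefined] by linarith
qed

lemma avg_diff: "avg f n (\<lambda>\<omega>. g \<omega> - h \<omega>) = avg f n g - avg f n h"
  by (simp add: avg_def sum_subtractf scaleR_diff_left)

text \<open>Consistency of the distributions: summing over whether n occurs contributes the factor
  \<open>f n + (1 - f n) = 1\<close>.\<close>

lemma avg_Suc:
  assumes g: "\<And>\<omega> \<omega>'. (\<forall>i<n. \<omega> i = \<omega>' i) \<Longrightarrow> g \<omega> = g \<omega>'"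
  shows "avg f (Suc n) g = avg f n g"
proof -
  have inj: "inj_on (insert n) (Pow {..<n})" by (rule inj_onI) (auto; blast)
  have P: "Pow {..<Suc n} = Pow {..<n} \<union> insert n ` Pow {..<n}"
    by (simp add: lessThan_Suc Pow_insert)
  have w1: "weight f (Suc n) S = weight f n S * (1 - f n)" if "S \<subseteq> {..<n}" for S
  proof -
    have "{..<Suc n} - S = insert n ({..<n} - S)" using that by auto
    then show ?thesis by (simp add: weight_def algebra_simps)
  qed
  have w2: "weight f (Suc n) (insert n S) = weight f n S * f n" if "S \<subseteq> {..<n}" for S
  proof -
    have "{..<Suc n} - insert n S = {..<n} - S" using that by auto
    moreover have "n \<notin> S" "finite S" using that finite_subset by auto
    ultimately show ?thesis by (simp add: weight_def ac_simps)
  qed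
  have g': "g (\<lambda>i. i \<in> insert n S) = g (\<lambda>i. i \<in> S)" for S by (rule g) auto
  have "avg f (Suc n) g = (\<Sum>S\<in>Pow {..<n}. g (\<lambda>i. i \<in> S) *\<^sub>R weight f (Suc n) S) +
      (\<Sum>S\<in>insert n ` Pow {..<n}. g (\<lambda>i. i \<in> S) *\<^sub>R weight f (Suc n) S)"
    unfolding avg_def P by (rule sum.union_disjoint) auto
  also have "(\<Sum>S\<in>insert n ` Pow {..<n}. g (\<lambda>i. i \<in> S) *\<^sub>R weight f (Suc n) S) =
      (\<Sum>S\<in>Pow {..<n}. g (\<lambda>i. i \<in> S) *\<^sub>R (weight f n S * f n))"
    unfolding sum.reindex[OF inj] o_def g' by (intro sum.cong refl) (simp add: w2)
  also have "(\<Sum>S\<in>Pow {..<n}. g (\<lambda>i. i \<in> S) *\<^sub>R weight f (Suc n) S) =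
      (\<Sum>S\<in>Pow {..<n}. g (\<lambda>i. i \<in> S) *\<^sub>R (weight f n S * (1 - f n)))"
    by (intro sum.cong refl) (simp add: w1)
  finally show ?thesis
    by (simp add: avg_def right_diff_distrib scaleR_diff_right flip: sum.distrib)
qed

lemma avg_truncate:
  assumes "n \<le> m"
  shows "avg f m (\<lambda>\<omega>. g (\<lambda>i. i < n \<and> \<omega> i)) = avg f n g"
  using assms
proof (induction m rule: dec_induct)
  case base
  show ?case unfolding avg_def
  proof (rule sum.cong[OF refl])
    fix S assume "S \<in> Pow {..<n}"
    then have "(\<lambda>i. i < n \<and> i \<in> S) = (\<lambda>i. i \<in> S)" by auto
    then show "g (\<lambda>i. i < n \<and> i \<in> S) *\<^sub>R weight f n S = g (\<lambda>i. i \<in> S) *\<^sub>R weight f n S" by simp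
  qed
next
  case (step m)
  have "avg f (Suc m) (\<lambda>\<omega>. g (\<lambda>i. i < n \<and> \<omega> i)) = avg f m (\<lambda>\<omega>. g (\<lambda>i. i < n \<and> \<omega> i))"
  proof (rule avg_Suc)
    fix \<omega> \<omega>' :: cantor assume "\<forall>i<m. \<omega> i = \<omega>' i"
    then have "(\<lambda>i. i < n \<and> \<omega> i) = (\<lambda>i. i < n \<and> \<omega>' i)" using step(1) by auto
    then show "g (\<lambda>i. i < n \<and> \<omega> i) = g (\<lambda>i. i < n \<and> \<omega>' i)" by simp
  qed
  then show ?case using step by simp
qed

text \<open>Two stages differ by the average of g minus its truncation to the earlier prefix, which
  is uniformly small.\<close>

lemma avg_LIMSEQ: "(\<lambda>n. avg f n (apply_bcontfun g)) \<longlonglongrightarrow> bern f g"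
proof -
  have "Cauchy (\<lambda>n. avg f n (apply_bcontfun g))"
  proof (rule CauchyI')
    fix e :: real assume e: "e > 0"
    then have "e/2 > 0" by simp
    then obtain n where n: "\<And>\<omega> \<omega>'. \<forall>i<n. \<omega> i = \<omega>' i \<Longrightarrow> \<bar>g \<omega> - g \<omega>'\<bar> < e/2"
      using ucylD[OF ucyl_apply[of g]] by blast
    have *: "norm (avg f n' (apply_bcontfun g) - avg f m (apply_bcontfun g)) < e" if m: "n \<le> n'" "n' < m" for m n'
    proof -
      have "norm (avg f m (apply_bcontfun g) - avg f n' (apply_bcontfun g)) =
          norm (avg f m (\<lambda>\<omega>. g \<omega> - g (\<lambda>i. i < n' \<and> \<omega> i)))"
        using m by (simp add: avg_diff avg_truncate)
      also have "\<dots> \<le> e/2"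
      proof (rule avg_norm_le)
        fix \<omega>
        have "\<bar>g \<omega> - g (\<lambda>i. i < n' \<and> \<omega> i)\<bar> < e/2" by (rule n) (use m in auto)
        then show "\<bar>g \<omega> - g (\<lambda>i. i < n' \<and> \<omega> i)\<bar> \<le> e/2" by simp
      qed
      finally show ?thesis using e by (simp add: norm_minus_commute)
    qed
    show "\<exists>M. \<forall>m\<ge>M. \<forall>n>m. dist (avg f m (apply_bcontfun g)) (avg f n (apply_bcontfun g)) < e"
      using * by (auto simp: dist_norm)
  qed
  then show ?thesis
    unfolding bern_def using Cauchy_convergent convergent_LIMSEQ_iff by blast
qed

lemma bern_sa: "bern f g \<in> sa"
  using closed_sequentially[OF closed_sa _ avg_LIMSEQ] avg_sa by blast

lemma bounded_linear_bern: "bounded_linear (bern f)"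
proof (rule bounded_linear_intro[where K=1])
  show "bern f (g + h) = bern f g + bern f h" for g h
  proof (rule LIMSEQ_unique[OF avg_LIMSEQ])
    have "(\<lambda>n. avg f n (apply_bcontfun g) + avg f n (apply_bcontfun h)) \<longlonglongrightarrow> bern f g + bern f h"
      by (intro tendsto_add avg_LIMSEQ)
    then show "(\<lambda>n. avg f n (apply_bcontfun (g + h))) \<longlonglongrightarrow> bern f g + bern f h"
      by (simp add: avg_def scaleR_left_distrib sum.distrib)
  qed
  show "bern f (r *\<^sub>R g) = r *\<^sub>R bern f g" for r g
  proof (rule LIMSEQ_unique[OF avg_LIMSEQ])
    have "(\<lambda>n. r *\<^sub>R avg f n (apply_bcontfun g)) \<longlonglongrightarrow> r *\<^sub>R bern f g"
      by (intro tendsto_scaleR tendsto_const avg_LIMSEQ)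
    then show "(\<lambda>n. avg f n (apply_bcontfun (r *\<^sub>R g))) \<longlonglongrightarrow> r *\<^sub>R bern f g"
      by (simp add: avg_def scaleR_sum_right)
  qed
  show "norm (bern f g) \<le> norm g * 1" for g
    using tendsto_norm[OF avg_LIMSEQ, of g]
    by (rule LIMSEQ_le_const2) (use avg_norm_le[OF abs_apply_le] in auto)
qed

lemma bern_eval:
  fixes g :: cfun
  assumes p: "\<phi> \<in> characters"
    and near: "\<And>e. e > 0 \<Longrightarrow> \<exists>N. \<forall>n\<ge>N. \<forall>S\<subseteq>{..<n}. \<phi> (weight f n S) \<noteq> 0 \<longrightarrow> \<bar>g (\<lambda>i. i \<in> S) - c\<bar> \<le> e"
  shows "\<phi> (bern f g) = c"
proof (rule LIMSEQ_unique[OF character_LIMSEQ[OF p avg_LIMSEQ]])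
  show "(\<lambda>n. \<phi> (avg f n (apply_bcontfun g))) \<longlonglongrightarrow> c"
  proof (rule LIMSEQ_I)
    fix e :: real assume e: "e > 0"
    then have "e/2 > 0" by simp
    from near[OF this] obtain N where
      N: "\<forall>n\<ge>N. \<forall>S\<subseteq>{..<n}. \<phi> (weight f n S) \<noteq> 0 \<longrightarrow> \<bar>g (\<lambda>i. i \<in> S) - c\<bar> \<le> e/2" by blast
    have "norm (\<phi> (avg f n (apply_bcontfun g)) - c) < e" if "n \<ge> N" for n
    proof -
      have "\<bar>\<phi> (avg f n (apply_bcontfun g)) - c\<bar> \<le> e/2"
        by (rule avg_bound[OF p]) (use N that in blast)
      then show ?thesis using e by simp
    qed
    then show "\<exists>no. \<forall>n\<ge>no. norm (\<phi> (avg f n (apply_bcontfun g)) - c) < e" by blast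
  qed
qed

text \<open>At such a character the Bernoulli measure is the point mass at \<omega>. On a Cantor set
  of such characters \<open>bern f\<close> is therefore an extension operator.\<close>

lemma bern_eval_sharp:
  fixes g :: cfun
  assumes p: "\<phi> \<in> characters" and sharp: "\<And>i. \<phi> (f i) = (if \<omega> i then 1 else 0)"
  shows "\<phi> (bern f g) = g \<omega>"
proof (rule bern_eval[OF p])
  fix e :: real assume e: "e > 0"
  obtain n where n: "\<And>\<omega> \<omega>'. \<forall>i<n. \<omega> i = \<omega>' i \<Longrightarrow> \<bar>g \<omega> - g \<omega>'\<bar> < e"
    using ucylD[OF ucyl_apply[of g] e] by blast
  show "\<exists>N. \<forall>n\<ge>N. \<forall>S\<subseteq>{..<n}. \<phi> (weight f n S) \<noteq> 0 \<longrightarrow> \<bar>g (\<lambda>i. i \<in> S) - g \<omega>\<bar> \<le> e"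
  proof (intro exI[of _ n] allI impI)
    fix m S assume m: "n \<le> m" "S \<subseteq> {..<m}" "\<phi> (weight f m S) \<noteq> 0"
    have "i \<in> S \<longleftrightarrow> \<omega> i" if "i < m" for i
      using weight_nonzero[OF p m(3,2) that] sharp[of i] by (cases "\<omega> i") auto
    then have "\<bar>g (\<lambda>i. i \<in> S) - g \<omega>\<bar> < e" using m(1) by (intro n) auto
    then show "\<bar>g (\<lambda>i. i \<in> S) - g \<omega>\<bar> \<le> e" by simp
  qed
qed

section \<open>Embedding into the continuous functions on the Cantor space\<close>

text \<open>By \<open>weight_nonzero\<close> these are the only characters at which the prefix of
  length n can carry weight. The conditions for True and False overlap, so cells of distinct
  prefixes need not be disjoint.\<close>

definition cell :: "nat \<Rightarrow> cantor \<Rightarrow> ('a \<Rightarrow> real) set" where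
  "cell n \<omega> = {\<phi>\<in>characters. \<forall>i<n. if \<omega> i then \<phi> (f i) > 0 else \<phi> (f i) < 1}"

definition depth :: "nat \<Rightarrow> cantor \<Rightarrow> nat" where
  "depth n \<omega> = (GREATEST k. k \<le> n \<and> cell k \<omega> \<noteq> {})"

text \<open>
  The points \<open>cpt n \<omega>\<close> stay in the cells along \<open>\<omega>\<close> as long as these are nonempty and are constant
  afterwards.  So they converge uniformly in \<open>\<omega>\<close>, which extends the map from the sequences with
  nonempty cells to characters to the whole Cantor space.
\<close>

definition cpt :: "nat \<Rightarrow> cantor \<Rightarrow> 'a \<Rightarrow> real" where
  "cpt n \<omega> = (SOME \<phi>. \<phi> \<in> cell (depth n \<omega>) \<omega>)"

lemma cell_antimono: "m \<le> n \<Longrightarrow> cell n \<omega> \<subseteq> cell m \<omega>"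
  by (auto simp: cell_def)

lemma depth_props: "depth n \<omega> \<le> n \<and> cell (depth n \<omega>) \<omega> \<noteq> {}"
  unfolding depth_def
  by (rule GreatestI_nat[where k=0 and b=n]) (use characters_nonempty in \<open>auto simp: cell_def\<close>)

lemma depth_ge: "k \<le> n \<Longrightarrow> cell k \<omega> \<noteq> {} \<Longrightarrow> k \<le> depth n \<omega>"
  unfolding depth_def by (rule Greatest_le_nat[where b=n]) auto

lemma cpt_mem: "cpt n \<omega> \<in> cell (depth n \<omega>) \<omega>"
  unfolding cpt_def using depth_props some_in_eq by blast

lemma cpt_character: "cpt n \<omega> \<in> characters"
  using cpt_mem by (auto simp: cell_def)

lemma cpt_cell: "k \<le> n \<Longrightarrow> cell k \<omega> \<noteq> {} \<Longrightarrow> cpt n \<omega> \<in> cell k \<omega>"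
  using cpt_mem cell_antimono[OF depth_ge] by blast

lemma cpt_stable:
  assumes "cell k \<omega> = {}" "k \<le> n" "k \<le> n'" shows "cpt n \<omega> = cpt n' \<omega>"
proof -
  have "(j \<le> n \<and> cell j \<omega> \<noteq> {}) \<longleftrightarrow> (j \<le> n' \<and> cell j \<omega> \<noteq> {})" for j
    using assms cell_antimono[of k j \<omega>] by (cases "k \<le> j") auto
  then show ?thesis by (simp add: cpt_def depth_def)
qed

lemma cpt_local:
  assumes eq: "\<forall>i<n. \<omega> i = \<omega>' i" shows "cpt n \<omega> = cpt n \<omega>'"
proof -
  have c: "cell k \<omega> = cell k \<omega>'" if "k \<le> n" for k
    using eq that by (auto simp: cell_def)
  have "(k \<le> n \<and> cell k \<omega> \<noteq> {}) \<longleftrightarrow> (k \<le> n \<and> cell k \<omega>' \<noteq> {})" for k using c by auto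
  then have "depth n \<omega> = depth n \<omega>'" by (simp add: depth_def)
  then show ?thesis using c[of "depth n \<omega>"] depth_props[of n \<omega>] by (simp add: cpt_def)
qed

lemma cell_separated:
  assumes "\<phi> \<in> cell N \<omega>" "\<psi> \<in> cell N \<omega>" "i < N"
  shows "\<not> (\<phi> (f i) = 0 \<and> \<psi> (f i) = 1) \<and> \<not> (\<phi> (f i) = 1 \<and> \<psi> (f i) = 0)"
  using assms by (cases "\<omega> i") (auto simp: cell_def)

text \<open>Milutin's averaging argument. The value of \<open>J a\<close> at \<omega> is the limit
  of the values of a at the points \<open>cpt n \<omega>\<close>. The Bernoulli measure of \<phi>
  charges only prefixes whose cells contain \<phi>; there, by separation, this value is close to
  that of a at \<phi>, so averaging returns the latter.\<close>

lemma cantor_embedding: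
  assumes sep: "sep_seq f"
  shows "\<exists>J. bounded_linear J \<and> (\<forall>a. bern f (J a) = re a)"
proof -
  have ex: "\<exists>N. \<forall>\<omega>. \<forall>\<phi>\<in>cell N \<omega>. \<forall>\<psi>\<in>cell N \<omega>. \<bar>\<phi> a - \<psi> a\<bar> < e" if e: "e > 0" for a :: 'a and e
  proof -
    have "\<exists>N. \<forall>\<phi>\<in>characters. \<forall>\<psi>\<in>characters.
     (\<forall>i<N. \<not> (\<phi> (f i) = 0 \<and> \<psi> (f i) = 1) \<and> \<not> (\<phi> (f i) = 1 \<and> \<psi> (f i) = 0)) \<longrightarrow> \<bar>\<phi> a - \<psi> a\<bar> < e"
      using sep e by (simp add: sep_seq_def)
    then obtain N where N: "\<forall>\<phi>\<in>characters. \<forall>\<psi>\<in>characters.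
     (\<forall>i<N. \<not> (\<phi> (f i) = 0 \<and> \<psi> (f i) = 1) \<and> \<not> (\<phi> (f i) = 1 \<and> \<psi> (f i) = 0)) \<longrightarrow> \<bar>\<phi> a - \<psi> a\<bar> < e"
      ..
    show ?thesis
    proof (intro exI[of _ N] allI ballI)
      fix \<omega> \<phi> \<psi> assume c: "\<phi> \<in> cell N \<omega>" "\<psi> \<in> cell N \<omega>"
      then have "\<phi> \<in> characters" "\<psi> \<in> characters" by (auto simp: cell_def)
      then show "\<bar>\<phi> a - \<psi> a\<bar> < e" using N cell_separated[OF c] by blast
    qed
  qed
  have cauchy: "\<exists>N. \<forall>\<omega>. \<forall>m\<ge>N. \<forall>n\<ge>N. \<bar>cpt m \<omega> a - cpt n \<omega> a\<bar> < e" if e: "e > 0" for a e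
  proof -
    obtain N where N: "\<forall>\<omega>. \<forall>\<phi>\<in>cell N \<omega>. \<forall>\<psi>\<in>cell N \<omega>. \<bar>\<phi> a - \<psi> a\<bar> < e" using ex[OF e] by blast
    show ?thesis
    proof (intro exI[of _ N] allI impI)
      fix \<omega> m n assume mn: "N \<le> m" "N \<le> n"
      show "\<bar>cpt m \<omega> a - cpt n \<omega> a\<bar> < e"
      proof (cases "cell N \<omega> = {}")
        case True
        then show ?thesis using cpt_stable[OF True mn] e by simp
      next
        case False
        then show ?thesis using N cpt_cell[OF mn(1) False] cpt_cell[OF mn(2) False] by blast
      qed
    qed
  qed
  define M where "M a \<omega> = lim (\<lambda>n. cpt n \<omega> a)" for a \<omega>
  have lim: "(\<lambda>n. cpt n \<omega> a) \<longlonglongrightarrow> M a \<omega>" for a \<omega>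
  proof -
    have "Cauchy (\<lambda>n. cpt n \<omega> a)"
      unfolding Cauchy_def dist_real_def using cauchy by blast
    then show ?thesis unfolding M_def using Cauchy_convergent convergent_LIMSEQ_iff by blast
  qed
  have close: "\<bar>x - M a \<omega>\<bar> \<le> e" if "\<forall>n\<ge>N. \<bar>x - cpt n \<omega> a\<bar> < e" for x N a \<omega> e
  proof (rule LIMSEQ_le_const2)
    show "(\<lambda>n. \<bar>x - cpt n \<omega> a\<bar>) \<longlonglongrightarrow> \<bar>x - M a \<omega>\<bar>" by (intro tendsto_intros lim)
    show "\<exists>N. \<forall>n\<ge>N. \<bar>x - cpt n \<omega> a\<bar> \<le> e" using that less_imp_le by blast
  qed
  have uc: "ucyl (M a)" for a
    unfolding ucyl_def
  proof (intro allI impI)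
    fix e :: real assume e: "e > 0"
    then have "e/4 > 0" by simp
    from cauchy[OF this] obtain N where N: "\<forall>\<omega>. \<forall>m\<ge>N. \<forall>n\<ge>N. \<bar>cpt m \<omega> a - cpt n \<omega> a\<bar> < e/4" by blast
    then have c: "\<bar>cpt N \<omega> a - M a \<omega>\<bar> \<le> e/4" for \<omega> using close[of N "cpt N \<omega> a" \<omega> a "e/4"] by blast
    show "\<exists>n. \<forall>\<omega> \<omega>'. (\<forall>i<n. \<omega> i = \<omega>' i) \<longrightarrow> \<bar>M a \<omega> - M a \<omega>'\<bar> < e"
    proof (intro exI[of _ N] allI impI)
      fix \<omega> \<omega>' :: cantor assume "\<forall>i<N. \<omega> i = \<omega>' i"
      then have "cpt N \<omega> = cpt N \<omega>'" by (rule cpt_local)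
      then have "cpt N \<omega> a = cpt N \<omega>' a" by simp
      then show "\<bar>M a \<omega> - M a \<omega>'\<bar> < e" using c[of \<omega>] c[of \<omega>'] e by linarith
    qed
  qed
  define J where "J a = Bcontfun (M a)" for a
  have ap: "apply_bcontfun (J a) = M a" for a unfolding J_def by (rule apply_Bcontfun[OF uc])
  have "bounded_linear J"
    unfolding J_def
  proof (rule bounded_linear_Bcontfun[OF uc, where K=1])
    show "M (a + b) \<omega> = M a \<omega> + M b \<omega>" for a b \<omega>
      using tendsto_add[OF lim[of \<omega> a] lim[of \<omega> b]]
      by (intro LIMSEQ_unique[OF lim]) (simp add: characterD(1)[OF cpt_character])
    show "M (r *\<^sub>R a) \<omega> = r * M a \<omega>" for r a \<omega>
      using tendsto_mult[OF tendsto_const lim[of \<omega> a], of r]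
      by (intro LIMSEQ_unique[OF lim]) (simp add: characterD(2)[OF cpt_character])
    show "\<bar>M a \<omega>\<bar> \<le> 1 * norm a" for a \<omega>
      using tendsto_rabs[OF lim[of \<omega> a]]
      by (rule LIMSEQ_le_const2) (use characterD(4)[OF cpt_character] in auto)
  qed
  moreover have "bern f (J a) = re a" for a
  proof (rule sa_eqI[OF bern_sa re_in_sa])
    fix \<phi> :: "'a \<Rightarrow> real" assume p: "\<phi> \<in> characters"
    have "\<phi> (bern f (J a)) = \<phi> a"
    proof (rule bern_eval[OF p], unfold ap)
      fix e :: real assume e: "e > 0"
      obtain N where N: "\<forall>\<omega>. \<forall>\<phi>\<in>cell N \<omega>. \<forall>\<psi>\<in>cell N \<omega>. \<bar>\<phi> a - \<psi> a\<bar> < e" using ex[OF e] by blast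
      show "\<exists>N. \<forall>n\<ge>N. \<forall>S\<subseteq>{..<n}. \<phi> (weight f n S) \<noteq> 0 \<longrightarrow> \<bar>M a (\<lambda>i. i \<in> S) - \<phi> a\<bar> \<le> e"
      proof (intro exI[of _ N] allI impI)
        fix n S assume S: "N \<le> n" "S \<subseteq> {..<n}" "\<phi> (weight f n S) \<noteq> 0"
        have c: "\<phi> \<in> cell N (\<lambda>i. i \<in> S)"
          using p weight_nonzero[OF p S(3,2)] S(1) by (auto simp: cell_def)
        then have "\<forall>m\<ge>N. \<bar>\<phi> a - cpt m (\<lambda>i. i \<in> S) a\<bar> < e" using N cpt_cell by blast
        from close[OF this] show "\<bar>M a (\<lambda>i. i \<in> S) - \<phi> a\<bar> \<le> e" by (simp add: abs_minus_commute)
      qed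
    qed
    then show "\<phi> (bern f (J a)) = \<phi> (re a)" by (simp add: characterD(3)[OF p])
  qed
  ultimately show ?thesis by blast
qed

end

section \<open>Separating sequences from separability\<close>

lemma dense_sequence:
  assumes "separable_space (euclidean :: 'a::abelian_unital_cstar_algebra topology)"
  shows "\<exists>d :: nat \<Rightarrow> 'a. \<forall>a. \<forall>e>0. \<exists>i. norm (d i - a) < e"
proof -
  obtain C :: "'a set" where C: "countable C" "closure C = UNIV"
    using assms by (auto simp: separable_space_def)
  then have "C \<noteq> {}" by auto
  then have r: "range (from_nat_into C) = C" using C(1) by (rule range_from_nat_into)
  have "\<exists>i. norm (from_nat_into C i - a) < e" if e: "e > 0" for a e
  proof -
    have "a \<in> closure C" using C(2) by simp
    then obtain y where "y \<in> C" "dist y a < e" using e unfolding closure_approachable by blast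
    then show ?thesis using r by (metis dist_norm imageE)
  qed
  then show ?thesis by blast
qed

text \<open>The functions are ramps: m times a member of a dense sequence, minus an integer k,
  clamped to the unit interval. If m times that member takes values at least 2 apart at two
  characters, an interval from some integer to the next lies between the values, and the ramp of
  this integer goes from 0 to 1.\<close>

lemma separating_sequence:
  assumes "separable_space (euclidean :: 'a::abelian_unital_cstar_algebra topology)"
  shows "\<exists>f :: nat \<Rightarrow> 'a. unit_seq f \<and> sep_seq f"
proof -
  obtain d :: "nat \<Rightarrow> 'a" where d: "\<And>a e. e > 0 \<Longrightarrow> \<exists>i. norm (d i - a) < e"
    using dense_sequence[OF assms] by blast
  define clamp where "clamp t = max 0 (min 1 t)" for t :: real
  define h where "h = (\<lambda>(i::nat, k::int, m::nat). gel (\<lambda>\<phi>. clamp (real m * \<phi> (d i) - of_int k)))"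
  have cont: "continuous_on characters (\<lambda>\<phi>. clamp (real m * \<phi> (d i) - of_int k))" for i k m
    unfolding clamp_def by (intro continuous_intros continuous_on_evaluation)
  have h: "h (i, k, m) \<in> sa" "\<phi> \<in> characters \<Longrightarrow> \<phi> (h (i, k, m)) = clamp (real m * \<phi> (d i) - of_int k)" for i k m \<phi>
    unfolding h_def using gel_in_sa[OF cont] gel_eval[OF cont] by auto
  define f where "f n = h (from_nat n)" for n
  have fh: "f (to_nat x) = h x" for x by (simp add: f_def)
  have "unit_seq f"
    unfolding unit_seq_def
  proof
    fix n
    obtain i k m where "(from_nat n :: nat \<times> int \<times> nat) = (i, k, m)" by (cases "from_nat n :: nat \<times> int \<times> nat")
    then have fn: "f n = h (i, k, m)" by (simp add: f_def)
    show "f n \<in> sa \<and> (\<forall>\<phi>\<in>characters. 0 \<le> \<phi> (f n) \<and> \<phi> (f n) \<le> 1)"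
      unfolding fn by (intro conjI ballI h(1)) (simp_all only: h(2), simp_all add: clamp_def)
  qed
  moreover have "sep_seq f"
    unfolding sep_seq_def
  proof (intro allI impI)
    fix a :: 'a and e :: real assume e: "e > 0"
    obtain i where i: "norm (d i - a) < e / 4" using d[of "e/4" a] e by auto
    \<comment> \<open>Characters that no ramp separates differ by less than 2 / m at
      \<open>d i\<close>; replacing \<open>a\<close> by \<open>d i\<close> at both of them costs e /
      4 each.\<close>
    obtain m :: nat where m: "m > 0" "2 / real m < e / 4"
    proof -
      obtain m :: nat where m: "8 / e < real m" using reals_Archimedean2 by blast
      have "0 < 8 / e" using e by simp
      then have "0 < real m" using m by linarith
      then show ?thesis using m e that[of m] by (simp add: field_simps)
    qed
    \<comment> \<open>A bound for the integers obtained by rounding up values of m times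
      \<open>d i\<close>, so that finitely many ramps decide.\<close>
    define B where "B = \<lceil>real m * norm (d i)\<rceil> + 1"
    obtain N where N: "\<And>k. k \<in> {- B..B} \<Longrightarrow> to_nat (i, k, m) < N"
    proof -
      have "finite ((\<lambda>k. to_nat (i, k, m)) ` {- B..B})" by simp
      then obtain N where "\<forall>n\<in>(\<lambda>k. to_nat (i, k, m)) ` {- B..B}. n < N"
        unfolding finite_nat_set_iff_bounded ..
      then show ?thesis using that by blast
    qed
    have half: "real m * \<phi> (d i) - real m * \<psi> (d i) < 2"
      if p: "\<phi> \<in> characters" "\<psi> \<in> characters" and s: "\<forall>i<N. \<not> (\<psi> (f i) = 0 \<and> \<phi> (f i) = 1)" for \<phi> \<psi>
    proof (rule ccontr)
      let ?x = "real m * \<phi> (d i)" and ?y = "real m * \<psi> (d i)"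
      assume "\<not> ?x - ?y < 2"
      then have xy: "?x - ?y \<ge> 2" by simp
      have "\<bar>?y\<bar> \<le> real m * norm (d i)"
        using characterD(4)[OF p(2), of "d i"] by (simp add: abs_mult mult_left_mono)
      then have "\<lceil>?y\<rceil> \<in> {- B..B}" unfolding B_def by simp linarith
      then have "to_nat (i, \<lceil>?y\<rceil>, m) < N" by (rule N)
      moreover have "\<psi> (f (to_nat (i, \<lceil>?y\<rceil>, m))) = 0"
      proof -
        have "?y - of_int \<lceil>?y\<rceil> \<le> 0" by linarith
        then have "clamp (?y - of_int \<lceil>?y\<rceil>) = 0" unfolding clamp_def by linarith
        then show ?thesis using p by (simp add: fh h)
      qed
      moreover have "\<phi> (f (to_nat (i, \<lceil>?y\<rceil>, m))) = 1"
      proof -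
        have "?x - of_int \<lceil>?y\<rceil> \<ge> 1" using xy by linarith
        then show ?thesis using p by (simp add: fh h clamp_def)
      qed
      ultimately show False using s by blast
    qed
    have "\<bar>\<phi> a - \<psi> a\<bar> < e" if p: "\<phi> \<in> characters" "\<psi> \<in> characters"
      and s: "\<forall>i<N. \<not> (\<phi> (f i) = 0 \<and> \<psi> (f i) = 1) \<and> \<not> (\<phi> (f i) = 1 \<and> \<psi> (f i) = 0)" for \<phi> \<psi>
    proof -
      have "real m * \<bar>\<phi> (d i) - \<psi> (d i)\<bar> < 2"
        using half[OF p] half[OF p(2,1)] s by (cases "\<phi> (d i) \<ge> \<psi> (d i)") (auto simp: right_diff_distrib)
      then have "\<bar>\<phi> (d i) - \<psi> (d i)\<bar> < 2 / real m" using m(1) by (simp add: field_simps)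
      moreover have "\<bar>\<phi> (d i) - \<phi> a\<bar> < e/4" "\<bar>\<psi> (d i) - \<psi> a\<bar> < e/4"
        using characterD(4)[OF p(1), of "d i - a"] characterD(4)[OF p(2), of "d i - a"] i
        by (simp_all add: characterD(8)[OF p(1)] characterD(8)[OF p(2)])
      ultimately show ?thesis using m(2) e by linarith
    qed
    then show "\<exists>N. \<forall>\<phi>\<in>characters. \<forall>\<psi>\<in>characters.
       (\<forall>i<N. \<not> (\<phi> (f i) = 0 \<and> \<psi> (f i) = 1) \<and> \<not> (\<phi> (f i) = 1 \<and> \<psi> (f i) = 0)) \<longrightarrow> \<bar>\<phi> a - \<psi> a\<bar> < e"
      by (intro exI[of _ N] ballI impI)
  qed
  ultimately show ?thesis by blast
qed

section \<open>Cantor sets in the character space\<close>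

lemma Hausdorff_space_t2: "Hausdorff_space (euclidean :: 'a::t2_space topology)"
  unfolding Hausdorff_space_def disjnt_def open_openin[symmetric] using hausdorff by blast

lemma urysohn_characters:
  assumes A: "compact A" "A \<subseteq> characters" and B: "compact B" "B \<subseteq> characters" and disj: "A \<inter> B = {}"
  shows "\<exists>c::'a::abelian_unital_cstar_algebra. c \<in> sa \<and> (\<forall>\<phi>\<in>characters. 0 \<le> \<phi> c \<and> \<phi> c \<le> 1) \<and>
    (\<forall>\<phi>\<in>A. \<phi> c = 0) \<and> (\<forall>\<phi>\<in>B. \<phi> c = 1)"
proof -
  let ?X = "top_of_set (characters :: ('a \<Rightarrow> real) set)"
  have "compact_space ?X" using compact_characters by (intro compact_space_subtopology) simp
  then have "normal_space ?X"
    by (rule compact_Hausdorff_or_regular_imp_normal_space)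
       (simp add: Hausdorff_space_subtopology Hausdorff_space_t2)
  moreover have "closedin ?X A" "closedin ?X B"
    using A B by (auto intro!: closed_subset compact_imp_closed)
  ultimately have "\<exists>f. continuous_map ?X (top_of_set {0..1::real}) f \<and> f ` A \<subseteq> {0} \<and> f ` B \<subseteq> {1}"
    using disj by (simp add: normal_space_iff_Urysohn disjnt_def)
  then obtain f where f: "continuous_map ?X (top_of_set {0..1::real}) f" "f ` A \<subseteq> {0}" "f ` B \<subseteq> {1}"
    by blast
  have cont: "continuous_on characters f" and im: "f ` characters \<subseteq> {0..1}"
    using f(1) by (auto simp: continuous_map_in_subtopology image_subset_iff)
  show ?thesis
  proof (intro exI[of _ "gel f"] conjI ballI)
    show "gel f \<in> sa" by (rule gel_in_sa[OF cont])
  qed (use A(2) B(2) f(2,3) im in \<open>auto simp: gel_eval[OF cont] subset_iff image_subset_iff\<close>)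
qed

text \<open>A box is given by its centre, the finitely many coordinates that it restricts, and its radius.\<close>

type_synonym 'a box_data = "('a \<Rightarrow> real) \<times> 'a set \<times> real"

definition box_of :: "('a \<Rightarrow> real) set \<Rightarrow> 'a box_data \<Rightarrow> ('a \<Rightarrow> real) set" where
  "box_of X N = {\<phi>\<in>X. \<forall>i\<in>fst (snd N). \<bar>\<phi> i - fst N i\<bar> \<le> snd (snd N)}"

definition valid_box :: "('a \<Rightarrow> real) set \<Rightarrow> 'a box_data \<Rightarrow> bool" where
  "valid_box X N \<longleftrightarrow> fst N \<in> X \<and> finite (fst (snd N)) \<and> snd (snd N) > 0"

text \<open>An isolated point would form a clopen subset, which connectedness excludes once there
  are two points.\<close>

lemma perfect_connected:
  fixes X :: "('a \<Rightarrow> real) set"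
  assumes conn: "connected X" and x: "x \<in> X" and y: "y \<in> X" "y \<noteq> z" "z \<in> X" and I: "finite I" and e: "e > 0"
  shows "\<exists>x'\<in>X. x' \<noteq> x \<and> (\<forall>i\<in>I. \<bar>x' i - x i\<bar> < e)"
proof (rule ccontr)
  assume n: "\<not> ?thesis"
  let ?O = "\<Inter>i\<in>I. {\<phi>. \<bar>\<phi> i - x i\<bar> < e}"
  have "open ?O"
    by (intro open_INT ballI open_Collect_less continuous_intros continuous_on_evaluation I)
  moreover have "X \<inter> ?O = {x}"
  proof
    show "{x} \<subseteq> X \<inter> ?O" using x e by auto
    show "X \<inter> ?O \<subseteq> {x}"
    proof
      fix \<phi> assume p: "\<phi> \<in> X \<inter> ?O"
      then have "\<forall>i\<in>I. \<bar>\<phi> i - x i\<bar> < e" by simp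
      then show "\<phi> \<in> {x}" using n p by blast
    qed
  qed
  ultimately have "openin (top_of_set X) {x}" using openin_open_Int[of ?O X] by simp
  moreover have "closedin (top_of_set X) {x}" using x by (intro closed_subset) auto
  ultimately have "{x} = X" using conn unfolding connected_clopen by blast
  then show False using y by blast
qed

lemma box_split:
  fixes X :: "('a::abelian_unital_cstar_algebra \<Rightarrow> real) set" and d :: "nat \<Rightarrow> 'a"
  assumes X: "connected X" "X \<subseteq> characters" and y: "y \<in> X" "z \<in> X" "y \<noteq> z" and N: "valid_box X N"
  shows "\<exists>M0 M1. (\<forall>M\<in>{M0, M1}. valid_box X M \<and> box_of X M \<subseteq> box_of X N \<and>
      (\<forall>\<phi>\<in>box_of X M. \<forall>\<psi>\<in>box_of X M. \<forall>k\<le>n. \<bar>\<phi> (d k) - \<psi> (d k)\<bar> \<le> 2 / real (Suc n))) \<and>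
    box_of X M0 \<inter> box_of X M1 = {}"
proof -
  obtain x I e where Ne: "N = (x, I, e)" by (cases N)
  have v: "x \<in> X" "finite I" "e > 0" using N by (auto simp: valid_box_def Ne)
  obtain x' where x': "x' \<in> X" "x' \<noteq> x" "\<forall>i\<in>I. \<bar>x' i - x i\<bar> < e / 2"
    using perfect_connected[OF X(1) v(1) y(1,3,2) v(2), of "e/2"] v(3) by auto
  obtain a where a: "x' a \<noteq> x a" using x'(2) by blast
  define I' where "I' = insert a (I \<union> d ` {..n})"
  \<comment> \<open>The first bound keeps a child inside its parent, as its centre is off by less
    than e / 2; the second makes it small at \<open>d 0\<close> to \<open>d n\<close>; a third of
    the gap at \<open>a\<close> separates the two children.\<close>
  define e' where "e' = min (e/2) (min (1 / real (Suc n)) (\<bar>x' a - x a\<bar> / 3))"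
  have e': "e' > 0" "e' \<le> e/2" "e' \<le> 1 / real (Suc n)" "e' \<le> \<bar>x' a - x a\<bar> / 3"
  proof -
    show "e' \<le> \<bar>x' a - x a\<bar> / 3" unfolding e'_def by linarith
  qed (use v(3) a in \<open>auto simp: e'_def\<close>)
  have I': "finite I'" "a \<in> I'" "I \<subseteq> I'" "\<And>k. k \<le> n \<Longrightarrow> d k \<in> I'" using v(2) by (auto simp: I'_def)
  have child: "valid_box X (c, I', e') \<and> box_of X (c, I', e') \<subseteq> box_of X N \<and>
      (\<forall>\<phi>\<in>box_of X (c, I', e'). \<forall>\<psi>\<in>box_of X (c, I', e'). \<forall>k\<le>n. \<bar>\<phi> (d k) - \<psi> (d k)\<bar> \<le> 2 / real (Suc n))"
    if c: "c \<in> X" "\<forall>i\<in>I. \<bar>c i - x i\<bar> < e / 2" for c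
  proof (intro conjI ballI allI impI)
    show "valid_box X (c, I', e')" using c e' I' by (simp add: valid_box_def)
    show "box_of X (c, I', e') \<subseteq> box_of X N"
    proof
      fix \<phi> assume p: "\<phi> \<in> box_of X (c, I', e')"
      have "\<bar>\<phi> i - x i\<bar> \<le> e" if i: "i \<in> I" for i
      proof -
        have "\<bar>\<phi> i - c i\<bar> \<le> e'" using p i I'(3) by (auto simp: box_of_def)
        moreover have "\<bar>c i - x i\<bar> < e / 2" using c(2) i by blast
        ultimately show ?thesis using e'(2) by linarith
      qed
      then show "\<phi> \<in> box_of X N" using p by (simp add: box_of_def Ne)
    qed
    fix \<phi> \<psi> k assume p: "\<phi> \<in> box_of X (c, I', e')" "\<psi> \<in> box_of X (c, I', e')" "k \<le> n"
    have "\<bar>\<phi> (d k) - c (d k)\<bar> \<le> e'" "\<bar>\<psi> (d k) - c (d k)\<bar> \<le> e'"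
      using p I'(4) by (auto simp: box_of_def)
    then have "\<bar>\<phi> (d k) - \<psi> (d k)\<bar> \<le> 2 * (1 / real (Suc n))" using e'(3) by linarith
    then show "\<bar>\<phi> (d k) - \<psi> (d k)\<bar> \<le> 2 / real (Suc n)" by simp
  qed
  have "box_of X (x, I', e') \<inter> box_of X (x', I', e') = {}"
  proof (rule ccontr)
    assume "\<not> ?thesis"
    then obtain \<phi> where "\<phi> \<in> box_of X (x, I', e')" "\<phi> \<in> box_of X (x', I', e')" by blast
    then have "\<bar>\<phi> a - x a\<bar> \<le> e'" "\<bar>\<phi> a - x' a\<bar> \<le> e'" using I'(2) by (auto simp: box_of_def)
    then have "\<bar>x' a - x a\<bar> \<le> 2 * e'" by linarith
    moreover have "\<bar>x' a - x a\<bar> > 0" using a by simp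
    ultimately show False using e'(4) by simp
  qed
  moreover have "\<forall>i\<in>I. \<bar>x i - x i\<bar> < e / 2" using v(3) by simp
  ultimately show ?thesis
    using child[OF v(1)] child[OF x'(1,3)] by (intro exI[of _ "(x, I', e')"] exI[of _ "(x', I', e')"]) simp
qed

text \<open>The nested boxes along \<omega> have a common point by compactness, and disjoint
  siblings make the map injective. The boxes are made small only at members of the dense sequence,
  which suffices for continuity because characters are 1-Lipschitz. The point y is avoided because
  it will be a base point, where functions have to vanish.\<close>

lemma cantor_scheme:
  fixes X :: "('a::abelian_unital_cstar_algebra \<Rightarrow> real) set" and d :: "nat \<Rightarrow> 'a"
  assumes X: "connected X" "closed X" "X \<subseteq> characters" and y: "y \<in> X" "z \<in> X" "y \<noteq> z"
    and d: "\<And>a e. e > 0 \<Longrightarrow> \<exists>i. norm (d i - a) < e"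
  shows "\<exists>s. (\<forall>\<omega>::cantor. s \<omega> \<in> X \<and> s \<omega> \<noteq> y) \<and> inj s \<and> (\<forall>a. ucyl (\<lambda>\<omega>. s \<omega> a))"
proof -
  let ?B = "box_of X"
  define good where "good N n M \<longleftrightarrow> valid_box X M \<and> ?B M \<subseteq> ?B N \<and>
      (\<forall>\<phi>\<in>?B M. \<forall>\<psi>\<in>?B M. \<forall>k\<le>n. \<bar>\<phi> (d k) - \<psi> (d k)\<bar> \<le> 2 / real (Suc n))" for N n M
  have "\<exists>c. valid_box X N \<longrightarrow> (good N n (c False) \<and> good N n (c True) \<and> ?B (c False) \<inter> ?B (c True) = {})" for N n
  proof (cases "valid_box X N")
    case True
    from box_split[OF X(1,3) y this, of n d] obtain M0 M1 where
      "good N n M0" "good N n M1" "?B M0 \<inter> ?B M1 = {}" by (auto simp: good_def)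
    then show ?thesis by (intro exI[of _ "\<lambda>b. if b then M1 else M0"]) simp
  qed simp
  then have "\<exists>c. \<forall>N n. valid_box X N \<longrightarrow>
      good N n (c N n False) \<and> good N n (c N n True) \<and> ?B (c N n False) \<inter> ?B (c N n True) = {}"
    by (intro choice allI)
  then obtain c where c: "\<And>N n. valid_box X N \<Longrightarrow>
      good N n (c N n False) \<and> good N n (c N n True) \<and> ?B (c N n False) \<inter> ?B (c N n True) = {}" by blast
  obtain a0 where a0: "z a0 \<noteq> y a0" using y(3) by (metis ext)
  \<comment> \<open>A radius of half the gap at \<open>a0\<close> around z excludes y.\<close>
  define N0 where "N0 = (z, {a0}, \<bar>z a0 - y a0\<bar> / 2)"
  have N0: "valid_box X N0" "y \<notin> ?B N0"
    using y a0 by (auto simp: N0_def valid_box_def box_of_def abs_minus_commute[of "y a0"])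
  define T where "T \<omega> = rec_nat N0 (\<lambda>n N. c N n (\<omega> n))" for \<omega> :: cantor
  have T: "T \<omega> 0 = N0" "T \<omega> (Suc n) = c (T \<omega> n) n (\<omega> n)" for \<omega> n by (simp_all add: T_def)
  have vT: "valid_box X (T \<omega> n)" for \<omega> n
  proof (induction n)
    case (Suc n)
    then show ?case using c[OF Suc, of n] by (cases "\<omega> n") (auto simp: T good_def)
  qed (simp add: T N0)
  have gT: "good (T \<omega> n) n (T \<omega> (Suc n))" for \<omega> n
    using c[OF vT, of \<omega> n n] by (cases "\<omega> n") (auto simp: T)
  have mono: "?B (T \<omega> n) \<subseteq> ?B (T \<omega> m)" if "m \<le> n" for \<omega> m n
    using that by (induction n rule: dec_induct) (use gT in \<open>auto simp: good_def\<close>)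
  have loc: "T \<omega> n = T \<omega>' n" if "\<forall>i<n. \<omega> i = \<omega>' i" for \<omega> \<omega>' n
    using that by (induction n) (auto simp: T)
  have closedB: "closed (?B N)" for N
  proof -
    have "?B N = X \<inter> (\<Inter>i\<in>fst (snd N). {\<phi>. \<bar>\<phi> i - fst N i\<bar> \<le> snd (snd N)})"
      by (auto simp: box_of_def)
    moreover have "closed (\<Inter>i\<in>fst (snd N). {\<phi>. \<bar>\<phi> i - fst N i\<bar> \<le> snd (snd N)})"
      by (intro closed_INT ballI closed_Collect_le continuous_intros continuous_on_evaluation)
    ultimately show ?thesis using X(2) by (simp add: closed_Int)
  qed
  have "\<exists>\<phi>. \<forall>n. \<phi> \<in> ?B (T \<omega> n)" for \<omega>
  proof -
    have "characters \<inter> (\<Inter>n\<in>UNIV. ?B (T \<omega> n)) \<noteq> {}"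
    proof (rule compact_imp_fip_image[OF compact_characters closedB])
      fix I' :: "nat set" assume "finite I'"
      then obtain n where n: "\<forall>i\<in>I'. i \<le> n" unfolding finite_nat_set_iff_bounded_le ..
      have "fst (T \<omega> n) \<in> ?B (T \<omega> n)" using vT[of \<omega> n] by (auto simp: valid_box_def box_of_def)
      moreover have "?B (T \<omega> n) \<subseteq> characters" using X(3) by (auto simp: box_of_def)
      ultimately have "fst (T \<omega> n) \<in> characters \<inter> (\<Inter>i\<in>I'. ?B (T \<omega> i))" using mono[of _ n] n by auto
      then show "characters \<inter> (\<Inter>i\<in>I'. ?B (T \<omega> i)) \<noteq> {}" by blast
    qed
    then show ?thesis by blast
  qed
  then obtain s where s: "\<And>\<omega> n. s \<omega> \<in> ?B (T \<omega> n)" by metis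
  have sX: "s \<omega> \<in> X" for \<omega> using s[of \<omega> 0] by (simp add: box_of_def)
  have "s \<omega> \<noteq> y" for \<omega> using s[of \<omega> 0] N0(2) by (auto simp: T)
  moreover have "inj s"
  proof (rule injI, rule ccontr)
    fix \<omega> \<omega>' assume eq: "s \<omega> = s \<omega>'" and ne: "\<omega> \<noteq> \<omega>'"
    define n where "n = (LEAST n. \<omega> n \<noteq> \<omega>' n)"
    have ex: "\<exists>n. \<omega> n \<noteq> \<omega>' n" using ne by auto
    have n: "\<omega> n \<noteq> \<omega>' n" "\<forall>i<n. \<omega> i = \<omega>' i"
      unfolding n_def using LeastI_ex[OF ex] not_less_Least by auto
    have "s \<omega> \<in> ?B (c (T \<omega> n) n (\<omega> n))" "s \<omega>' \<in> ?B (c (T \<omega> n) n (\<omega>' n))"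
      using s[of \<omega> "Suc n"] s[of \<omega>' "Suc n"] loc[OF n(2)] by (simp_all add: T)
    then show False using c[OF vT, of \<omega> n n] n(1) eq by (cases "\<omega> n"; cases "\<omega>' n") auto
  qed
  moreover have "ucyl (\<lambda>\<omega>. s \<omega> a)" for a
    unfolding ucyl_def
  proof (intro allI impI)
    fix e :: real assume e: "e > 0"
    obtain k where k: "norm (d k - a) < e / 4" using d[of "e/4" a] e by auto
    obtain m :: nat where m: "2 / real (Suc m) < e / 4"
    proof -
      obtain m :: nat where "8 / e < real m" using reals_Archimedean2 by blast
      then have "2 / real (Suc m) < e / 4" using e by (simp add: field_simps)
      then show ?thesis using that by blast
    qed
    define n where "n = max k m"
    have "2 / real (Suc n) \<le> 2 / real (Suc m)" by (intro divide_left_mono) (auto simp: n_def)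
    then have n: "k \<le> n" "2 / real (Suc n) < e / 4" using m by (auto simp: n_def)
    show "\<exists>n. \<forall>\<omega> \<omega>'. (\<forall>i<n. \<omega> i = \<omega>' i) \<longrightarrow> \<bar>s \<omega> a - s \<omega>' a\<bar> < e"
    proof (intro exI[of _ "Suc n"] allI impI)
      fix \<omega> \<omega>' :: cantor assume eq: "\<forall>i<Suc n. \<omega> i = \<omega>' i"
      have "s \<omega> \<in> ?B (T \<omega> (Suc n))" "s \<omega>' \<in> ?B (T \<omega> (Suc n))"
        using s[of \<omega> "Suc n"] s[of \<omega>' "Suc n"] loc[OF eq] by simp_all
      then have "\<bar>s \<omega> (d k) - s \<omega>' (d k)\<bar> < e / 4"
        using gT[of \<omega> n] n unfolding good_def by fastforce
      moreover have *: "\<bar>s \<omega> (d k) - s \<omega> a\<bar> < e / 4" for \<omega>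
      proof -
        have "s \<omega> \<in> characters" using sX X(3) by blast
        then show ?thesis using characterD(4)[of "s \<omega>" "d k - a"] k by (simp add: characterD(8))
      qed
      ultimately show "\<bar>s \<omega> a - s \<omega>' a\<bar> < e" using e *[of \<omega>] *[of \<omega>'] by linarith
    qed
  qed
  ultimately show ?thesis using sX by blast
qed

text \<open>Each \<open>f n\<close> tells apart the two parts of the Cantor set given by the n-th
  coordinate, so \<open>bern f\<close> extends functions from it. The cut-off \<open>c\<close> makes
  the extension vanish at the base points without changing it on the Cantor set.\<close>

lemma cantor_sharp_sequence:
  fixes F :: "('a::abelian_unital_cstar_algebra \<Rightarrow> real) set"
  assumes sep: "separable_space (euclidean :: 'a topology)" and F: "rep_set F"
    and y: "y \<in> F" and z: "z \<in> ccomp y" "z \<noteq> y"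
  shows "\<exists>s f c. (\<forall>\<omega>::cantor. s \<omega> \<in> characters) \<and> (\<forall>a. ucyl (\<lambda>\<omega>. s \<omega> a)) \<and> unit_seq f \<and>
    (\<forall>\<omega> n. s \<omega> (f n) = (if \<omega> n then 1 else 0)) \<and> c \<in> sa \<and> (\<forall>\<omega>. s \<omega> c = 1) \<and> (\<forall>\<psi>\<in>F. \<psi> c = 0)"
proof -
  obtain d :: "nat \<Rightarrow> 'a" where d: "\<And>a e. e > 0 \<Longrightarrow> \<exists>i. norm (d i - a) < e"
    using dense_sequence[OF sep] by blast
  have sub: "ccomp y \<subseteq> characters" by (auto simp: ccomp_def)
  have "y \<noteq> z" using z(2) by simp
  from cantor_scheme[OF ccomp_connected[OF F y] closed_ccomp sub rep_set_D(5)[OF F y] z(1) this d]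
  obtain s where s: "\<And>\<omega>::cantor. s \<omega> \<in> ccomp y" "\<And>\<omega>. s \<omega> \<noteq> y" "inj s" "\<And>a. ucyl (\<lambda>\<omega>. s \<omega> a)"
    by blast
  have sc: "s \<omega> \<in> characters" for \<omega> using s(1) sub by blast
  have "continuous_on UNIV s"
  proof (rule continuous_on_coordinatewise_then_product)
    show "continuous_on UNIV (\<lambda>\<omega>. s \<omega> a)" for a
      using ucyl_bcontfun[OF s(4)[of a]] by (simp add: bcontfun_def)
  qed
  then have comp: "compact (s ` {\<omega>. \<omega> n = b})" and comp': "compact (range s)" for n b
  proof -
    have "open {\<omega>::cantor. \<omega> n \<noteq> b}"
      using open_coordinate_vimage[OF open_discrete, of n "{\<not> b}"] by (simp add: vimage_def)
    then have "closed {\<omega>::cantor. \<omega> n = b}" by (simp add: closed_def Compl_eq)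
    then have "compact {\<omega>::cantor. \<omega> n = b}" using compact_Int_closed[OF compact_cantor] by simp
    then show "compact (s ` {\<omega>. \<omega> n = b})"
      using \<open>continuous_on UNIV s\<close> by (meson compact_continuous_image continuous_on_subset subset_UNIV)
    show "compact (range s)" by (rule compact_continuous_image[OF \<open>continuous_on UNIV s\<close> compact_cantor])
  qed
  have "\<exists>f. f \<in> sa \<and> (\<forall>\<phi>\<in>characters. 0 \<le> \<phi> f \<and> \<phi> f \<le> 1) \<and>
      (\<forall>\<phi>\<in>s ` {\<omega>. \<omega> n = False}. \<phi> f = 0) \<and> (\<forall>\<phi>\<in>s ` {\<omega>. \<omega> n = True}. \<phi> f = 1)" for n
  proof (rule urysohn_characters[OF comp _ comp])
    show "s ` {\<omega>. \<omega> n = False} \<inter> s ` {\<omega>. \<omega> n = True} = {}"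
      using injD[OF s(3)] by (auto dest!: injD[OF s(3)])
  qed (use sc in auto)
  then obtain f where f: "\<And>n. f n \<in> sa" "\<And>n \<phi>. \<phi> \<in> characters \<Longrightarrow> 0 \<le> \<phi> (f n) \<and> \<phi> (f n) \<le> 1"
    "\<And>n \<omega>. \<not> \<omega> n \<Longrightarrow> s \<omega> (f n) = 0" "\<And>n \<omega>. \<omega> n \<Longrightarrow> s \<omega> (f n) = 1"
    by (auto simp: image_iff Ball_def) metis
  have "\<exists>c. c \<in> sa \<and> (\<forall>\<phi>\<in>characters. 0 \<le> \<phi> c \<and> \<phi> c \<le> 1) \<and> (\<forall>\<phi>\<in>F. \<phi> c = 0) \<and> (\<forall>\<phi>\<in>range s. \<phi> c = 1)"
  proof (rule urysohn_characters[OF _ _ comp'])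
    show "compact F" using rep_set_D(1)[OF F] by (rule finite_imp_compact)
    show "F \<subseteq> characters" using rep_set_D(2)[OF F] by blast
    show "F \<inter> range s = {}"
    proof (rule ccontr)
      assume "F \<inter> range s \<noteq> {}"
      then obtain \<omega> where w: "s \<omega> \<in> F" by blast
      then have "s \<omega> = y" using rep_set_D(4)[OF F w y rep_set_D(5)[OF F w] s(1)] by simp
      then show False using s(2) by blast
    qed
  qed (use sc in auto)
  then obtain c where c: "c \<in> sa" "\<forall>\<phi>\<in>F. \<phi> c = 0" "\<forall>\<phi>\<in>range s. \<phi> c = 1" by blast
  have u: "unit_seq f" unfolding unit_seq_def using f(1,2) by simp
  show ?thesis
    by (intro exI[of _ s] exI[of _ f] exI[of _ c]) (use sc s(4) u f(3,4) c in auto)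
qed

text \<open>Subtracting the locally constant function with the same values at the base points gives
  a projection onto the self-adjoint elements that vanish there.\<close>

definition compl_proj :: "('a::abelian_unital_cstar_algebra \<Rightarrow> real) set \<Rightarrow> 'a \<Rightarrow> 'a" where
  "compl_proj F a = re a - (\<Sum>\<psi>\<in>F. \<psi> a *\<^sub>R proj \<psi>)"

lemma bounded_linear_character: "\<phi> \<in> characters \<Longrightarrow> bounded_linear \<phi>"
  by (rule bounded_linear_intro[where K=1]) (simp_all add: characterD)

lemma bounded_linear_compl_proj:
  assumes "rep_set F" shows "bounded_linear (compl_proj F)"
  unfolding compl_proj_def
  by (intro bounded_linear_sub bounded_linear_re bounded_linear_sum bounded_linear_scaleR_const
      bounded_linear_character rep_set_D(2)[OF assms])

lemma compl_proj_sa: "rep_set F \<Longrightarrow> compl_proj F a \<in> sa"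
  unfolding compl_proj_def by (intro sa_diff re_in_sa sa_sum sa_scaleR proj_sa)

lemma compl_proj_eval:
  assumes F: "rep_set F" and p: "\<phi> \<in> F"
  shows "\<phi> (compl_proj F a) = 0"
proof -
  have c: "\<phi> \<in> characters" by (rule rep_set_D(2)[OF F p])
  have "\<phi> (\<Sum>\<psi>\<in>F. \<psi> a *\<^sub>R proj \<psi>) = (\<Sum>\<psi>\<in>F. if \<phi> = \<psi> then \<psi> a else 0)"
    unfolding character_sum[OF c]
    by (intro sum.cong refl) (simp add: characterD(2)[OF c] proj_eval_rep[OF F _ p])
  also have "\<dots> = \<phi> a" using p rep_set_D(1)[OF F] by simp
  finally show ?thesis by (simp add: compl_proj_def characterD(3,8)[OF c])
qed

lemma compl_proj_id:
  assumes "a \<in> sa" "\<And>\<phi>. \<phi> \<in> F \<Longrightarrow> \<phi> a = 0"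
  shows "compl_proj F a = a"
proof -
  have "(\<Sum>\<psi>\<in>F. \<psi> a *\<^sub>R proj \<psi>) = 0" by (rule sum.neutral) (simp add: assms(2))
  then show ?thesis by (simp add: compl_proj_def re_sa assms(1))
qed

text \<open>Otherwise the base points are the only characters, and the finitely many projections
  span the algebra.\<close>

lemma nontrivial_component:
  fixes F :: "('a::abelian_unital_cstar_algebra \<Rightarrow> real) set"
  assumes inf: "infinite_dimensional TYPE('a)" and F: "rep_set F"
  shows "\<exists>y\<in>F. \<exists>z\<in>ccomp y. z \<noteq> y"
proof (rule ccontr)
  assume n: "\<not> ?thesis"
  have X: "characters \<subseteq> F"
  proof
    fix \<phi> :: "'a \<Rightarrow> real" assume "\<phi> \<in> characters"
    from rep_set_D(3)[OF F this] obtain y where y: "y \<in> F" "\<phi> \<in> ccomp y" ..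
    have "\<forall>y\<in>F. \<forall>z\<in>ccomp y. z = y" using n by simp
    with y have "\<phi> = y" by simp
    then show "\<phi> \<in> F" using y(1) by simp
  qed
  interpret vector_space "scaleC :: complex \<Rightarrow> 'a \<Rightarrow> 'a" by (rule vector_space_scaleC)
  have sa: "a \<in> span (proj ` F)" if "a \<in> sa" for a
  proof -
    have "compl_proj F a = 0"
    proof (rule sa_eqI[OF compl_proj_sa[OF F] sa_0])
      fix \<phi> :: "'a \<Rightarrow> real" assume p: "\<phi> \<in> characters"
      then have "\<phi> \<in> F" using X by blast
      then show "\<phi> (compl_proj F a) = \<phi> 0" by (simp add: compl_proj_eval[OF F] characterD(10)[OF p])
    qed
    then have "a = (\<Sum>\<psi>\<in>F. complex_of_real (\<psi> a) *\<^sub>C proj \<psi>)"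
      using that by (simp add: compl_proj_def re_sa scaleC_of_real)
    also have "\<dots> \<in> span (proj ` F)" by (intro span_sum span_scale span_base imageI)
    finally show ?thesis .
  qed
  have "x \<in> span (proj ` F)" for x
    using span_add[OF sa[OF re_in_sa[of x]] span_scale[OF sa[OF im_in_sa[of x]], of \<i>]]
    by (simp add: re_im_decomp)
  then have "span (proj ` F) = UNIV" by blast
  then show False using inf rep_set_D(1)[OF F] unfolding infinite_dimensional_def by blast
qed

text \<open>The decomposition method with \<open>compl_proj F\<close> as the projection: the
  complement sits in \<open>cfun\<close> by Milutin's averaging, and \<open>cfun\<close> sits in the
  complement by extension from a Cantor set, with restriction as left inverse.\<close>

lemma complement_iso_cfun:
  fixes F :: "('a::abelian_unital_cstar_algebra \<Rightarrow> real) set"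
  assumes sep: "separable_space (euclidean :: 'a topology)" and inf: "infinite_dimensional TYPE('a)"
    and F: "rep_set F"
  shows "\<exists>(\<Phi> :: 'a \<Rightarrow> cfun) \<Psi>. bounded_linear \<Phi> \<and> bounded_linear \<Psi> \<and>
    (\<forall>a. \<Psi> (\<Phi> a) = compl_proj F a) \<and> (\<forall>f. \<Phi> (\<Psi> f) = f)"
proof -
  let ?P = "compl_proj F"
  have PP: "?P (?P a) = ?P a" for a
    by (rule compl_proj_id) (rule compl_proj_sa[OF F], rule compl_proj_eval[OF F])
  have blP: "bounded_linear ?P" by (rule bounded_linear_compl_proj[OF F])
  have Pre: "?P (re a) = ?P a" for a
    using rep_set_D(2)[OF F] by (simp add: compl_proj_def characterD(3))
  obtain h :: "nat \<Rightarrow> 'a" where h: "unit_seq h" "sep_seq h" using separating_sequence[OF sep] by blast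
  obtain J where J: "bounded_linear J" "\<And>a. bern h (J a) = re a" using cantor_embedding[OF h] by blast
  obtain y z where yz: "y \<in> F" "z \<in> ccomp y" "z \<noteq> y" using nontrivial_component[OF inf F] by blast
  obtain s :: "cantor \<Rightarrow> 'a \<Rightarrow> real" and f c where sfc: "\<forall>\<omega>. s \<omega> \<in> characters" "\<forall>a. ucyl (\<lambda>\<omega>. s \<omega> a)"
    "unit_seq f" "\<forall>\<omega> n. s \<omega> (f n) = (if \<omega> n then 1 else 0)"
    "c \<in> sa" "\<forall>\<omega>. s \<omega> c = 1" "\<forall>\<psi>\<in>F. \<psi> c = 0"
    using cantor_sharp_sequence[OF sep F yz] by blast
  note s = sfc(1,2)[rule_format] and f = sfc(3) sfc(4)[rule_format] and c = sfc(5) sfc(6,7)[rule_format]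
  define r where "r a = Bcontfun (\<lambda>\<omega>. s \<omega> (?P a))" for a
  have blr: "bounded_linear r"
  proof -
    have "bounded_linear (\<lambda>a. Bcontfun (\<lambda>\<omega>. s \<omega> a))"
      by (rule bounded_linear_Bcontfun[where K=1]) (use s in \<open>auto simp: characterD\<close>)
    then show ?thesis unfolding r_def by (rule bounded_linear_compose[OF _ blP])
  qed
  have "\<exists>\<Phi> \<Psi>. bounded_linear \<Phi> \<and> bounded_linear \<Psi> \<and> (\<forall>w. \<Psi> (\<Phi> w) = ?P w) \<and> (\<forall>f::cfun. \<Phi> (\<Psi> f) = f)"
  proof (rule decomposition_method[where J="\<lambda>a. J (?P a)" and R="\<lambda>g. ?P (bern h g)"
        and j="\<lambda>g. c * bern f g" and r=r])
    show "bounded_linear (\<lambda>a. J (?P a))" by (rule bounded_linear_compose[OF J(1) blP])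
    show "bounded_linear (\<lambda>g. ?P (bern h g))"
      by (rule bounded_linear_compose[OF blP bounded_linear_bern[OF h(1)]])
    show "bounded_linear (\<lambda>g. c * bern f g)"
      by (rule bounded_linear_compose[OF bounded_linear_mult_right bounded_linear_bern[OF f(1)]])
    have Pj: "?P (c * bern f g) = c * bern f g" for g
    proof (rule compl_proj_id)
      show "c * bern f g \<in> sa" by (intro sa_mult c(1) bern_sa[OF f(1)])
      show "\<phi> (c * bern f g) = 0" if "\<phi> \<in> F" for \<phi>
        using characterD(6)[OF rep_set_D(2)[OF F that] c(1) bern_sa[OF f(1)]] c(3)[OF that] by simp
    qed
    show "?P (c * bern f g) = c * bern f g" for g by (rule Pj)
    show "r (c * bern f g) = g" for g
    proof (rule bcontfun_eqI)
      fix \<omega>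
      have "apply_bcontfun (r (c * bern f g)) \<omega> = s \<omega> (c * bern f g)"
        by (simp add: r_def Pj apply_Bcontfun[OF s(2)])
      also have "\<dots> = s \<omega> c * s \<omega> (bern f g)" by (rule characterD(6)[OF s(1) c(1) bern_sa[OF f(1)]])
      also have "s \<omega> (bern f g) = g \<omega>" by (rule bern_eval_sharp[OF f(1) s(1) f(2)])
      finally show "apply_bcontfun (r (c * bern f g)) \<omega> = g \<omega>" by (simp add: c(2))
    qed
  qed (use PP blP blr in \<open>simp_all add: J(2) Pre r_def\<close>)
  then show ?thesis by blast
qed

section \<open>The classification\<close>

lemma compl_proj_proj:
  assumes F: "rep_set F" and p: "\<phi> \<in> F"
  shows "compl_proj F (proj \<phi>) = 0"
proof -
  have "proj \<phi> = (\<Sum>\<psi>\<in>F. \<psi> (proj \<phi>) *\<^sub>R proj \<psi>)" by (rule integral_sum[OF F proj_integral[OF F p]])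
  then show ?thesis by (simp add: compl_proj_def re_sa proj_sa[OF F p])
qed

text \<open>T matches components through \<beta> and complements through \<open>cfun\<close>. Both
  sums run over \<open>F\<close>; a second instance with the algebras exchanged treats the same
  operators with sums reindexed over \<open>G\<close>. The composition is \<open>re\<close> because
  the operators live on the whole algebra and see only self-adjoint parts.\<close>

lemma linear_iso_of_components:
  fixes F :: "('a::abelian_unital_cstar_algebra \<Rightarrow> real) set"
    and G :: "('b::abelian_unital_cstar_algebra \<Rightarrow> real) set"
    and \<Phi>A :: "'a \<Rightarrow> cfun" and \<Phi>B :: "'b \<Rightarrow> cfun"
  assumes F: "rep_set F" and G: "rep_set G" and b: "bij_betw \<beta> F G"
    and A: "bounded_linear \<Phi>A" "\<And>a. \<Psi>A (\<Phi>A a) = compl_proj F a"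
    and B: "bounded_linear \<Psi>B" "\<And>b. \<Psi>B (\<Phi>B b) = compl_proj G b" "\<And>f. \<Phi>B (\<Psi>B f) = f"
    and T: "\<And>a. T a = (\<Sum>\<psi>\<in>F. \<psi> a *\<^sub>R proj (\<beta> \<psi>)) + \<Psi>B (\<Phi>A (compl_proj F a))"
    and S: "\<And>b. S b = (\<Sum>\<psi>\<in>F. \<beta> \<psi> b *\<^sub>R proj \<psi>) + \<Psi>A (\<Phi>B (compl_proj G b))"
    and cA: "\<And>f. compl_proj F (\<Psi>A f) = \<Psi>A f" and cB: "\<And>f. compl_proj G (\<Psi>B f) = \<Psi>B f"
  shows "bounded_linear T" "T a \<in> sa" "S (T a) = re a" "\<phi> \<in> F \<Longrightarrow> T (proj \<phi>) = proj (\<beta> \<phi>)"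
proof -
  have \<beta>: "\<beta> \<psi> \<in> G" if "\<psi> \<in> F" for \<psi> using b that by (auto simp: bij_betw_def)
  interpret P: bounded_linear "compl_proj F" by (rule bounded_linear_compl_proj[OF F])
  interpret PB: bounded_linear "compl_proj G" by (rule bounded_linear_compl_proj[OF G])
  interpret A: bounded_linear \<Phi>A by fact
  interpret B: bounded_linear \<Psi>B by fact
  have blT: "bounded_linear (\<lambda>a. (\<Sum>\<psi>\<in>F. \<psi> a *\<^sub>R proj (\<beta> \<psi>)) + \<Psi>B (\<Phi>A (compl_proj F a)))"
    by (intro bounded_linear_add bounded_linear_sum bounded_linear_scaleR_const bounded_linear_character
        rep_set_D(2)[OF F] bounded_linear_compose[OF B(1)] bounded_linear_compose[OF A(1)]
        bounded_linear_compl_proj[OF F])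
  then show "bounded_linear T" by (simp add: T[abs_def])
  have "\<Psi>B f \<in> sa" for f using compl_proj_sa[OF G, of "\<Psi>B f"] by (simp add: cB)
  then show "T a \<in> sa" for a
    unfolding T by (intro sa_add sa_sum sa_scaleR proj_sa[OF G] \<beta>)
  have PG: "compl_proj G (\<Sum>\<psi>\<in>F. \<psi> a *\<^sub>R proj (\<beta> \<psi>)) = 0" for a
    by (simp add: PB.sum PB.scaleR compl_proj_proj[OF G \<beta>])
  have PT: "compl_proj G (T a) = \<Psi>B (\<Phi>A (compl_proj F a))" for a
    by (simp add: T PB.add PG cB)
  have ev: "\<beta> \<phi> (T a) = \<phi> a" if p: "\<phi> \<in> F" for \<phi> a
  proof -
    have c: "\<beta> \<phi> \<in> characters" by (rule rep_set_D(2)[OF G \<beta>[OF p]])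
    have inj: "\<beta> \<phi> = \<beta> \<psi> \<longleftrightarrow> \<phi> = \<psi>" if "\<psi> \<in> F" for \<psi>
      using b p that by (auto simp: bij_betw_def dest: inj_onD)
    have "\<beta> \<phi> (\<Sum>\<psi>\<in>F. \<psi> a *\<^sub>R proj (\<beta> \<psi>)) = (\<Sum>\<psi>\<in>F. if \<phi> = \<psi> then \<psi> a else 0)"
      unfolding character_sum[OF c]
      by (intro sum.cong refl)
        (simp add: characterD(2)[OF c] proj_eval_rep[OF G \<beta> \<beta>[OF p]] inj)
    also have "\<dots> = \<phi> a" using p rep_set_D(1)[OF F] by simp
    moreover have "\<beta> \<phi> (\<Psi>B f) = 0" for f
      using compl_proj_eval[OF G \<beta>[OF p], of "\<Psi>B f"] by (simp add: cB)
    ultimately show ?thesis by (simp add: T characterD(1)[OF c])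
  qed
  show "S (T a) = re a" for a
  proof -
    have "compl_proj F (compl_proj F a) = compl_proj F a"
      using cA[of "\<Phi>A a"] by (simp add: A(2))
    then have "S (T a) = (\<Sum>\<psi>\<in>F. \<psi> a *\<^sub>R proj \<psi>) + compl_proj F a"
      using ev by (simp add: S PT B(3) A(2) cong: sum.cong_simp)
    then show ?thesis by (simp add: compl_proj_def)
  qed
  show "T (proj \<phi>) = proj (\<beta> \<phi>)" if p: "\<phi> \<in> F"
  proof -
    have "(\<Sum>\<psi>\<in>F. \<psi> (proj \<phi>) *\<^sub>R proj (\<beta> \<psi>)) = (\<Sum>\<psi>\<in>F. if \<psi> = \<phi> then proj (\<beta> \<psi>) else 0)"
      by (intro sum.cong refl) (simp add: proj_eval_rep[OF F p])
    also have "\<dots> = proj (\<beta> \<phi>)" using p rep_set_D(1)[OF F] by simp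
    finally show ?thesis by (simp add: T compl_proj_proj[OF F p] A.zero B.zero)
  qed
qed

text \<open>A linear map that respects the lattices descends along the coverings. Continuity is
  local: for v near u = uexp a the logarithm gives v = uexp (a + l) with the norm of l at most that
  of v - u.\<close>

lemma uexp_factor:
  fixes T :: "'a::abelian_unital_cstar_algebra \<Rightarrow> 'b::abelian_unital_cstar_algebra"
  assumes T: "bounded_linear T" "\<And>a. T a \<in> sa" "\<And>l. l \<in> integral_elements \<Longrightarrow> T l \<in> integral_elements"
  shows "\<exists>f. (\<forall>a\<in>sa. f (uexp a) = uexp (T a)) \<and> continuous_on U0 f"
proof -
  interpret T: bounded_linear T by fact
  define f where "f u = uexp (T (SOME a. a \<in> sa \<and> uexp a = u))" for u :: 'a
  have f: "f (uexp a) = uexp (T a)" if a: "a \<in> sa" for a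
  proof -
    define b where "b = (SOME b. b \<in> sa \<and> uexp b = uexp a)"
    have b: "b \<in> sa" "uexp b = uexp a"
      unfolding b_def using someI_ex[of "\<lambda>b. b \<in> sa \<and> uexp b = uexp a"] a by auto
    then have "T b - T a \<in> integral_elements"
      using uexp_eq_iff[OF b(1) a] T(3)[of "b - a"] by (simp add: T.diff)
    then show ?thesis using uexp_eq_iff[OF T(2) T(2)] by (simp add: f_def b_def)
  qed
  obtain K where K: "K > 0" "\<And>a. norm (T a) \<le> norm a * K" using T.pos_bounded by blast
  have "continuous_on U0 f"
  proof (rule continuous_onI)
    fix u :: 'a and e :: real assume u: "u \<in> U0" and e: "e > 0"
    obtain a where a: "a \<in> sa" "u = uexp a" using u by (auto simp: U0_eq)
    have lip: "dist (f v) (f u) \<le> 2 * pi * (norm (v - u) * K)" if v: "v \<in> U0" "norm (v - u) < 1" for v :: 'a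
    proof -
      define l where "l = ulog (uexp (- a) * v)"
      have "v \<in> unitary_elements" using v by (auto simp: U0_eq uexp_unitary)
      from uexp_near[OF this, of a] v(2)
      have l: "l \<in> sa" "uexp (a + l) = v" "norm l \<le> 1 / 4" by (simp_all add: l_def a)
      have "norm l \<le> norm (uexp l - 1)" by (rule norm_le_uexp) (use l in auto)
      also have "\<dots> = norm (uexp a * (uexp l - 1))"
        by (rule norm_unitary_mult[OF uexp_unitary, symmetric])
      also have "uexp a * (uexp l - 1) = v - u"
        using l(2) by (simp add: uexp_add a right_diff_distrib)
      finally have Tl: "norm (T l) \<le> norm (v - u) * K"
        using K(2)[of l] mult_right_mono[of "norm l" "norm (v - u)" K] K(1) by linarith
      have "dist (f v) (f u) \<le> 2 * pi * norm (T (a + l) - T a)"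
        using norm_uexp_diff_le[of "T (a + l)" "T a"] f[OF a(1)] f[OF sa_add[OF a(1) l(1)]] a(2) l(2)
        by (simp add: dist_norm)
      then have "dist (f v) (f u) \<le> 2 * pi * norm (T l)" by (simp add: T.add)
      moreover have "2 * pi * norm (T l) \<le> 2 * pi * (norm (v - u) * K)"
        using Tl by (intro mult_left_mono) auto
      ultimately show ?thesis by linarith
    qed
    define d where "d = min 1 (e / (2 * pi * K))"
    show "\<exists>d>0. \<forall>v\<in>U0. dist v u < d \<longrightarrow> dist (f v) (f u) \<le> e"
    proof (intro exI[of _ d] conjI ballI impI)
      show "d > 0" using e K(1) by (simp add: d_def)
      fix v assume v: "v \<in> U0" "dist v u < d"
      then have "norm (v - u) < 1" "norm (v - u) < e / (2 * pi * K)" by (auto simp: d_def dist_norm)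
      then show "dist (f v) (f u) \<le> e"
        using lip[OF v(1)] K(1) by (simp add: field_simps)
    qed
  qed
  then show ?thesis using f by blast
qed

lemma integral_map:
  fixes T :: "'a::abelian_unital_cstar_algebra \<Rightarrow> 'b::abelian_unital_cstar_algebra"
  assumes F: "rep_set F" and T: "bounded_linear T"
    and p: "\<And>\<phi>. \<phi> \<in> F \<Longrightarrow> T (proj \<phi>) \<in> integral_elements" and l: "l \<in> integral_elements"
  shows "T l \<in> integral_elements"
proof -
  interpret T: bounded_linear T by fact
  obtain n :: "_ \<Rightarrow> int" where n: "l = (\<Sum>\<phi>\<in>F. of_int (n \<phi>) *\<^sub>R proj \<phi>)"
    using l unfolding integral_iff[OF F] by blast
  have int: "of_int k *\<^sub>R x \<in> integral_elements" if x: "x \<in> integral_elements" for k :: int and x :: 'b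
    using x by (auto simp: integral_elements_def characterD(2) intro!: sa_scaleR)
  have sum: "sum f I \<in> integral_elements" if "\<And>i. i \<in> I \<Longrightarrow> f i \<in> integral_elements" for f :: "_ \<Rightarrow> 'b" and I
    using that by (induction I rule: infinite_finite_induct) (auto intro: integral_elements_intros)
  show ?thesis unfolding n by (simp add: T.sum T.scaleR) (intro sum int p)
qed

lemma group_iso_of_linear_iso:
  fixes T :: "'a::abelian_unital_cstar_algebra \<Rightarrow> 'b::abelian_unital_cstar_algebra"
  assumes T: "bounded_linear T" "\<And>a. T a \<in> sa" "\<And>l. l \<in> integral_elements \<Longrightarrow> T l \<in> integral_elements"
    and S: "bounded_linear S" "\<And>a. S a \<in> sa" "\<And>l. l \<in> integral_elements \<Longrightarrow> S l \<in> integral_elements"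
    and ST: "\<And>a. S (T a) = re a" and TS: "\<And>b. T (S b) = re b"
  shows "topologically_isomorphic (U0_group :: 'a monoid) (U0_group :: 'b monoid)"
proof -
  interpret T: bounded_linear T by fact
  obtain f where f: "\<And>a. a \<in> sa \<Longrightarrow> f (uexp a) = uexp (T a)" "continuous_on U0 f"
    using uexp_factor[OF T] by blast
  obtain g where g: "\<And>a. a \<in> sa \<Longrightarrow> g (uexp a) = uexp (S a)" "continuous_on U0 g"
    using uexp_factor[OF S] by blast
  have gf: "g (f u) = u" if "u \<in> U0" for u
    using that by (auto simp: U0_eq f(1) g(1) T(2) ST re_sa)
  have fg: "f (g u) = u" if "u \<in> U0" for u
    using that by (auto simp: U0_eq f(1) g(1) S(2) TS re_sa)
  have fU: "f u \<in> U0" if "u \<in> U0" for u using that T(2) by (auto simp: U0_eq f(1))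
  have gU: "g u \<in> U0" if "u \<in> U0" for u using that S(2) by (auto simp: U0_eq g(1))
  have "f \<in> iso U0_group U0_group"
    unfolding iso_def
  proof (intro CollectI conjI homI)
    fix u v :: 'a assume "u \<in> carrier U0_group" "v \<in> carrier U0_group"
    then obtain a b where ab: "a \<in> sa" "u = uexp a" "b \<in> sa" "v = uexp b"
      by (auto simp: U0_group_def U0_eq)
    have "f (u * v) = uexp (T (a + b))" using ab by (simp add: f(1) sa_add flip: uexp_add)
    also have "\<dots> = f u * f v" using ab by (simp add: f(1) T.add uexp_add)
    finally show "f (u \<otimes>\<^bsub>U0_group\<^esub> v) = f u \<otimes>\<^bsub>U0_group\<^esub> f v" by (simp add: U0_group_def)
  next
    show "bij_betw f (carrier U0_group) (carrier U0_group)"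
      by (rule bij_betw_byWitness[where f'=g]) (auto simp: U0_group_def gf fg fU gU)
  qed (simp add: U0_group_def fU)
  moreover have "homeomorphic_map (top_of_set U0) (top_of_set U0) f"
    unfolding homeomorphic_map_maps
    by (intro exI[of _ g])
       (auto simp: homeomorphic_maps_def continuous_map_in_subtopology f(2) g(2) gf fg fU gU)
  ultimately show ?thesis by (auto simp: topologically_isomorphic_def U0_group_def)
qed

text \<open>Finite generation provides the base points, and the isomorphism equates their numbers;
  any bijection between them then extends to a linear isomorphism that matches the lattices, since
  these are free on the projections.\<close>

lemma pi1_iso_imp_topologically_isomorphic:
  assumes sepA: "separable_space (euclidean :: 'a::abelian_unital_cstar_algebra topology)"
    and sepB: "separable_space (euclidean :: 'b::abelian_unital_cstar_algebra topology)"
    and infA: "infinite_dimensional TYPE('a)" and infB: "infinite_dimensional TYPE('b)"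
    and fgA: "finitely_generated (pi1_U0 TYPE('a))" and fgB: "finitely_generated (pi1_U0 TYPE('b))"
    and iso: "pi1_U0 TYPE('a) \<cong> pi1_U0 TYPE('b)"
  shows "topologically_isomorphic (U0_group :: 'a monoid) (U0_group :: 'b monoid)"
proof -
  let ?LA = "integral_group :: 'a monoid" and ?LB = "integral_group :: 'b monoid"
  have LA: "?LA \<cong> pi1_U0 TYPE('a)" and LB: "?LB \<cong> pi1_U0 TYPE('b)"
    using integral_group_iso_pi1_one by (auto simp: is_iso_def)
  have "?LA \<cong> pi1_U0 TYPE('b)" by (rule iso_trans[OF LA iso])
  then have AB: "?LA \<cong> ?LB" by (rule iso_trans[OF _ group.iso_sym[OF group_integral_group LB]])
  then obtain h where h: "h \<in> iso ?LA ?LB" by (auto simp: is_iso_def)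
  obtain k where k: "k \<in> iso ?LB ?LA"
    using group.iso_sym[OF group_integral_group AB] by (auto simp: is_iso_def)
  obtain F :: "('a \<Rightarrow> real) set" where F: "rep_set F" using rep_set_exists[OF fgA] by blast
  obtain G :: "('b \<Rightarrow> real) set" where G: "rep_set G" using rep_set_exists[OF fgB] by blast
  have "card F = card G"
    using card_rep_set_le[OF F G h] card_rep_set_le[OF G F k] by simp
  then obtain \<beta> where \<beta>: "bij_betw \<beta> F G"
    using finite_same_card_bij[OF rep_set_D(1)[OF F] rep_set_D(1)[OF G]] by blast
  define \<gamma> where "\<gamma> = inv_into F \<beta>"
  have \<gamma>: "bij_betw \<gamma> G F" unfolding \<gamma>_def by (rule bij_betw_inv_into[OF \<beta>])
  obtain \<Phi>A :: "'a \<Rightarrow> cfun" and \<Psi>A where A: "bounded_linear \<Phi>A" "bounded_linear \<Psi>A"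
    "\<And>a. \<Psi>A (\<Phi>A a) = compl_proj F a" "\<And>f. \<Phi>A (\<Psi>A f) = f"
    using complement_iso_cfun[OF sepA infA F] by blast
  obtain \<Phi>B :: "'b \<Rightarrow> cfun" and \<Psi>B where B: "bounded_linear \<Phi>B" "bounded_linear \<Psi>B"
    "\<And>b. \<Psi>B (\<Phi>B b) = compl_proj G b" "\<And>f. \<Phi>B (\<Psi>B f) = f"
    using complement_iso_cfun[OF sepB infB G] by blast
  have cA: "compl_proj F (\<Psi>A f) = \<Psi>A f" for f using A(3)[of "\<Psi>A f"] by (simp add: A(4))
  have cB: "compl_proj G (\<Psi>B f) = \<Psi>B f" for f using B(3)[of "\<Psi>B f"] by (simp add: B(4))
  define T where "T a = (\<Sum>\<psi>\<in>F. \<psi> a *\<^sub>R proj (\<beta> \<psi>)) + \<Psi>B (\<Phi>A (compl_proj F a))" for a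
  define S where "S b = (\<Sum>\<psi>\<in>G. \<psi> b *\<^sub>R proj (\<gamma> \<psi>)) + \<Psi>A (\<Phi>B (compl_proj G b))" for b
  have S': "S b = (\<Sum>\<psi>\<in>F. \<beta> \<psi> b *\<^sub>R proj \<psi>) + \<Psi>A (\<Phi>B (compl_proj G b))" for b
    unfolding S_def sum.reindex_bij_betw[OF \<beta>, symmetric]
    using bij_betw_inv_into_left[OF \<beta>] by (simp add: \<gamma>_def cong: sum.cong_simp)
  have T': "T a = (\<Sum>\<psi>\<in>G. \<gamma> \<psi> a *\<^sub>R proj \<psi>) + \<Psi>B (\<Phi>A (compl_proj F a))" for a
    unfolding T_def sum.reindex_bij_betw[OF \<gamma>, symmetric]
    using bij_betw_inv_into_right[OF \<beta>] by (simp add: \<gamma>_def cong: sum.cong_simp)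
  note t = linear_iso_of_components[OF F G \<beta> A(1,3) B(2,3,4) T_def S' cA cB]
  note s = linear_iso_of_components[OF G F \<gamma> B(1,3) A(2,3,4) S_def T' cB cA]
  show ?thesis
  proof (rule group_iso_of_linear_iso[OF t(1,2) _ s(1,2) _ t(3) s(3)])
    show "T l \<in> integral_elements" if "l \<in> integral_elements" for l
    proof (rule integral_map[OF F t(1) _ that])
      fix \<phi> assume p: "\<phi> \<in> F"
      then have "\<beta> \<phi> \<in> G" using \<beta> by (rule bij_betwE[THEN bspec, rotated])
      then show "T (proj \<phi>) \<in> integral_elements" unfolding t(4)[OF p] by (rule proj_integral[OF G])
    qed
    show "S l \<in> integral_elements" if "l \<in> integral_elements" for l
    proof (rule integral_map[OF G s(1) _ that])
      fix \<phi> assume p: "\<phi> \<in> G"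
      then have "\<gamma> \<phi> \<in> F" using \<gamma> by (rule bij_betwE[THEN bspec, rotated])
      then show "S (proj \<phi>) \<in> integral_elements" unfolding s(4)[OF p] by (rule proj_integral[OF F])
    qed
  qed
qed

theorem theorem4p9:
  assumes "separable_space (euclidean :: 'a::abelian_unital_cstar_algebra topology)"
    and "separable_space (euclidean :: 'b::abelian_unital_cstar_algebra topology)"
    and "infinite_dimensional TYPE('a)"
    and "infinite_dimensional TYPE('b)"
    and "finitely_generated (pi1_U0 TYPE('a))"
    and "finitely_generated (pi1_U0 TYPE('b))"
  shows "topologically_isomorphic (U0_group :: 'a monoid) (U0_group :: 'b monoid) \<longleftrightarrow>
    pi1_U0 TYPE('a) \<cong> pi1_U0 TYPE('b)"
  using topologically_isomorphic_imp_pi1_iso pi1_iso_imp_topologically_isomorphic[OF assms] by blast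

end
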